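(* Let $A$ be a separable purely infinite simple C$^*$-algebra, and assume that $\rho\in\mathrm{End}(A)_0$ is irreducible and $d(\rho)>1$. Then $\rho$ is properly outer.
   Context: For an inclusion of C$^*$-algebras $A\supset B$ with a conditional expectation $E:A\to B$, the index $\mathrm{Ind}\,E$ is the best (smallest) constant $\lambda\ge 1$ such that $E-\lambda^{-1}\mathrm{id}:A\to A$ is positive ($\mathrm{Ind}\,E=\infty$ if there is none). $\mathrm{End}(A)_0$ is the set of ($*$-)endomorphisms $\rho$ of $A$ whose image has finite index, i.e. there is a conditional expectation $A\to\rho(A)$ of finite index. $\rho$ is irreducible if $M(A)\cap\rho(A)'=\mathbb{C}1$, where $M(A)$ is the multiplier algebra. The statistical dimension is $d(\rho)=[A:\rho(A)]_0^{1/2}$, where $[A:\rho(A)]_0$ is the minimum of $\mathrm{Ind}\,E$ over the conditional expectations $E:A\to\rho(A)$ (when $\rho$ is irreducible there is only one conditional expectation). An endomorphism $\rho$ of $A$ is properly outer if for any $a\in A$ and any non-zero hereditary C$^*$-subalgebra $C$ of $A$, $\inf\{\|ca\rho(c)\| : c\in C_+,\ \|c\|=1\}=0$, where $C_+$ is the set of positive elements of $C$. *)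

theory Defs
  imports "HOL-Analysis.Analysis"
begin

class scaleC =
  fixes scaleC :: "complex \<Rightarrow> 'a \<Rightarrow> 'a"  (infixr \<open>*\<^sub>C\<close> 75)

class star =
  fixes star :: "'a \<Rightarrow> 'a"

text \<open>
  Complex C*-algebras, not assumed unital. The real scalar multiplication of the
  library classes is the restriction of the complex one; together with
  \<open>real_normed_algebra\<close> and \<open>banach\<close> this gives a complex Banach algebra.
\<close>

class cstar_algebra = real_normed_algebra + banach + scaleC + star +
  assumes scaleR_scaleC: "r *\<^sub>R x = complex_of_real r *\<^sub>C x"
    and scaleC_add_right: "c *\<^sub>C (x + y) = c *\<^sub>C x + c *\<^sub>C y"
    and scaleC_add_left: "(c + d) *\<^sub>C x = c *\<^sub>C x + d *\<^sub>C x"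
    and scaleC_scaleC: "c *\<^sub>C d *\<^sub>C x = (c * d) *\<^sub>C x"
    and mult_scaleC_left: "(c *\<^sub>C x) * y = c *\<^sub>C (x * y)"
    and mult_scaleC_right: "x * (c *\<^sub>C y) = c *\<^sub>C (x * y)"
    and norm_scaleC: "norm (c *\<^sub>C x) = cmod c * norm x"
    and star_star: "star (star x) = x"
    and star_add: "star (x + y) = star x + star y"
    and star_scaleC: "star (c *\<^sub>C x) = cnj c *\<^sub>C star x"
    and star_mult: "star (x * y) = star y * star x"
    and cstar_identity: "norm (star x * x) = (norm x)\<^sup>2"

global_interpretation cvec: vector_space "scaleC :: complex \<Rightarrow> 'a \<Rightarrow> 'a::cstar_algebra"
proof
  fix x :: 'a
  have "(1::complex) *\<^sub>C x = 1 *\<^sub>R x"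
    by (simp only: scaleR_scaleC of_real_1)
  then show "(1::complex) *\<^sub>C x = x" by simp
qed (simp_all add: scaleC_add_right scaleC_add_left scaleC_scaleC)

definition clinear :: "('a::cstar_algebra \<Rightarrow> 'a) \<Rightarrow> bool" where
  "clinear f \<longleftrightarrow> Vector_Spaces.linear scaleC scaleC f"

definition cstar_subalgebra :: "'a::cstar_algebra set \<Rightarrow> bool" where
  "cstar_subalgebra B \<longleftrightarrow> cvec.subspace B \<and> closed B \<and>
     (\<forall>x\<in>B. \<forall>y\<in>B. x * y \<in> B) \<and> (\<forall>x\<in>B. star x \<in> B)"

text \<open>The positive elements of a C*-subalgebra \<open>B\<close>.\<close>

definition pos_cone :: "'a::cstar_algebra set \<Rightarrow> 'a set" where
  "pos_cone B = {star x * x | x. x \<in> B}"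

definition cstar_le :: "'a::cstar_algebra \<Rightarrow> 'a \<Rightarrow> bool" where
  "cstar_le a b \<longleftrightarrow> b - a \<in> pos_cone UNIV"

definition positive_map :: "('a::cstar_algebra \<Rightarrow> 'a) \<Rightarrow> bool" where
  "positive_map f \<longleftrightarrow> f ` pos_cone UNIV \<subseteq> pos_cone UNIV"

definition hereditary_subalgebra :: "'a::cstar_algebra set \<Rightarrow> bool" where
  "hereditary_subalgebra C \<longleftrightarrow> cstar_subalgebra C \<and>
     (\<forall>a\<in>pos_cone UNIV. \<forall>c\<in>pos_cone C. cstar_le a c \<longrightarrow> a \<in> C)"

definition closed_ideal :: "'a::cstar_algebra set \<Rightarrow> bool" where
  "closed_ideal I \<longleftrightarrow> cvec.subspace I \<and> closed I \<and>
     (\<forall>a. \<forall>x\<in>I. a * x \<in> I \<and> x * a \<in> I)"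

definition simple_cstar :: "'a::cstar_algebra itself \<Rightarrow> bool" where
  "simple_cstar _ \<longleftrightarrow> (UNIV :: 'a set) \<noteq> {0} \<and>
     (\<forall>I :: 'a set. closed_ideal I \<longrightarrow> I = {0} \<or> I = UNIV)"

definition cprojection :: "'a::cstar_algebra \<Rightarrow> bool" where
  "cprojection p \<longleftrightarrow> star p = p \<and> p * p = p"

text \<open>A projection that is Murray-von Neumann equivalent to a proper subprojection.\<close>

definition infinite_projection :: "'a::cstar_algebra \<Rightarrow> bool" where
  "infinite_projection p \<longleftrightarrow> cprojection p \<and>
     (\<exists>q v. cprojection q \<and> cstar_le q p \<and> q \<noteq> p \<and> star v * v = p \<and> v * star v = q)"

text \<open>Cuntz's definition, used for simple C*-algebras.\<close>

definition purely_infinite :: "'a::cstar_algebra itself \<Rightarrow> bool" where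
  "purely_infinite _ \<longleftrightarrow>
     (\<forall>C :: 'a set. hereditary_subalgebra C \<and> C \<noteq> {0} \<longrightarrow> (\<exists>p\<in>C. infinite_projection p))"

definition star_endomorphism :: "('a::cstar_algebra \<Rightarrow> 'a) \<Rightarrow> bool" where
  "star_endomorphism \<rho> \<longleftrightarrow> clinear \<rho> \<and>
     (\<forall>x y. \<rho> (x * y) = \<rho> x * \<rho> y) \<and> (\<forall>x. \<rho> (star x) = star (\<rho> x))"

definition conditional_expectation :: "('a::cstar_algebra \<Rightarrow> 'a) \<Rightarrow> 'a set \<Rightarrow> bool" where
  "conditional_expectation E B \<longleftrightarrow> clinear E \<and> positive_map E \<and>
     (\<forall>x. norm (E x) \<le> norm x) \<and> range E \<subseteq> B \<and> (\<forall>b\<in>B. E b = b) \<and>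
     (\<forall>b\<in>B. \<forall>x. E (b * x) = b * E x \<and> E (x * b) = E x * b)"

text \<open>
  The infimum is \<open>\<infinity>\<close> if there is no admissible \<open>\<lambda>\<close>; otherwise it is attained, since
  the positive elements form a closed set.
\<close>

definition Ind :: "('a::cstar_algebra \<Rightarrow> 'a) \<Rightarrow> ereal" where
  "Ind E = Inf {ereal l | l. l \<ge> 1 \<and> positive_map (\<lambda>x. E x - inverse l *\<^sub>R x)}"

definition min_index :: "'a::cstar_algebra set \<Rightarrow> ereal" where
  "min_index B = Inf {Ind E | E. conditional_expectation E B}"

definition End0 :: "('a::cstar_algebra \<Rightarrow> 'a) set" where
  "End0 = {\<rho>. star_endomorphism \<rho> \<and> (\<exists>E. conditional_expectation E (range \<rho>) \<and> Ind E < \<infinity>)}"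

text \<open>Only meaningful on \<open>End0\<close>, where the minimal index is finite.\<close>

definition stat_dim :: "('a::cstar_algebra \<Rightarrow> 'a) \<Rightarrow> real" where
  "stat_dim \<rho> = sqrt (real_of_ereal (min_index (range \<rho>)))"

text \<open>
  The multiplier algebra as the algebra of double centralizers \<open>(L, R)\<close>: the
  product is \<open>(L\<^sub>1 \<circ> L\<^sub>2, R\<^sub>2 \<circ> R\<^sub>1)\<close>, and \<open>a\<close> is embedded as the pair of its left and right
  multiplications.
\<close>

type_synonym 'a double_centralizer = "('a \<Rightarrow> 'a) \<times> ('a \<Rightarrow> 'a)"

definition multiplier_algebra :: "'a::cstar_algebra double_centralizer set" where
  "multiplier_algebra = {(L, R).
     clinear L \<and> bounded_linear L \<and> clinear R \<and> bounded_linear R \<and>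
     (\<forall>x y. L (x * y) = L x * y) \<and> (\<forall>x y. R (x * y) = x * R y) \<and>
     (\<forall>x y. R x * y = x * L y)}"

definition mult_M :: "'a double_centralizer \<Rightarrow> 'a double_centralizer \<Rightarrow> 'a double_centralizer" where
  "mult_M m n = (fst m \<circ> fst n, snd n \<circ> snd m)"

definition embed_M :: "'a::cstar_algebra \<Rightarrow> 'a double_centralizer" where
  "embed_M a = (\<lambda>x. a * x, \<lambda>x. x * a)"

definition scalar_M :: "complex \<Rightarrow> 'a::cstar_algebra double_centralizer" where
  "scalar_M c = (\<lambda>x. c *\<^sub>C x, \<lambda>x. c *\<^sub>C x)"

definition irreducible_endo :: "('a::cstar_algebra \<Rightarrow> 'a) \<Rightarrow> bool" where
  "irreducible_endo \<rho> \<longleftrightarrow>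
     {m \<in> multiplier_algebra. \<forall>b\<in>range \<rho>. mult_M m (embed_M b) = mult_M (embed_M b) m}
       = range scalar_M"

definition properly_outer :: "('a::cstar_algebra \<Rightarrow> 'a) \<Rightarrow> bool" where
  "properly_outer \<rho> \<longleftrightarrow>
     (\<forall>a. \<forall>C. hereditary_subalgebra C \<and> C \<noteq> {0} \<longrightarrow>
        Inf {norm (c * a * \<rho> c) | c. c \<in> pos_cone C \<and> norm c = 1} = 0)"

end

theory Submission
  imports Defs
begin

text \<open>
  If \<open>\<rho>\<close> is not properly outer, there are \<open>a\<close>, a projection \<open>P\<close> and \<open>\<delta> > 0\<close> with
  \<open>\<parallel>q a \<rho>(q)\<parallel> \<ge> \<delta>\<close> for all non-zero projections \<open>q \<le> P\<close>. Choose \<open>p \<le> P\<close> for which \<open>\<parallel>p a \<rho>(p)\<parallel>\<close> is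
  almost minimal. Then \<open>c = p a \<rho>(p)\<close> has small off-diagonal parts, so it almost intertwines
  projections and hence all of \<open>pAp\<close>; transported by an isometry \<open>P \<rightarrow> p\<close>, it almost intertwines
  \<open>PAP\<close>. Iterating this gives a norm-convergent sequence whose limit \<open>b \<noteq> 0\<close> satisfies
  \<open>x b = b \<rho>(x)\<close> on \<open>PAP\<close>. Up to scaling, \<open>b b\<^sup>* = P\<close> and \<open>b\<^sup>* b\<close> is a projection commuting with
  \<open>\<rho>(PAP)\<close>; irreducibility forces \<open>b\<^sup>* b = \<rho>(P)\<close>, so \<open>\<rho>(P) A \<rho>(P) \<subseteq> \<rho>(A)\<close>. Finite index makes
  \<open>\<rho>(A) \<rho>(P) A\<close> dense, hence the conditional expectation is the identity and the index is \<open>1\<close>.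

  Spectral theory is replaced throughout by square roots \<open>1 - c\<close> of \<open>1 - x\<close>, \<open>\<parallel>x\<parallel> \<le> 1\<close>.
\<close>

section \<open>Square roots and positive elements\<close>

text \<open>Pure infiniteness supplies projections in hereditary subalgebras, not approximations by
  combinations of them; the passage from projections to all of \<open>P A P\<close> is therefore
  algebraic. A partial isometry with orthogonal source and range is a combination of projections, a
  contraction between orthogonal copies of \<open>P\<close> is an average of two such isometries,
  and an element of \<open>P A P\<close> becomes a product of two off-diagonal contractions once it
  sits in a corner with room for several copies of \<open>P\<close>. Two obstacles fix the rest. The
  near-minimal \<open>p\<close> depends on the tolerance; compressing by an isometry with source
  \<open>P\<close> brings every estimate back to one corner, and the lower bound \<delta> survives
  this, so the limit is non-zero. Irreducibility speaks of multipliers of all of \<open>A\<close>,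
  while the intertwiner yields a projection in a corner; extending it requires density, which comes
  from the inequality x \<le> l E(x) for positive x (Pimsner-Popa).\<close>

lemma star_zero [simp]: "star (0 :: 'a::cstar_algebra) = 0"
  using star_add[of "0::'a" 0] by simp

lemma star_minus: "star (- x) = - star (x :: 'a::cstar_algebra)"
  using star_add[of x "- x"] by (simp add: eq_neg_iff_add_eq_0 add.commute)

lemma star_diff: "star (x - y) = star x - star (y :: 'a::cstar_algebra)"
  using star_add[of x "- y"] by (simp add: star_minus)

lemma star_scaleR: "star (r *\<^sub>R x) = r *\<^sub>R star (x :: 'a::cstar_algebra)"
  by (simp add: scaleR_scaleC star_scaleC)

lemma star_sum: "star (sum f I) = (\<Sum>i\<in>I. star (f i :: 'a::cstar_algebra))"
  by (induction I rule: infinite_finite_induct) (simp_all add: star_add)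

lemmas star_simps = star_star star_add star_minus star_diff star_scaleR star_mult

lemma norm_star [simp]: "norm (star x) = norm (x :: 'a::cstar_algebra)"
proof -
  have le: "norm y \<le> norm (star y)" for y :: 'a
  proof (cases "y = 0")
    case False
    have "norm y * norm y \<le> norm (star y) * norm y"
      using cstar_identity[of y] norm_mult_ineq[of "star y" y] by (simp add: power2_eq_square)
    then show ?thesis using False by simp
  qed simp
  from le[of x] le[of "star x"] show ?thesis by (simp add: star_star)
qed

lemma cstar_identity': "norm (x * star x) = (norm (x :: 'a::cstar_algebra))\<^sup>2"
  using cstar_identity[of "star x"] by (simp add: star_star)

lemma norm_sa_square: "star s = s \<Longrightarrow> norm (s * s) = (norm (s :: 'a::cstar_algebra))\<^sup>2"
  using cstar_identity[of s] by simp

lemma star_mult_self_eq_0 [simp]: "star x * x = 0 \<longleftrightarrow> x = (0 :: 'a::cstar_algebra)"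
  using cstar_identity[of x] by auto

lemma bounded_linear_star: "bounded_linear (star :: 'a::cstar_algebra \<Rightarrow> 'a)"
  by (rule bounded_linear_intro[where K = 1]) (simp_all add: star_add star_scaleR)

lemmas continuous_on_star [continuous_intros] =
  bounded_linear.continuous_on[OF bounded_linear_star]
lemmas tendsto_star [tendsto_intros] = bounded_linear.tendsto[OF bounded_linear_star]

text \<open>
  \<open>1 - c\<close> is a square root of \<open>1 - x\<close>, written without the unit. The iteration
  \<open>c \<mapsto> (x + c\<^sup>2) / 2\<close> is dominated by the same iteration for the real number \<open>1\<close>.
\<close>

lemma sqrt_iteration:
  fixes x :: "'a::{real_normed_algebra,banach}"
  assumes "norm x \<le> 1"
  obtains c where "c + c = x + c * c" "norm c \<le> 1"
    "\<And>S. closed S \<Longrightarrow> 0 \<in> S \<Longrightarrow> (\<And>y. y \<in> S \<Longrightarrow> (1/2) *\<^sub>R (x + y * y) \<in> S) \<Longrightarrow> c \<in> S"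
proof -
  define s where "s n = ((\<lambda>y. (1/2) *\<^sub>R (x + y * y)) ^^ n) 0" for n
  define r where "r n = ((\<lambda>t. (1 + t * t) / 2) ^^ n) (0::real)" for n
  have s0: "s 0 = 0" and sS: "s (Suc n) = (1/2) *\<^sub>R (x + s n * s n)" for n
    by (simp_all add: s_def)
  have r0: "r 0 = 0" and rS: "r (Suc n) = (1 + r n * r n) / 2" for n
    by (simp_all add: r_def)
  have r01: "0 \<le> r n \<and> r n \<le> 1" for n
  proof (induction n)
    case (Suc n)
    then have "r n * r n \<le> 1 * 1" by (intro mult_mono) auto
    then show ?case by (simp add: rS)
  qed (simp add: r0)
  have rmono: "r n \<le> r (Suc n)" for n
  proof (induction n)
    case (Suc n)
    then have "r n * r n \<le> r (Suc n) * r (Suc n)" using r01[of n] by (intro mult_mono) auto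
    then show ?case by (simp add: rS)
  qed (simp add: r0 rS)
  have sle: "norm (s n) \<le> r n" for n
  proof (induction n)
    case (Suc n)
    have "norm (s n * s n) \<le> r n * r n"
      using Suc r01[of n] by (intro order_trans[OF norm_mult_ineq] mult_mono) auto
    then have "norm (x + s n * s n) \<le> 1 + r n * r n"
      using assms norm_triangle_ineq[of x "s n * s n"] by linarith
    then show ?case by (simp add: sS rS)
  qed (simp add: s0 r0)
  have sdiff: "norm (s (Suc n) - s n) \<le> r (Suc n) - r n" for n
  proof (induction n)
    case 0
    then show ?case using assms by (simp add: s0 sS r0 rS)
  next
    case (Suc n)
    have eq: "s (Suc (Suc n)) - s (Suc n)
        = (1/2) *\<^sub>R (s (Suc n) * (s (Suc n) - s n) + (s (Suc n) - s n) * s n)"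
      unfolding sS[of "Suc n"] sS[of n] by (simp add: algebra_simps)
    have "norm (s (Suc n) * (s (Suc n) - s n) + (s (Suc n) - s n) * s n)
        \<le> norm (s (Suc n)) * norm (s (Suc n) - s n) + norm (s (Suc n) - s n) * norm (s n)"
      by (intro order_trans[OF norm_triangle_ineq] add_mono norm_mult_ineq)
    also have "\<dots> \<le> r (Suc n) * (r (Suc n) - r n) + (r (Suc n) - r n) * r n"
      using Suc sle r01 rmono by (intro add_mono mult_mono) auto
    also have "\<dots> = 2 * (r (Suc (Suc n)) - r (Suc n))"
      unfolding rS[of "Suc n"] by (subst (4) rS) (simp add: algebra_simps)
    finally show ?case unfolding eq by simp
  qed
  have sdist: "norm (s (n + k) - s n) \<le> r (n + k) - r n" for n k
  proof (induction k)
    case (Suc k)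
    have "norm (s (n + Suc k) - s n) \<le> norm (s (Suc (n + k)) - s (n + k)) + norm (s (n + k) - s n)"
      using norm_triangle_ineq[of "s (Suc (n + k)) - s (n + k)" "s (n + k) - s n"] by simp
    then show ?case using Suc sdiff[of "n + k"] by simp
  qed simp
  have "Cauchy r"
    using r01 rmono by (intro convergent_Cauchy Bseq_mono_convergent BseqI'[where K = 1])
      (auto intro: lift_Suc_mono_le)
  then have "Cauchy s"
    unfolding Cauchy_altdef2
  proof (intro allI impI)
    fix e :: real assume r: "\<forall>e>0. \<exists>N. \<forall>n\<ge>N. dist (r n) (r N) < e" and "e > 0"
    then obtain N where N: "\<And>n. n \<ge> N \<Longrightarrow> dist (r n) (r N) < e" by blast
    have "dist (s n) (s N) < e" if "n \<ge> N" for n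
      using sdist[of N "n - N"] N[OF that] that by (simp add: dist_norm)
    then show "\<exists>N. \<forall>n\<ge>N. dist (s n) (s N) < e" by blast
  qed
  then obtain c where c: "s \<longlonglongrightarrow> c"
    by (auto simp: Cauchy_convergent_iff convergent_def)
  have "(\<lambda>n. s (Suc n)) \<longlonglongrightarrow> (1/2) *\<^sub>R (x + c * c)"
    unfolding sS by (intro tendsto_intros c)
  with c have cc: "c = (1/2) *\<^sub>R (x + c * c)"
    by (metis LIMSEQ_Suc LIMSEQ_unique)
  show thesis
  proof
    show "c + c = x + c * c"
      by (subst (1 2) cc) (simp flip: scaleR_add_left)
    show "norm c \<le> 1"
      using tendsto_norm[OF c] by (rule LIMSEQ_le_const2) (use sle r01 order_trans in blast)
    fix S assume S: "closed S" "0 \<in> S" "\<And>y. y \<in> S \<Longrightarrow> (1/2) *\<^sub>R (x + y * y) \<in> S"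
    have "s n \<in> S" for n by (induction n) (use S in \<open>auto simp: s0 sS\<close>)
    then show "c \<in> S" using c S(1) closed_sequentially by blast
  qed
qed

lemma closed_sa: "closed {z :: 'a::cstar_algebra. star z = z}"
  by (intro closed_Collect_eq continuous_on_star continuous_on_id)

lemma closed_commutant: "closed {z :: 'a::real_normed_algebra. y * z = z * y}"
  by (intro closed_Collect_eq continuous_on_mult continuous_on_id continuous_on_const)

lemma closed_left_fixed: "closed {z :: 'a::real_normed_algebra. y * z = z}"
  by (intro closed_Collect_eq continuous_on_mult continuous_on_id continuous_on_const)

text \<open>The self-adjoint elements, the commutant of \<open>y\<close> and the elements fixed
  under left multiplication by \<open>y\<close> form closed sets containing 0; each is stable under
  the iteration step once it contains \<open>x\<close>, so the limit inherits the property.\<close>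

lemma sqrt_iteration_sa:
  fixes x :: "'a::cstar_algebra"
  assumes "norm x \<le> 1" "star x = x"
  obtains c where "c + c = x + c * c" "norm c \<le> 1" "star c = c"
    "\<And>y. y * x = x * y \<Longrightarrow> y * c = c * y" "\<And>y. y * x = x \<Longrightarrow> y * c = c"
proof -
  obtain c where c: "c + c = x + c * c" "norm c \<le> 1"
    "\<And>S. closed S \<Longrightarrow> 0 \<in> S \<Longrightarrow> (\<And>y. y \<in> S \<Longrightarrow> (1/2) *\<^sub>R (x + y * y) \<in> S) \<Longrightarrow> c \<in> S"
    using sqrt_iteration[OF assms(1)] by blast
  have sa: "star c = c"
    using c(3)[OF closed_sa] by (simp add: star_simps assms(2))
  have comm: "y * c = c * y" if "y * x = x * y" for y
  proof -
    have "y * ((1/2) *\<^sub>R (x + z * z)) = (1/2) *\<^sub>R (x + z * z) * y" if z: "y * z = z * y" for z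
    proof -
      have "y * (z * z) = z * z * y" using z by (metis mult.assoc)
      then show ?thesis using \<open>y * x = x * y\<close> by (simp add: distrib_left distrib_right)
    qed
    then show ?thesis using c(3)[OF closed_commutant, of y] by simp
  qed
  have fixed: "y * c = c" if "y * x = x" for y
    using c(3)[OF closed_left_fixed, of y] that by (simp add: distrib_left flip: mult.assoc)
  show thesis by (rule that[OF c(1,2) sa comm fixed])
qed

section \<open>Order and square roots in unital C*-algebras\<close>

class unital_cstar_algebra = cstar_algebra + real_normed_algebra_1

lemma star_one [simp]: "star (1 :: 'a::unital_cstar_algebra) = 1"
  by (metis mult_1_right star_mult star_star)

text \<open>The working form of positivity: squares of self-adjoint elements can be handled by norm
  estimates alone. It agrees with \<open>pos_cone UNIV\<close>, the hard half of this being
  \<open>sa_square_star_mult\<close>.\<close>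

definition sa_square :: "'a::cstar_algebra \<Rightarrow> bool" where
  "sa_square a \<longleftrightarrow> (\<exists>s. star s = s \<and> a = s * s)"

lemma sa_square_star: "sa_square a \<Longrightarrow> star a = a"
  by (auto simp: sa_square_def star_mult)

lemma sa_squareI: "star s = s \<Longrightarrow> sa_square (s * s)"
  by (auto simp: sa_square_def)

lemma sa_square_scaleR: "sa_square a \<Longrightarrow> 0 \<le> r \<Longrightarrow> sa_square (r *\<^sub>R a)"
  unfolding sa_square_def
proof (elim exE conjE)
  fix s assume "star s = s" "a = s * s" "0 \<le> r"
  then show "\<exists>s. star s = s \<and> r *\<^sub>R a = s * s"
    by (intro exI[of _ "sqrt r *\<^sub>R s"]) (simp add: star_scaleR)
qed

text \<open>The element s + i r is normal, \<open>star ?z * ?z\<close> is the sum of squares, and an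
  imaginary part never exceeds its element in norm.\<close>

lemma norm_le_commuting_squares:
  fixes s r :: "'a::cstar_algebra"
  assumes "star s = s" "star r = r" "s * r = r * s"
  shows "(norm r)\<^sup>2 \<le> norm (s * s + r * r)"
proof -
  let ?z = "s + \<i> *\<^sub>C r"
  have st: "star ?z = s - \<i> *\<^sub>C r"
    by (simp add: star_add star_scaleC assms)
  have "star ?z * ?z = s * s + r * r"
    unfolding st by (simp add: algebra_simps mult_scaleC_left mult_scaleC_right scaleC_scaleC assms)
  then have N: "(norm ?z)\<^sup>2 = norm (s * s + r * r)"
    using cstar_identity[of ?z] by simp
  have "?z - star ?z = (2 * \<i>) *\<^sub>C r"
    unfolding st by (simp add: cvec.scale_left_distrib[symmetric])
  then have "2 * norm r = norm (?z - star ?z)"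
    by (simp add: norm_scaleC norm_mult)
  also have "\<dots> \<le> norm ?z + norm (star ?z)" by (rule norm_triangle_ineq4)
  finally have "norm r \<le> norm ?z" by simp
  then have "(norm r)\<^sup>2 \<le> (norm ?z)\<^sup>2" by (intro power_mono) auto
  with N show ?thesis by simp
qed

text \<open>The norm condition says that the spectrum of \<open>a\<close> lies in [0, 2t]; after
  division by \<open>t\<close> the element is 1 - x with x a contraction. The bound on the root
  repeats the condition with \<open>sqrt t\<close>, so the root is positive as well.\<close>

lemma sa_sqrt:
  fixes a :: "'a::unital_cstar_algebra"
  assumes "star a = a" "norm (t *\<^sub>R 1 - a) \<le> t"
  obtains s where "star s = s" "s * s = a" "norm (sqrt t *\<^sub>R 1 - s) \<le> sqrt t"
    "\<And>y. y * a = a * y \<Longrightarrow> y * s = s * y"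
proof (cases "t = 0")
  case True
  with assms have "a = 0" by simp
  with True show thesis by (intro that[of 0]) auto
next
  case False
  moreover have "0 \<le> t" using assms(2) norm_ge_zero order_trans by blast
  ultimately have t: "t > 0" by simp
  let ?x = "1 - (1/t) *\<^sub>R a"
  have x: "t *\<^sub>R ?x = t *\<^sub>R 1 - a" using t by (simp add: scaleR_diff_right)
  then have "t * norm ?x \<le> t" using assms(2) t by (metis abs_of_pos norm_scaleR)
  then have "norm ?x \<le> 1" using t by simp
  moreover have "star ?x = ?x" by (simp add: star_simps assms)
  ultimately obtain c where c: "c + c = ?x + c * c" "norm c \<le> 1" "star c = c"
    "\<And>y. y * ?x = ?x * y \<Longrightarrow> y * c = c * y" using sqrt_iteration_sa by blast
  have sq: "(1 - c) * (1 - c) = (1/t) *\<^sub>R a"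
    using c(1) by (simp add: algebra_simps)
  show thesis
  proof (rule that[of "sqrt t *\<^sub>R (1 - c)"])
    show "star (sqrt t *\<^sub>R (1 - c)) = sqrt t *\<^sub>R (1 - c)" by (simp add: star_simps c)
    show "sqrt t *\<^sub>R (1 - c) * sqrt t *\<^sub>R (1 - c) = a" using t by (simp add: sq)
    have "sqrt t *\<^sub>R 1 - sqrt t *\<^sub>R (1 - c) = sqrt t *\<^sub>R c" by (simp add: scaleR_diff_right)
    then show "norm (sqrt t *\<^sub>R 1 - sqrt t *\<^sub>R (1 - c)) \<le> sqrt t"
      using c(2) t by (simp add: mult_left_le)
    fix y assume "y * a = a * y"
    then have "y * c = c * y" by (intro c(4)) (simp add: algebra_simps)
    then show "y * sqrt t *\<^sub>R (1 - c) = sqrt t *\<^sub>R (1 - c) * y" by (simp add: algebra_simps)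
  qed
qed

lemma sa_squareI_norm:
  "star a = a \<Longrightarrow> norm (t *\<^sub>R 1 - a) \<le> t \<Longrightarrow> sa_square (a :: 'a::unital_cstar_algebra)"
  by (metis sa_sqrt sa_square_def)

text \<open>Converse of the norm criterion for positivity. The criterion applies to
  \<open>t *\<^sub>R 1 - s * s\<close> and gives a root \<open>r\<close> commuting with
  \<open>s\<close>; then s s + r r is the scalar \<open>t\<close>, which bounds
  \<open>r\<close>.\<close>

lemma norm_one_diff_square:
  fixes s :: "'a::unital_cstar_algebra"
  assumes "star s = s" "(norm s)\<^sup>2 \<le> t"
  shows "norm (t *\<^sub>R 1 - s * s) \<le> t"
proof -
  have "norm (t *\<^sub>R 1 - (t *\<^sub>R 1 - s * s)) \<le> t"
    using assms by (simp add: norm_sa_square)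
  moreover have "star (t *\<^sub>R 1 - s * s) = t *\<^sub>R 1 - s * s" by (simp add: star_simps assms)
  ultimately obtain r where r: "star r = r" "r * r = t *\<^sub>R 1 - s * s"
    and comm: "\<And>y. y * (t *\<^sub>R 1 - s * s) = (t *\<^sub>R 1 - s * s) * y \<Longrightarrow> y * r = r * y"
    using sa_sqrt by metis
  have "0 \<le> t" using assms(2) zero_le_power2 order_trans by blast
  have "s * r = r * s" by (rule comm) (simp add: algebra_simps)
  from norm_le_commuting_squares[OF assms(1) r(1) this] have "(norm r)\<^sup>2 \<le> t"
    using \<open>0 \<le> t\<close> by (simp add: r(2))
  then show ?thesis using norm_sa_square[OF r(1)] by (simp add: r(2))
qed

text \<open>The criterion \<open>norm (t *\<^sub>R 1 - a) \<le> t\<close> adds up by the triangle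
  inequality.\<close>

lemma sa_square_add:
  fixes a b :: "'a::unital_cstar_algebra"
  assumes "sa_square a" "sa_square b"
  shows "sa_square (a + b)"
proof -
  obtain s r where s: "star s = s" "a = s * s" and r: "star r = r" "b = r * r"
    using assms by (auto simp: sa_square_def)
  let ?t = "(norm s)\<^sup>2" and ?u = "(norm r)\<^sup>2"
  have "(?t + ?u) *\<^sub>R 1 - (a + b) = (?t *\<^sub>R 1 - a) + (?u *\<^sub>R 1 - b)"
    by (simp add: algebra_simps)
  then have "norm ((?t + ?u) *\<^sub>R 1 - (a + b)) \<le> norm (?t *\<^sub>R 1 - a) + norm (?u *\<^sub>R 1 - b)"
    by (metis norm_triangle_ineq)
  also have "\<dots> \<le> ?t + ?u"
    unfolding s r by (intro add_mono norm_one_diff_square) (use s r in auto)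
  finally show ?thesis
    by (intro sa_squareI_norm) (auto simp: star_add sa_square_star assms)
qed

lemma sa_square_norm_diff:
  fixes a :: "'a::unital_cstar_algebra"
  assumes "star a = a" "norm a \<le> t"
  shows "sa_square (t *\<^sub>R 1 - a)"
  using assms by (intro sa_squareI_norm[where t = t]) (auto simp: star_simps)

lemma norm_le_of_sa_square_diff:
  fixes a :: "'a::unital_cstar_algebra"
  assumes "sa_square a" "sa_square (t *\<^sub>R 1 - a)" "0 \<le> t"
  shows "norm a \<le> t"
proof -
  obtain w where w: "star w = w" "t *\<^sub>R 1 - a = w * w" using assms by (auto simp: sa_square_def)
  have "w * a = a * w"
  proof -
    have a: "a = t *\<^sub>R 1 - w * w" using w(2) by (simp add: algebra_simps)
    show ?thesis unfolding a by (simp add: algebra_simps)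
  qed
  obtain s where s: "star s = s" "a = s * s" using assms by (auto simp: sa_square_def)
  \<comment> \<open>The given root \<open>s\<close> need not commute with \<open>w\<close>; the root
    \<open>v\<close> constructed from \<open>a\<close> does.\<close>
  have "norm ((norm s)\<^sup>2 *\<^sub>R 1 - a) \<le> (norm s)\<^sup>2" unfolding s by (rule norm_one_diff_square) (use s in auto)
  then obtain v where v: "star v = v" "v * v = a" "\<And>y. y * a = a * y \<Longrightarrow> y * v = v * y"
    using sa_sqrt sa_square_star[OF assms(1)] by metis
  have "(norm v)\<^sup>2 \<le> norm (w * w + v * v)"
    by (intro norm_le_commuting_squares v w \<open>w * a = a * w\<close>)
  also have "w * w + v * v = t *\<^sub>R 1" by (simp add: v flip: w(2))
  finally show ?thesis using norm_sa_square[OF v(1)] assms by (simp add: v)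
qed

lemma norm_mono_sa_square:
  fixes a b :: "'a::unital_cstar_algebra"
  assumes "sa_square a" "sa_square b"
  shows "norm a \<le> norm (a + b)"
proof (rule norm_le_of_sa_square_diff)
  have "sa_square (norm (a + b) *\<^sub>R 1 - (a + b))"
    by (rule sa_square_norm_diff) (auto simp: star_add sa_square_star assms)
  from sa_square_add[OF this assms(2)] show "sa_square (norm (a + b) *\<^sub>R 1 - a)"
    by (simp add: algebra_simps)
qed (use assms in auto)

lemma norm_shift_square:
  fixes s :: "'a::unital_cstar_algebra"
  assumes "star s = s" "0 \<le> t"
  shows "t + (norm s)\<^sup>2 \<le> norm (t *\<^sub>R 1 + s * s)"
proof -
  let ?k = "norm (t *\<^sub>R 1 + s * s)"
  have T: "sa_square (t *\<^sub>R (1::'a))"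
    using sa_square_scaleR[OF sa_squareI[of "1::'a"] assms(2)] by simp
  have "t \<le> ?k" using norm_mono_sa_square[OF T sa_squareI[OF assms(1)]] assms(2) by simp
  moreover have "sa_square (?k *\<^sub>R 1 - (t *\<^sub>R 1 + s * s))"
    by (rule sa_square_norm_diff) (auto simp: star_simps assms)
  then have "sa_square ((?k - t) *\<^sub>R 1 - s * s)" by (simp add: algebra_simps)
  ultimately have "norm (s * s) \<le> ?k - t"
    by (intro norm_le_of_sa_square_diff) (auto simp: sa_squareI assms)
  then show ?thesis using assms by (simp add: norm_sa_square)
qed

text \<open>\<open>s\<close> is the absolute value of \<open>a\<close>: \<open>sa_sqrt\<close>
  returns a root within \<open>norm a\<close> of the scalar \<open>norm a\<close>, which the norm
  criterion recognizes as positive.\<close>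

lemma sa_abs:
  fixes a :: "'a::unital_cstar_algebra"
  assumes "star a = a"
  obtains s where "star s = s" "s * s = a * a" "sa_square s" "\<And>y. y * a = a * y \<Longrightarrow> y * s = s * y"
proof -
  have "norm ((norm a)\<^sup>2 *\<^sub>R 1 - a * a) \<le> (norm a)\<^sup>2"
    by (rule norm_one_diff_square) (use assms in auto)
  moreover have "star (a * a) = a * a" by (simp add: star_mult assms)
  ultimately obtain s where s: "star s = s" "s * s = a * a"
    "norm (sqrt ((norm a)\<^sup>2) *\<^sub>R 1 - s) \<le> sqrt ((norm a)\<^sup>2)"
    "\<And>y. y * (a * a) = (a * a) * y \<Longrightarrow> y * s = s * y"
    using sa_sqrt[of "a * a"] by metis
  show thesis
  proof (rule that[OF s(1,2)])
    show "sa_square s" using s by (intro sa_squareI_norm)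
    fix y assume "y * a = a * y"
    then have "y * (a * a) = (a * a) * y" by (metis mult.assoc)
    then show "y * s = s * y" by (rule s(4))
  qed
qed

text \<open>Stands in for the equality of the non-zero spectra of xy and yx. Real and imaginary
  parts of \<open>z\<close> show that \<open>z * star z\<close> is positive, hence within
  \<open>M\<close> of the scalar \<open>M\<close>; multiplying by \<open>star z\<close> and
  \<open>z\<close> bounds \<open>k * k * (M + k * k)\<close> by the square of \<open>M\<close>.
  Adding a quarter of that square completes the square of M/2 + k k, whose norm is at least 3M/2;
  then 9/4 is at most 5/4 unless M = 0.\<close>

lemma star_mult_neg_square:
  fixes z :: "'a::unital_cstar_algebra"
  assumes k: "star k = k" "star z * z = - (k * k)"
  shows "z = 0"
proof -
  define M where "M = (norm z)\<^sup>2"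
  have M: "norm (star z * z) = M" by (simp add: M_def cstar_identity)
  then have k2: "(norm k)\<^sup>2 = M" using norm_sa_square[OF k(1)] k(2) by simp
  define h where "h = z + star z"
  define g where "g = \<i> *\<^sub>C (z - star z)"
  have h: "star h = h" by (simp add: h_def star_simps add.commute)
  have g: "star g = g" by (simp add: g_def star_simps star_scaleC cvec.scale_right_diff_distrib)
  have "h * h + g * g = 2 *\<^sub>R (star z * z + z * star z)"
    by (simp add: h_def g_def algebra_simps mult_scaleC_left mult_scaleC_right scaleC_scaleC
        cvec.scale_right_diff_distrib scaleR_2)
  then have "h * h + g * g + 2 *\<^sub>R (k * k) = 2 *\<^sub>R (z * star z)"
    by (simp add: k scaleR_add_right scaleR_diff_right)
  then have "(1/2) *\<^sub>R (h * h + g * g + 2 *\<^sub>R (k * k)) = z * star z" by (simp only: scaleR_scaleR) simp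
  moreover have "sa_square ((1/2) *\<^sub>R (h * h + g * g + 2 *\<^sub>R (k * k)))"
    by (intro sa_square_add sa_squareI sa_square_scaleR h g k) auto
  ultimately have "sa_square (z * star z)" by (simp only:)
  then obtain l where l: "star l = l" "z * star z = l * l" by (auto simp: sa_square_def)
  have "(norm l)\<^sup>2 = M" using norm_sa_square[OF l(1)] cstar_identity'[of z] by (simp add: M_def l)
  then have "norm (M *\<^sub>R 1 - z * star z) \<le> M" unfolding l
    by (intro norm_one_diff_square l) auto
  moreover have "star z * ((M *\<^sub>R 1 - z * star z) * z) = - (k * k) * (M *\<^sub>R 1 + k * k)"
  proof -
    have "star z * ((M *\<^sub>R 1 - z * star z) * z) = M *\<^sub>R (star z * z) - (star z * z) * (star z * z)"
      by (simp add: algebra_simps)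
    then show ?thesis unfolding k(2) by (simp add: algebra_simps)
  qed
  moreover have "norm (star z * ((M *\<^sub>R 1 - z * star z) * z)) \<le> norm z * (norm (M *\<^sub>R 1 - z * star z) * norm z)"
    using norm_mult_ineq[of "star z" "(M *\<^sub>R 1 - z * star z) * z"]
      mult_left_mono[OF norm_mult_ineq[of "M *\<^sub>R 1 - z * star z" z], of "norm z"] by simp
  moreover have "norm z * (norm (M *\<^sub>R 1 - z * star z) * norm z) \<le> norm z * (M * norm z)"
    using calculation(1) by (intro mult_left_mono mult_right_mono) auto
  ultimately have "norm ((k * k) * (M *\<^sub>R 1 + k * k)) \<le> norm z * (M * norm z)"
    by simp
  then have A: "norm ((k * k) * (M *\<^sub>R 1 + k * k)) \<le> M\<^sup>2"
    by (simp add: M_def power2_eq_square algebra_simps)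
  have M0: "0 \<le> M" by (simp add: M_def)
  have st: "star ((M/2) *\<^sub>R 1 + k * k) = (M/2) *\<^sub>R 1 + k * k" by (simp add: star_simps k)
  have "M/2 + M \<le> norm ((M/2) *\<^sub>R 1 + k * k)"
    using norm_shift_square[OF k(1), of "M/2"] M0 k2 by simp
  then have "(M/2 + M)\<^sup>2 \<le> (norm ((M/2) *\<^sub>R 1 + k * k))\<^sup>2" using M0 by (intro power_mono) auto
  also have "\<dots> = norm (((M/2) *\<^sub>R 1 + k * k) * ((M/2) *\<^sub>R 1 + k * k))"
    by (simp add: norm_sa_square[OF st])
  also have "((M/2) *\<^sub>R 1 + k * k) * ((M/2) *\<^sub>R 1 + k * k)
      = (k * k) * (M *\<^sub>R 1 + k * k) + (M\<^sup>2/4) *\<^sub>R 1"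
    by (simp add: algebra_simps power2_eq_square flip: scaleR_add_left)
  also have "norm \<dots> \<le> M\<^sup>2 + M\<^sup>2/4"
    using A by (intro order_trans[OF norm_triangle_ineq] add_mono) auto
  finally have "M\<^sup>2 \<le> 0" by (simp add: power2_eq_square field_simps)
  then show ?thesis by (simp add: M_def)
qed

text \<open>
  With \<open>a = x\<^sup>* x\<close> and \<open>n = \<bar>a\<bar> - a\<close>, the element \<open>(x n)\<^sup>* (x n) = - n \<bar>a\<bar> n\<close> is a negative square, hence zero.
\<close>

lemma sa_square_star_mult_unital:
  fixes x :: "'a::unital_cstar_algebra"
  shows "sa_square (star x * x)"
proof -
  define a where "a = star x * x"
  have a: "star a = a" by (simp add: a_def star_simps)
  obtain s where s: "star s = s" "s * s = a * a" "sa_square s" "\<And>y. y * a = a * y \<Longrightarrow> y * s = s * y"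
    using sa_abs[OF a] by blast
  have as: "a * s = s * a" by (rule s(4)) simp
  obtain q where q: "star q = q" "s = q * q" using s(3) by (auto simp: sa_square_def)
  \<comment> \<open>\<open>q\<close> is an arbitrary root of \<open>s\<close>; \<open>v\<close> is
    one that commutes with \<open>n\<close>, so that n s n is the square of the self-adjoint
    \<open>n * v\<close>.\<close>
  have "norm ((norm q)\<^sup>2 *\<^sub>R 1 - s) \<le> (norm q)\<^sup>2" unfolding q by (rule norm_one_diff_square) (use q in auto)
  then obtain v where v: "star v = v" "v * v = s" "\<And>y. y * s = s * y \<Longrightarrow> y * v = v * y"
    using sa_sqrt s(1) by metis
  define n where "n = s - a"
  have n: "star n = n" by (simp add: n_def star_simps s a)
  have vn: "n * v = v * n" by (rule v(3)) (simp add: n_def algebra_simps as)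
  have an: "a * n = - (s * n)" by (simp add: n_def algebra_simps s as)
  have "star (x * n) * (x * n) = n * (a * n)" by (simp add: star_simps n a_def mult.assoc)
  also have "\<dots> = - ((n * v) * (n * v))"
    using vn by (simp add: an mult.assoc flip: v(2)) (metis mult.assoc)
  finally have "x * n = 0"
    by (intro star_mult_neg_square[of "n * v"]) (auto simp: star_simps n v vn)
  then have "a * n = 0" by (simp add: a_def mult.assoc)
  then have "s * n = 0" using an by simp
  with \<open>a * n = 0\<close> have "n * n = 0" by (simp add: n_def left_diff_distrib)
  then have "n = 0" using star_mult_self_eq_0[of n] n by simp
  then show ?thesis using s(3) by (simp add: n_def a_def)
qed

section \<open>The unitization\<close>

datatype 'a unitization = Unitize (upart: 'a) (cpart: complex)

definition uact :: "'a::cstar_algebra unitization \<Rightarrow> 'a \<Rightarrow> 'a" where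
  "uact u x = upart u * x + cpart u *\<^sub>C x"

lemma bounded_linear_scaleC: "bounded_linear (\<lambda>x :: 'a::cstar_algebra. c *\<^sub>C x)"
  by (rule bounded_linear_intro[where K = "cmod c"])
    (simp_all add: scaleC_add_right scaleR_scaleC scaleC_scaleC norm_scaleC mult.commute)

lemma scaleC_scaleR: "c *\<^sub>C (r *\<^sub>R x) = r *\<^sub>R (c *\<^sub>C (x :: 'a::cstar_algebra))"
  by (simp add: scaleR_scaleC scaleC_scaleC mult.commute)

lemma scaleR_scaleC_assoc: "(r *\<^sub>R c) *\<^sub>C x = r *\<^sub>R (c *\<^sub>C (x :: 'a::cstar_algebra))"
  by (simp add: scaleR_scaleC scaleC_scaleC scaleR_conv_of_real)

lemma bounded_linear_uact: "bounded_linear (uact u)"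
  unfolding uact_def
  by (intro bounded_linear_add bounded_linear_mult_right bounded_linear_scaleC)

instantiation unitization :: (cstar_algebra) ring_1
begin

definition "0 = Unitize 0 0"
definition "1 = Unitize 0 1"
definition "u + v = Unitize (upart u + upart v) (cpart u + cpart v)"
definition "u - v = Unitize (upart u - upart v) (cpart u - cpart v)"
definition "- u = Unitize (- upart u) (- cpart u)"
definition "u * v = Unitize (upart u * upart v + cpart u *\<^sub>C upart v + cpart v *\<^sub>C upart u) (cpart u * cpart v)"

instance
  by standard
    (auto simp: zero_unitization_def one_unitization_def plus_unitization_def minus_unitization_def
      uminus_unitization_def times_unitization_def algebra_simps mult_scaleC_left mult_scaleC_right
      scaleC_scaleC scaleC_add_right scaleC_add_left)

end

lemmas unitization_defs = zero_unitization_def one_unitization_def plus_unitization_def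
  minus_unitization_def uminus_unitization_def times_unitization_def

lemma uact_mult: "uact (u * v) x = uact u (uact v x)"
  by (simp add: uact_def unitization_defs algebra_simps mult_scaleC_left mult_scaleC_right
      scaleC_scaleC scaleC_add_right scaleC_add_left)

lemma uact_add: "uact (u + v) x = uact u x + uact v x"
  by (simp add: uact_def unitization_defs algebra_simps scaleC_add_left)

instantiation unitization :: (cstar_algebra) real_normed_algebra_1
begin

definition "r *\<^sub>R u = Unitize (r *\<^sub>R upart u) (r *\<^sub>R cpart u)"
text \<open>The operator norm of the left action alone vanishes at the difference of the two units
  when \<open>A\<close> already has one; the maximum with the scalar part keeps this a norm.\<close>

definition "norm u = max (onorm (uact u)) (cmod (cpart u))"
definition dist_unitization :: "'a unitization \<Rightarrow> 'a unitization \<Rightarrow> real" where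
  "dist_unitization u v = norm (u - v)"
definition sgn_unitization :: "'a unitization \<Rightarrow> 'a unitization" where
  "sgn_unitization u = inverse (norm u) *\<^sub>R u"
definition uniformity_unitization :: "('a unitization \<times> 'a unitization) filter" where
  "uniformity_unitization = (INF e\<in>{0<..}. principal {(x, y). dist x y < e})"
definition open_unitization :: "'a unitization set \<Rightarrow> bool" where
  "open_unitization U \<longleftrightarrow> (\<forall>x\<in>U. \<forall>\<^sub>F (x', y) in uniformity. x' = x \<longrightarrow> y \<in> U)"

instance
proof
  fix r s :: real and u v :: "'a unitization"
  show "norm u = 0 \<longleftrightarrow> u = 0"
  proof
    assume "norm u = 0"
    then have "onorm (uact u) \<le> 0" "cmod (cpart u) \<le> 0"
      unfolding norm_unitization_def by linarith+
    then have l: "cpart u = 0" and "onorm (uact u) = 0"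
      using onorm_pos_le[OF bounded_linear_uact, of u] by auto
    then have "uact u (star (upart u)) = 0"
      using onorm_eq_0[OF bounded_linear_uact, of u] by metis
    then have "upart u * star (upart u) = 0" using l by (simp add: uact_def)
    then have "upart u = 0" using cstar_identity'[of "upart u"] by simp
    with l show "u = 0" by (cases u) (simp add: unitization_defs)
  next
    assume "u = 0"
    then show "norm u = 0"
      by (simp add: norm_unitization_def uact_def[abs_def] unitization_defs onorm_zero)
  qed
  have "onorm (uact (u + v)) \<le> onorm (uact u) + onorm (uact v)"
    unfolding uact_add[abs_def] by (intro onorm_triangle bounded_linear_uact)
  then show "norm (u + v) \<le> norm u + norm v"
    using norm_triangle_ineq[of "cpart u" "cpart v"]
    by (auto simp: norm_unitization_def plus_unitization_def max_def split: if_splits)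
  have "uact (r *\<^sub>R u) = (\<lambda>x. r *\<^sub>R uact u x)"
    by (simp add: fun_eq_iff uact_def scaleR_unitization_def scaleR_scaleC scaleC_add_right
        mult_scaleC_left scaleC_scaleC scaleR_conv_of_real)
  then have "onorm (uact (r *\<^sub>R u)) = \<bar>r\<bar> * onorm (uact u)"
    by (simp add: onorm_scaleR[OF bounded_linear_uact])
  then show "norm (r *\<^sub>R u) = \<bar>r\<bar> * norm u"
    by (simp add: norm_unitization_def scaleR_unitization_def max_mult_distrib_left)
  have "uact (u * v) = uact u \<circ> uact v" by (simp add: fun_eq_iff uact_mult)
  then have "onorm (uact (u * v)) \<le> onorm (uact u) * onorm (uact v)"
    by (simp add: onorm_compose bounded_linear_uact)
  also have "\<dots> \<le> norm u * norm v"
    by (intro mult_mono) (auto simp: norm_unitization_def onorm_pos_le bounded_linear_uact le_max_iff_disj)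
  finally have "onorm (uact (u * v)) \<le> norm u * norm v" .
  moreover have "cmod (cpart (u * v)) \<le> norm u * norm v"
    by (auto simp: norm_unitization_def times_unitization_def norm_mult le_max_iff_disj intro!: mult_mono)
  ultimately show "norm (u * v) \<le> norm u * norm v"
    by (simp add: norm_unitization_def[of "u * v"])
  have "onorm (uact (1 :: 'a unitization)) \<le> 1"
    by (rule onorm_bound) (auto simp: uact_def unitization_defs norm_scaleC)
  then show "norm (1 :: 'a unitization) = 1"
    by (simp add: norm_unitization_def one_unitization_def max_absorb2)
qed (auto simp: dist_unitization_def sgn_unitization_def uniformity_unitization_def
    open_unitization_def scaleR_unitization_def unitization_defs algebra_simps
    scaleC_scaleR scaleR_scaleC_assoc)

end

definition embed_unit :: "'a::cstar_algebra \<Rightarrow> 'a unitization" where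
  "embed_unit a = Unitize a 0"

lemma norm_embed_unit [simp]: "norm (embed_unit a) = norm a"
proof -
  have u: "uact (embed_unit a) = (\<lambda>x. a * x)" by (simp add: fun_eq_iff uact_def embed_unit_def)
  have "onorm ((*) a) \<le> norm a" by (rule onorm_bound) (auto simp: norm_mult_ineq)
  moreover have "norm a \<le> onorm ((*) a)"
  proof (cases "a = 0")
    case False
    have "norm (a * star a) \<le> onorm ((*) a) * norm (star a)"
      by (rule onorm) (rule bounded_linear_mult_right)
    then show ?thesis using False by (simp add: cstar_identity' power2_eq_square)
  qed (simp add: onorm_pos_le bounded_linear_mult_right)
  ultimately show ?thesis
    by (simp add: norm_unitization_def u) (simp add: embed_unit_def max_def)
qed

lemma cmod_cpart_le: "cmod (cpart u) \<le> norm u"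
  by (simp add: norm_unitization_def)

instantiation unitization :: (cstar_algebra) unital_cstar_algebra
begin

definition "c *\<^sub>C u = Unitize (c *\<^sub>C upart u) (c * cpart u)"
definition "star u = Unitize (star (upart u)) (cnj (cpart u))"

instance
proof
  fix c d :: complex and r :: real and u v :: "'a unitization"
  show "star (u * v) = star v * star u"
    by (simp add: star_unitization_def times_unitization_def star_simps star_scaleC add_ac)
  have uC: "uact (c *\<^sub>C u) = (\<lambda>x. c *\<^sub>C uact u x)" for c :: complex and u :: "'a unitization"
    by (simp add: fun_eq_iff uact_def scaleC_unitization_def scaleC_add_right
        mult_scaleC_left scaleC_scaleC)
  have le: "onorm (uact (c *\<^sub>C u)) \<le> cmod c * onorm (uact u)" for c :: complex and u :: "'a unitization"
    unfolding uC by (rule onorm_bound)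
      (auto simp: norm_scaleC mult.assoc onorm_pos_le onorm bounded_linear_uact intro!: mult_left_mono)
  have "onorm (uact (c *\<^sub>C u)) = cmod c * onorm (uact u)"
  proof (cases "c = 0")
    case True
    then show ?thesis using le[of 0 u] onorm_pos_le[OF bounded_linear_uact, of "0 *\<^sub>C u"] by simp
  next
    case False
    then have "inverse c *\<^sub>C c *\<^sub>C u = u"
      by (cases u) (simp add: scaleC_unitization_def scaleC_scaleC)
    then have "onorm (uact u) \<le> cmod (inverse c) * onorm (uact (c *\<^sub>C u))"
      using le[of "inverse c" "c *\<^sub>C u"] by simp
    then show ?thesis using le[of c u] False by (simp add: norm_inverse norm_divide field_simps)
  qed
  then show "norm (c *\<^sub>C u) = cmod c * norm u"
    by (simp add: norm_unitization_def max_mult_distrib_left) (simp add: scaleC_unitization_def norm_mult)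
  \<comment> \<open>The product of \<open>uact u x\<close> with its adjoint is
    \<open>star x * uact (star u * u) x\<close>, which lies in \<open>A\<close>, where the
    C*-identity is available.\<close>
  have key: "(onorm (uact u))\<^sup>2 \<le> onorm (uact (star u * u))" for u :: "'a unitization"
  proof -
    let ?K = "onorm (uact (star u * u))"
    have K0: "0 \<le> ?K" by (simp add: onorm_pos_le bounded_linear_uact)
    have "norm (uact u x) \<le> sqrt ?K * norm x" for x
    proof -
      have "star (uact u x) * uact u x = star x * uact (star u * u) x"
        unfolding uact_mult
        by (simp add: uact_def star_unitization_def algebra_simps star_simps star_scaleC
            mult_scaleC_left mult_scaleC_right scaleC_scaleC scaleC_add_right)
      then have "(norm (uact u x))\<^sup>2 \<le> norm x * norm (uact (star u * u) x)"
        using cstar_identity[of "uact u x"] norm_mult_ineq[of "star x" "uact (star u * u) x"] by simp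
      also have "\<dots> \<le> norm x * (?K * norm x)"
        by (intro mult_left_mono onorm bounded_linear_uact) auto
      also have "\<dots> = (sqrt ?K * norm x)\<^sup>2"
        using K0 by (simp add: power_mult_distrib) (simp add: power2_eq_square)
      finally show ?thesis by (rule power2_le_imp_le) (use K0 in auto)
    qed
    then have "onorm (uact u) \<le> sqrt ?K" by (intro onorm_bound) (use K0 in auto)
    then have "(onorm (uact u))\<^sup>2 \<le> (sqrt ?K)\<^sup>2"
      by (intro power_mono) (auto simp: onorm_pos_le bounded_linear_uact)
    then show ?thesis using K0 by simp
  qed
  have comp: "onorm (uact (star u * u)) \<le> onorm (uact (star u)) * onorm (uact u)" for u :: "'a unitization"
  proof -
    have "uact (star u * u) = uact (star u) \<circ> uact u" by (simp add: fun_eq_iff uact_mult)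
    then show ?thesis by (simp add: onorm_compose bounded_linear_uact)
  qed
  have le_star: "onorm (uact u) \<le> onorm (uact (star u))" for u :: "'a unitization"
  proof (cases "onorm (uact u) = 0")
    case False
    then have "0 < onorm (uact u)" using onorm_pos_le[OF bounded_linear_uact, of u] by simp
    moreover have "onorm (uact u) * onorm (uact u) \<le> onorm (uact (star u)) * onorm (uact u)"
      using order_trans[OF key[of u] comp[of u]] by (simp add: power2_eq_square)
    ultimately show ?thesis by simp
  qed (simp add: onorm_pos_le bounded_linear_uact)
  have "star (star u) = u" by (cases u) (simp add: star_unitization_def star_star)
  then have "onorm (uact (star u)) = onorm (uact u)"
    using le_star[of u] le_star[of "star u"] by simp
  then have "onorm (uact (star u * u)) = (onorm (uact u))\<^sup>2"
    using key[of u] comp[of u] by (simp add: power2_eq_square)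
  moreover have "cmod (cpart (star u * u)) = (cmod (cpart u))\<^sup>2"
    by (simp add: star_unitization_def times_unitization_def norm_mult power2_eq_square)
  moreover have "max (a\<^sup>2) (b\<^sup>2) = (max a b)\<^sup>2" if "0 \<le> a" "0 \<le> b" for a b :: real
    using that by (cases "a \<le> b") (simp_all add: max_absorb1 max_absorb2 power_mono)
  ultimately show "norm (star u * u) = (norm u)\<^sup>2"
    by (simp add: norm_unitization_def onorm_pos_le bounded_linear_uact)
next
  fix X :: "nat \<Rightarrow> 'a unitization"
  assume X: "Cauchy X"
  have dc: "cpart (u - v) = cpart u - cpart v" for u v :: "'a unitization"
    by (simp add: minus_unitization_def)
  have du: "embed_unit (upart u - upart v) = (u - v) - (cpart u - cpart v) *\<^sub>C 1" for u v :: "'a unitization"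
    by (simp add: unitization_defs scaleC_unitization_def embed_unit_def)
  have n1: "norm (c *\<^sub>C (1 :: 'a unitization)) \<le> cmod c" for c
  proof -
    have "uact (c *\<^sub>C (1 :: 'a unitization)) = (\<lambda>x. c *\<^sub>C x)"
      by (simp add: fun_eq_iff uact_def scaleC_unitization_def one_unitization_def)
    moreover have "onorm (\<lambda>x :: 'a. c *\<^sub>C x) \<le> cmod c" by (rule onorm_bound) (auto simp: norm_scaleC)
    ultimately show ?thesis
      by (simp add: norm_unitization_def) (simp add: scaleC_unitization_def one_unitization_def)
  qed
  have Cc: "Cauchy (\<lambda>n. cpart (X n))"
    unfolding Cauchy_def dist_norm
  proof (intro allI impI)
    fix e :: real assume "e > 0"
    then obtain N where N: "\<forall>m\<ge>N. \<forall>n\<ge>N. norm (X m - X n) < e"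
      using X unfolding Cauchy_def dist_norm by blast
    have "cmod (cpart (X m) - cpart (X n)) < e" if "m \<ge> N" "n \<ge> N" for m n
      using N that cmod_cpart_le[of "X m - X n"] by (fastforce simp: dc)
    then show "\<exists>N. \<forall>m\<ge>N. \<forall>n\<ge>N. cmod (cpart (X m) - cpart (X n)) < e" by blast
  qed
  \<comment> \<open>\<open>upart\<close> need not be contractive; it differs from the identity by
    the scalar part, which is, hence the factor 2.\<close>
  have dn: "norm (upart u - upart v) \<le> 2 * norm (u - v)" for u v :: "'a unitization"
  proof -
    have "norm (upart u - upart v) = norm ((u - v) - (cpart u - cpart v) *\<^sub>C 1)"
      by (metis du norm_embed_unit)
    also have "\<dots> \<le> norm (u - v) + cmod (cpart u - cpart v)"
      by (intro order_trans[OF norm_triangle_ineq4] add_mono n1 order_refl)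
    finally show ?thesis using cmod_cpart_le[of "u - v"] by (simp add: dc)
  qed
  have Cu: "Cauchy (\<lambda>n. upart (X n))"
    unfolding Cauchy_def dist_norm
  proof (intro allI impI)
    fix e :: real assume "e > 0"
    then have "e/2 > 0" by simp
    then obtain N where N: "\<forall>m\<ge>N. \<forall>n\<ge>N. norm (X m - X n) < e/2"
      using X unfolding Cauchy_def dist_norm by blast
    have "norm (upart (X m) - upart (X n)) < e" if "m \<ge> N" "n \<ge> N" for m n
      using N that dn[of "X m" "X n"] by fastforce
    then show "\<exists>N. \<forall>m\<ge>N. \<forall>n\<ge>N. norm (upart (X m) - upart (X n)) < e" by blast
  qed
  obtain a l where al: "(\<lambda>n. upart (X n)) \<longlonglongrightarrow> a" "(\<lambda>n. cpart (X n)) \<longlonglongrightarrow> l"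
    using Cc Cu by (auto simp: Cauchy_convergent_iff convergent_def)
  have bound: "norm (X n - Unitize a l) \<le> norm (upart (X n) - a) + cmod (cpart (X n) - l)" for n
  proof -
    have "X n - Unitize a l = embed_unit (upart (X n) - a) + (cpart (X n) - l) *\<^sub>C 1"
      by (simp add: unitization_defs scaleC_unitization_def embed_unit_def)
    then have "norm (X n - Unitize a l)
        \<le> norm (embed_unit (upart (X n) - a)) + norm ((cpart (X n) - l) *\<^sub>C (1 :: 'a unitization))"
      by (simp only: norm_triangle_ineq)
    then show ?thesis using n1[of "cpart (X n) - l"] by simp
  qed
  have lim: "(\<lambda>n. norm (upart (X n) - a) + cmod (cpart (X n) - l)) \<longlonglongrightarrow> 0"
    using tendsto_add[OF tendsto_norm_zero[OF LIM_zero[OF al(1)]] tendsto_norm_zero[OF LIM_zero[OF al(2)]]]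
    by simp
  have "(\<lambda>n. X n - Unitize a l) \<longlonglongrightarrow> 0"
    by (rule Lim_null_comparison[OF always_eventually lim]) (simp add: bound)
  then have "X \<longlonglongrightarrow> Unitize a l" by (rule LIM_zero_cancel)
  then show "convergent X" by (auto simp: convergent_def)
qed (simp_all add: scaleC_unitization_def star_unitization_def scaleR_unitization_def
    plus_unitization_def times_unitization_def scaleR_scaleC scaleR_conv_of_real[where 'a = complex]
    scaleC_add_right scaleC_add_left scaleC_scaleC mult_scaleC_left mult_scaleC_right
    star_star star_add star_scaleC distrib_left distrib_right mult_ac)

end

lemma cpart_simps [simp]:
  "cpart (0 :: 'a::cstar_algebra unitization) = 0"
  "cpart (1 :: 'a unitization) = 1"
  "cpart (u + v :: 'a unitization) = cpart u + cpart v"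
  "cpart (u - v :: 'a unitization) = cpart u - cpart v"
  "cpart (- u :: 'a unitization) = - cpart u"
  "cpart (u * v :: 'a unitization) = cpart u * cpart v"
  "cpart (star u :: 'a unitization) = cnj (cpart u)"
  "cpart (r *\<^sub>R u :: 'a unitization) = r *\<^sub>R cpart u"
  "cpart (embed_unit a) = 0"
  by (simp_all add: unitization_defs star_unitization_def scaleR_unitization_def embed_unit_def)

lemma embed_unit_simps:
  "embed_unit (0 :: 'a::cstar_algebra) = 0"
  "embed_unit (a + b :: 'a) = embed_unit a + embed_unit b"
  "embed_unit (a - b :: 'a) = embed_unit a - embed_unit b"
  "embed_unit (- a :: 'a) = - embed_unit a"
  "embed_unit (a * b :: 'a) = embed_unit a * embed_unit b"
  "embed_unit (star a :: 'a) = star (embed_unit a)"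
  "embed_unit (r *\<^sub>R a :: 'a) = r *\<^sub>R embed_unit a"
  "embed_unit (c *\<^sub>C a :: 'a) = c *\<^sub>C embed_unit a"
  by (simp_all add: unitization_defs star_unitization_def scaleR_unitization_def
      scaleC_unitization_def embed_unit_def)

lemma embed_unit_eq_iff [simp]: "embed_unit a = embed_unit b \<longleftrightarrow> a = b"
  by (simp add: embed_unit_def)

lemma embed_unit_eq_0_iff [simp]: "embed_unit a = 0 \<longleftrightarrow> a = (0 :: 'a::cstar_algebra)"
  by (simp add: embed_unit_def unitization_defs)

lemma embed_unit_upart: "cpart u = 0 \<Longrightarrow> embed_unit (upart u) = u"
  by (cases u) (simp add: embed_unit_def)

lemma bounded_linear_embed_unit: "bounded_linear (embed_unit :: 'a::cstar_algebra \<Rightarrow> 'a unitization)"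
  by (rule bounded_linear_intro[where K = 1]) (simp_all add: embed_unit_simps)

text \<open>A self-adjoint root of an element of \<open>A\<close> has a scalar part with square 0,
  so it already lies in \<open>A\<close>.\<close>

lemma sa_square_embed_unit [simp]: "sa_square (embed_unit a) \<longleftrightarrow> sa_square (a :: 'a::cstar_algebra)"
proof
  assume "sa_square (embed_unit a)"
  then obtain s where s: "star s = s" "embed_unit a = s * s" by (auto simp: sa_square_def)
  have "cpart s * cpart s = 0" using arg_cong[OF s(2), of cpart] by simp
  then have "embed_unit (upart s) = s" by (intro embed_unit_upart) simp
  then have "star (upart s) = upart s" "a = upart s * upart s"
    using s by (metis embed_unit_simps(6) embed_unit_eq_iff, metis embed_unit_simps(5) embed_unit_eq_iff)
  then show "sa_square a" by (auto simp: sa_square_def)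
next
  assume "sa_square a"
  then obtain s where "star s = s" "a = s * s" by (auto simp: sa_square_def)
  then show "sa_square (embed_unit a)"
    unfolding sa_square_def by (intro exI[of _ "embed_unit s"]) (simp flip: embed_unit_simps)
qed

section \<open>Positivity without a unit\<close>

lemma sa_square_star_mult: "sa_square (star x * (x :: 'a::cstar_algebra))"
  using sa_square_star_mult_unital[of "embed_unit x"] by (simp flip: embed_unit_simps)

lemma sa_square_mult_star: "sa_square (x * star (x :: 'a::cstar_algebra))"
  using sa_square_star_mult[of "star x"] by (simp add: star_star)

lemma pos_cone_UNIV_iff: "a \<in> pos_cone UNIV \<longleftrightarrow> sa_square (a :: 'a::cstar_algebra)"
proof
  assume "a \<in> pos_cone UNIV"
  then show "sa_square a" by (auto simp: pos_cone_def sa_square_star_mult)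
next
  assume "sa_square a"
  then obtain s where "star s = s" "a = s * s" by (auto simp: sa_square_def)
  then show "a \<in> pos_cone UNIV" unfolding pos_cone_def by (auto intro!: exI[of _ s])
qed

lemma sa_square_plus:
  "sa_square a \<Longrightarrow> sa_square b \<Longrightarrow> sa_square (a + b :: 'a::cstar_algebra)"
  using sa_square_add[of "embed_unit a" "embed_unit b"] by (simp flip: embed_unit_simps)

lemma norm_mono:
  "sa_square a \<Longrightarrow> sa_square b \<Longrightarrow> norm a \<le> norm (a + b :: 'a::cstar_algebra)"
  using norm_mono_sa_square[of "embed_unit a" "embed_unit b"] by (simp flip: embed_unit_simps)

lemma norm_mono_diff:
  "sa_square a \<Longrightarrow> sa_square (b - a) \<Longrightarrow> norm a \<le> norm (b :: 'a::cstar_algebra)"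
  using norm_mono[of a "b - a"] by simp

lemma sa_square_antisym: "sa_square a \<Longrightarrow> sa_square (- a) \<Longrightarrow> a = (0 :: 'a::cstar_algebra)"
  using norm_mono[of a "- a"] by simp

lemma sa_square_conj: "sa_square a \<Longrightarrow> sa_square (star z * a * (z :: 'a::cstar_algebra))"
proof -
  assume "sa_square a"
  then obtain s where "star s = s" "a = s * s" by (auto simp: sa_square_def)
  then have "star z * a * z = star (s * z) * (s * z)" by (simp add: star_mult mult.assoc)
  then show ?thesis using sa_square_star_mult by metis
qed

lemma sa_square_0 [simp]: "sa_square (0 :: 'a::cstar_algebra)"
  using sa_squareI[of "0 :: 'a"] by simp

section \<open>Hereditary subalgebras and projections\<close>

text \<open>If 0 \<le> a \<le> c and c n = 0, compression by \<open>n\<close> turns c - a into minus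
  a square, so \<open>n\<close> kills the root of \<open>a\<close>. With \<open>n\<close> in the
  unitization this covers both corners (n = 1 - p) and annihilators of the negative part of h -
  t.\<close>

lemma hereditary_annihilator:
  fixes n :: "'a::cstar_algebra unitization"
  assumes n: "star n = n"
  shows "hereditary_subalgebra {x. n * embed_unit x = 0 \<and> embed_unit x * n = 0}" (is "hereditary_subalgebra ?C")
proof -
  note cont = bounded_linear.continuous_on[OF bounded_linear_embed_unit continuous_on_id]
  have "closed ?C"
    unfolding Collect_conj_eq
    by (intro closed_Int closed_Collect_eq continuous_on_mult continuous_on_const cont)
  moreover have "cvec.subspace ?C"
    by (auto simp: cvec.subspace_def embed_unit_simps distrib_left distrib_right mult_scaleC_left mult_scaleC_right)
  moreover have "x * y \<in> ?C" if "x \<in> ?C" "y \<in> ?C" for x y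
    using that by (simp add: embed_unit_simps mult.assoc) (simp flip: mult.assoc)
  moreover have "star x \<in> ?C" if "x \<in> ?C" for x
  proof -
    have "n * star (embed_unit x) = star (embed_unit x * n)" "star (embed_unit x) * n = star (n * embed_unit x)"
      by (simp_all add: star_mult n)
    then show ?thesis using that by (simp add: embed_unit_simps)
  qed
  moreover have "a \<in> ?C" if ac: "a \<in> pos_cone UNIV" "c \<in> pos_cone ?C" "cstar_le a c" for a c
  proof -
    obtain y where y: "c = star y * y" "embed_unit y * n = 0" using ac(2) by (auto simp: pos_cone_def)
    obtain s where s: "star s = s" "a = s * s" using ac(1) by (auto simp: pos_cone_UNIV_iff sa_square_def)
    define k where "k = embed_unit s * n"
    have "sa_square (embed_unit (c - a))"
      using ac(3) by (simp add: cstar_le_def pos_cone_UNIV_iff)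
    then have "sa_square (star n * embed_unit (c - a) * n)" by (rule sa_square_conj)
    moreover have "star n * embed_unit (c - a) * n = - (star k * k)"
      by (simp add: k_def n y s embed_unit_simps star_mult algebra_simps flip: embed_unit_simps(6))
    ultimately have "star k * k = 0"
      using sa_square_antisym[OF sa_square_star_mult[of k]] by simp
    then have k0: "embed_unit s * n = 0" by (simp add: k_def)
    moreover have "n * embed_unit s = star (embed_unit s * n)"
      by (simp add: star_mult n s flip: embed_unit_simps(6))
    ultimately have "n * embed_unit s = 0" by simp
    with k0 show ?thesis by (simp add: s embed_unit_simps mult.assoc) (simp flip: mult.assoc)
  qed
  ultimately show ?thesis unfolding hereditary_subalgebra_def cstar_subalgebra_def by blast
qed

lemma hereditary_Int:
  assumes "hereditary_subalgebra C" "hereditary_subalgebra D"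
  shows "hereditary_subalgebra (C \<inter> D)"
proof -
  have "pos_cone (C \<inter> D) \<subseteq> pos_cone C \<inter> pos_cone D" by (auto simp: pos_cone_def)
  then show ?thesis
    using assms unfolding hereditary_subalgebra_def cstar_subalgebra_def
    by (simp add: cvec.subspace_inter closed_Int) blast
qed

lemma hereditary_corner:
  assumes "star p = p"
  shows "hereditary_subalgebra {x. p * x = x \<and> x * p = (x :: 'a::cstar_algebra)}"
proof -
  have "{x. p * x = x \<and> x * p = x}
      = {x. (1 - embed_unit p) * embed_unit x = 0 \<and> embed_unit x * (1 - embed_unit p) = 0}"
    by (auto simp: algebra_simps simp flip: embed_unit_simps)
  then show ?thesis
    using hereditary_annihilator[of "1 - embed_unit p"] assms
    by (simp add: star_simps flip: embed_unit_simps(6))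
qed

lemma cprojection_mult [simp]: "cprojection p \<Longrightarrow> p * p = p"
  and cprojection_star [simp]: "cprojection p \<Longrightarrow> star p = p"
  by (simp_all add: cprojection_def)

lemma cprojection_absorb: "cprojection p \<Longrightarrow> p * (p * x) = p * x"
  by (simp flip: mult.assoc)

lemma norm_cprojection: "cprojection p \<Longrightarrow> p \<noteq> 0 \<Longrightarrow> norm p = 1"
  using cstar_identity[of p] by (simp add: power2_eq_square)

lemma norm_cprojection_le: "cprojection p \<Longrightarrow> norm p \<le> 1"
  using norm_cprojection[of p] by (cases "p = 0") auto

lemma sa_square_cprojection: "cprojection p \<Longrightarrow> sa_square p"
  using sa_squareI[of p] by simp

lemma infinite_projection_nonzero: "infinite_projection p \<Longrightarrow> p \<noteq> 0"
  by (auto simp: infinite_projection_def)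

lemma isometry_right_unit:
  fixes u :: "'a::cstar_algebra"
  assumes "star u * u = P" "cprojection P"
  shows "u * P = u"
proof -
  have "star (u * P - u) * (u * P - u) = 0"
    using assms(2) by (simp add: star_simps algebra_simps cprojection_absorb assms(1))
      (simp add: assms flip: mult.assoc)
  then show ?thesis by simp
qed

lemma norm_isometry_le:
  fixes u :: "'a::cstar_algebra"
  assumes "star u * u = P" "cprojection P"
  shows "norm u \<le> 1"
proof -
  have "(norm u)\<^sup>2 \<le> 1\<^sup>2" using cstar_identity[of u] norm_cprojection_le[OF assms(2)] by (simp add: assms)
  then show ?thesis by (rule power2_le_imp_le) simp
qed

lemma purely_infiniteD:
  assumes "purely_infinite TYPE('a::cstar_algebra)" "hereditary_subalgebra C" "x \<in> C" "x \<noteq> (0::'a)"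
  obtains q where "q \<in> C" "infinite_projection q" "cprojection q" "q \<noteq> 0"
proof -
  have "C \<noteq> {0}" using assms by auto
  then obtain q where "q \<in> C" "infinite_projection q"
    using assms unfolding purely_infinite_def by blast
  then show thesis
    using that infinite_projection_nonzero by (auto simp: infinite_projection_def)
qed

lemma norm_le_of_le_unit:
  fixes a :: "'a::cstar_algebra"
  assumes "sa_square a" "sa_square (t *\<^sub>R 1 - embed_unit a)" "0 \<le> t"
  shows "norm a \<le> t"
  using norm_le_of_sa_square_diff[of "embed_unit a" t] assms by simp

text \<open>
  With \<open>a = h - t\<close> in the unitization, \<open>h a\<^sub>+ h\<close> is a non-zero element that is annihilated by
  \<open>a\<^sub>-\<close>; the projection is found in the annihilator of \<open>a\<^sub>-\<close>.
\<close>

lemma top_projection: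
  fixes h :: "'a::cstar_algebra"
  assumes pi: "purely_infinite TYPE('a)"
    and h: "sa_square h" and P: "cprojection P" "P * h = h" and t: "0 < t" "t < norm h"
  obtains q where "cprojection q" "q \<noteq> 0" "P * q = q" "sa_square (q * h * q - t *\<^sub>R q)"
proof -
  define H where "H = embed_unit h"
  have hs: "star h = h" by (rule sa_square_star[OF h])
  have Hs: "star H = H" by (simp add: H_def hs flip: embed_unit_simps)
  have hP: "h * P = h" using P hs by (metis cprojection_star star_mult)
  define a where "a = H - t *\<^sub>R 1"
  have as: "star a = a" by (simp add: a_def star_simps Hs)
  obtain s where s: "star s = s" "s * s = a * a" "sa_square s" "\<And>y. y * a = a * y \<Longrightarrow> y * s = s * y"
    using sa_abs[OF as] by blast
  have comm: "a * s = s * a" "H * s = s * H" "H * a = a * H"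
    by (intro s(4); simp add: a_def algebra_simps)+ (simp add: a_def algebra_simps)
  \<comment> \<open>\<open>f\<close> and \<open>n\<close> are twice the positive and the negative
    part of \<open>a\<close>.\<close>
  define f where "f = s + a"
  define n where "n = s - a"
  have nf: "n * f = 0" "f * n = 0" by (simp_all add: n_def f_def algebra_simps s comm)
  have ns: "star n = n" and fs: "star f = f" by (simp_all add: n_def f_def star_simps s as)
  have Hn: "H * n = n * H" and Hf: "H * f = f * H" by (simp_all add: n_def f_def algebra_simps comm)
  \<comment> \<open>Sandwiching by \<open>H\<close> puts the element visibly in \<open>A\<close> and
    in the corner of \<open>P\<close>.\<close>
  define k where "k = upart (H * f * H)"
  have k: "embed_unit k = H * f * H" unfolding k_def by (rule embed_unit_upart) (simp add: H_def)
  let ?C = "{x. n * embed_unit x = 0 \<and> embed_unit x * n = 0} \<inter> {x. P * x = x \<and> x * P = x}"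
  have "n * (H * f * H) = H * (n * f) * H" "(H * f * H) * n = H * (f * n) * H"
    by (simp_all add: mult.assoc Hn) (simp_all add: Hn flip: mult.assoc)
  moreover have "P * k = k" "k * P = k"
  proof -
    have "embed_unit (P * k) = embed_unit (P * h) * f * H" "embed_unit (k * P) = H * f * embed_unit (h * P)"
      by (simp_all add: embed_unit_simps k H_def mult.assoc)
    then have "embed_unit (P * k) = embed_unit k" "embed_unit (k * P) = embed_unit k"
      unfolding P hP k by (simp_all add: H_def)
    then show "P * k = k" "k * P = k" by simp_all
  qed
  ultimately have "k \<in> ?C" by (simp add: k nf)
  \<comment> \<open>Otherwise \<open>H * f = 0\<close>, and then s f = - t f although
    \<open>s\<close> is positive; this forces f = 0, that is h \<le> t.\<close>
  moreover have "k \<noteq> 0"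
  proof
    assume "k = 0"
    then have "H * f * H = 0" using k by (simp add: embed_unit_simps)
    then have "star (H * f) * (H * f) = 0" by (simp add: star_mult Hs fs Hf[symmetric]) (simp flip: mult.assoc)
    then have "H * f = 0" by simp
    then have "a * f = - (t *\<^sub>R f)" by (simp add: a_def algebra_simps)
    moreover have "a * f = s * f" by (simp add: f_def algebra_simps s comm)
    ultimately have sf: "s * f = - (t *\<^sub>R f)" by simp
    have "sa_square (star f * s * f)" by (rule sa_square_conj[OF s(3)])
    then have "sa_square (- (t *\<^sub>R (f * f)))" by (simp add: mult.assoc sf fs)
    moreover have "sa_square (t *\<^sub>R (f * f))" using t by (intro sa_square_scaleR sa_squareI fs) auto
    ultimately have "t *\<^sub>R (f * f) = 0" by (intro sa_square_antisym)
    then have "star f * f = 0" using t fs by simp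
    then have "f = 0" by simp
    then have "s = t *\<^sub>R 1 - embed_unit h" by (simp add: f_def a_def H_def algebra_simps eq_neg_iff_add_eq_0)
    then have "norm h \<le> t" using h s(3) t by (intro norm_le_of_le_unit) auto
    with t show False by simp
  qed
  moreover have "hereditary_subalgebra ?C"
    by (intro hereditary_Int hereditary_annihilator hereditary_corner ns) (use P in auto)
  ultimately obtain q where q: "q \<in> ?C" "cprojection q" "q \<noteq> 0"
    using purely_infiniteD[OF pi] by blast
  \<comment> \<open>\<open>q\<close> kills the negative part, so on \<open>q\<close> the element
    \<open>a\<close> acts as its absolute value.\<close>
  have "a * embed_unit q = s * embed_unit q" using q(1) by (simp add: n_def left_diff_distrib)
  then have "embed_unit q * (a * embed_unit q) = star (embed_unit q) * s * embed_unit q"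
    using q(2) by (simp add: mult.assoc flip: embed_unit_simps(6))
  then have "sa_square (embed_unit q * (a * embed_unit q))"
    using sa_square_conj[OF s(3)] by metis
  moreover have "embed_unit q * (a * embed_unit q) = embed_unit (q * h * q - t *\<^sub>R q)"
    using q(2) by (simp add: a_def H_def embed_unit_simps algebra_simps flip: embed_unit_simps(5))
  ultimately show thesis using that[of q] q by simp
qed

lemma corner_norm_diff:
  fixes B :: "'a::cstar_algebra"
  assumes "sa_square B" "cprojection q" "q * B = B" "norm B \<le> k"
  shows "sa_square (k *\<^sub>R q - B)"
proof -
  have Bs: "star B = B" by (rule sa_square_star[OF assms(1)])
  then have Bq: "B * q = B" using assms by (metis cprojection_star star_mult)
  have "sa_square (k *\<^sub>R 1 - embed_unit B)"
    using assms Bs by (intro sa_square_norm_diff) (auto simp flip: embed_unit_simps)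
  from sa_square_conj[OF this, of "embed_unit q"]
  have "sa_square (embed_unit (k *\<^sub>R q - B))"
    using assms Bq by (simp add: algebra_simps embed_unit_simps flip: embed_unit_simps(5,6))
  then show ?thesis by simp
qed

text \<open>\<open>q\<close> is the unit of the corner containing \<open>B\<close>, so t q acts
  there as a scalar shift: \<open>k *\<^sub>R q\<close> dominates B + t q, hence (k - t) q dominates
  \<open>B\<close>. Norms thus add up instead of merely dominating each other.\<close>

lemma norm_corner_shift:
  fixes B :: "'a::cstar_algebra"
  assumes B: "sa_square B" and q: "cprojection q" "q \<noteq> 0" "q * B = B" and t: "0 \<le> t"
    and D: "sa_square (D - t *\<^sub>R q)"
  shows "norm B + t \<le> norm (B + D)"
proof -
  define k where "k = norm (B + t *\<^sub>R q)"
  have tq: "sa_square (t *\<^sub>R q)" using q t by (intro sa_square_scaleR sa_square_cprojection)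
  have "t \<le> k" using norm_mono[OF tq B] q t by (simp add: k_def norm_cprojection add.commute)
  have "sa_square (k *\<^sub>R q - (B + t *\<^sub>R q))"
    using q B tq by (intro corner_norm_diff sa_square_plus) (auto simp: distrib_left k_def)
  then have "norm B \<le> norm ((k - t) *\<^sub>R q)"
    by (intro norm_mono_diff[OF B]) (simp add: algebra_simps)
  then have "norm B + t \<le> k" using q \<open>t \<le> k\<close> by (simp add: norm_cprojection)
  also have "k \<le> norm (B + D)"
    using norm_mono_diff[of "B + t *\<^sub>R q" "B + D"] D sa_square_plus[OF B tq] by (simp add: k_def)
  finally show ?thesis .
qed

section \<open>Projections in purely infinite simple algebras\<close>

lemma closure_additive:
  fixes S :: "'a::real_normed_vector set"
  assumes "\<And>x y. x \<in> S \<Longrightarrow> y \<in> S \<Longrightarrow> x + y \<in> S" "a \<in> closure S" "b \<in> closure S"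
  shows "a + b \<in> closure S"
proof -
  obtain f g where "\<forall>n. f n \<in> S" "f \<longlonglongrightarrow> a" "\<forall>n. g n \<in> S" "g \<longlonglongrightarrow> b"
    using assms by (meson closure_sequential)
  then show ?thesis
    using assms(1) tendsto_add[of f a sequentially g b] unfolding closure_sequential by meson
qed

lemma closure_image_bounded_linear:
  assumes "bounded_linear f" "\<And>x. x \<in> S \<Longrightarrow> f x \<in> T" "a \<in> closure S"
  shows "f a \<in> closure T"
proof -
  obtain g where g: "\<forall>n. g n \<in> S" "g \<longlonglongrightarrow> a" using assms(3) by (meson closure_sequential)
  then have "(\<lambda>n. f (g n)) \<longlonglongrightarrow> f a" using bounded_linear.tendsto[OF assms(1)] by blast
  then show ?thesis using assms(2) g unfolding closure_sequential by meson
qed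

text \<open>The closure of these sums is a closed ideal containing \<open>r = r * r * r\<close>,
  hence everything. With lists of pairs the ideal operations become list operations.\<close>

lemma simple_approx:
  fixes r z :: "'a::cstar_algebra"
  assumes "simple_cstar TYPE('a)" "cprojection r" "r \<noteq> 0" "e > 0"
  obtains ps where "norm (z - (\<Sum>(x, y)\<leftarrow>ps. x * r * y)) < e"
proof -
  let ?F = "\<lambda>ps. \<Sum>(x, y)\<leftarrow>ps. x * r * (y::'a)"
  let ?S = "range ?F"
  have scale: "c *\<^sub>C ?F ps = ?F (map (\<lambda>(x, y). (c *\<^sub>C x, y)) ps)" for c ps
    by (induction ps) (auto simp: scaleC_add_right mult_scaleC_left)
  have left: "a * ?F ps = ?F (map (\<lambda>(x, y). (a * x, y)) ps)" for a ps
    by (induction ps) (auto simp: distrib_left mult.assoc)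
  have right: "?F ps * a = ?F (map (\<lambda>(x, y). (x, y * a)) ps)" for a ps
    by (induction ps) (auto simp: distrib_right mult.assoc)
  have add: "?F ps + ?F qs = ?F (ps @ qs)" for ps qs by simp
  have S_add: "x + y \<in> ?S" if xy: "x \<in> ?S" "y \<in> ?S" for x y
  proof -
    obtain ps qs where "x = ?F ps" "y = ?F qs" using xy by blast
    then show ?thesis by (simp only: add) (rule rangeI)
  qed
  have S_scale: "c *\<^sub>C x \<in> ?S" and S_left: "a * x \<in> ?S" and S_right: "x * a \<in> ?S"
    if x: "x \<in> ?S" for x a c
  proof -
    obtain ps where ps: "x = ?F ps" using x by blast
    show "c *\<^sub>C x \<in> ?S" unfolding ps scale by (rule rangeI)
    show "a * x \<in> ?S" unfolding ps left by (rule rangeI)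
    show "x * a \<in> ?S" unfolding ps right by (rule rangeI)
  qed
  have "closed_ideal (closure ?S)"
    unfolding closed_ideal_def cvec.subspace_def
  proof (intro conjI allI ballI)
    show "0 \<in> closure ?S" by (rule subsetD[OF closure_subset]) (auto intro!: image_eqI[of _ _ "[]"])
  next
    fix a b assume "a \<in> closure ?S" "b \<in> closure ?S"
    then show "a + b \<in> closure ?S" using closure_additive[of ?S a b] S_add by blast
  next
    fix c a assume "a \<in> closure ?S"
    then show "c *\<^sub>C a \<in> closure ?S"
      by (rule closure_image_bounded_linear[OF bounded_linear_scaleC, rotated]) (rule S_scale)
  next
    fix a b assume b: "b \<in> closure ?S"
    show "a * b \<in> closure ?S" using b
      by (rule closure_image_bounded_linear[OF bounded_linear_mult_right, rotated]) (rule S_left)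
    show "b * a \<in> closure ?S" using b
      by (rule closure_image_bounded_linear[OF bounded_linear_mult_left, rotated]) (rule S_right)
  qed simp
  moreover have "r \<in> closure ?S"
    by (rule subsetD[OF closure_subset]) (use assms(2) in \<open>auto intro!: image_eqI[of _ _ "[(r, r)]"]\<close>)
  ultimately have "z \<in> closure ?S"
    using assms(1,3) unfolding simple_cstar_def by auto
  then obtain ps where "dist (?F ps) z < e" using assms(4) unfolding closure_approachable by blast
  then show thesis by (intro that[of ps]) (simp add: dist_norm norm_minus_commute)
qed

text \<open>\<open>y\<close> is the Neumann inverse of 1 - e times the square root of 1 - e; both
  are limits of expressions in \<open>e\<close>, so they commute with whatever commutes with
  \<open>e\<close>.\<close>

lemma inverse_sqrt:
  fixes e :: "'a::unital_cstar_algebra"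
  assumes "star e = e" "norm e < 1"
  obtains y where "star y = y" "y * (1 - e) * y = 1" "\<And>z. z * e = e * z \<Longrightarrow> z * y = y * z"
proof -
  have "norm (1 *\<^sub>R 1 - (1 - e)) \<le> 1" "star (1 - e) = 1 - e" using assms by (simp_all add: star_simps)
  then obtain s where s: "star s = s" "s * s = 1 - e"
    and comm: "\<And>y. y * (1 - e) = (1 - e) * y \<Longrightarrow> y * s = s * y"
    using sa_sqrt by metis
  have cs: "z * s = s * z" if "z * e = e * z" for z
    by (rule comm) (simp add: algebra_simps that)
  define S where "S n = (\<Sum>k<n. e ^ k)" for n
  have "S n * (1 - e) = 1 - e ^ n" for n
  proof (induction n)
    case (Suc n)
    have "S (Suc n) * (1 - e) = S n * (1 - e) + (e ^ n - e ^ n * e)"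
      by (simp add: S_def distrib_right right_diff_distrib)
    then show ?case by (simp add: Suc power_Suc2 del: power_Suc)
  qed (simp add: S_def)
  then have lim: "(\<lambda>n. S n * (1 - e)) \<longlonglongrightarrow> 1 - 0"
    by (simp only:) (intro tendsto_diff tendsto_const LIMSEQ_power_zero assms)
  have "summable (\<lambda>n. e ^ n)"
    by (rule summable_norm_cancel, rule summable_comparison_test'[of "\<lambda>n. norm e ^ n" 0])
      (use assms in \<open>auto simp: norm_power_ineq summable_geometric\<close>)
  then obtain i where i: "S \<longlonglongrightarrow> i" unfolding S_def summable_def sums_def by blast
  have i1: "i * (1 - e) = 1"
    using LIMSEQ_unique[OF tendsto_mult_right[OF i] lim] by simp
  have "star (e ^ k) = e ^ k" for k
    by (induction k) (simp_all add: star_mult assms power_commutes)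
  then have "S n \<in> {z. star z = z}" for n by (simp add: S_def star_sum)
  then have "star i = i" using closed_sequentially[OF closed_sa _ i] by simp
  have ci: "z * i = i * z" if "z * e = e * z" for z
  proof -
    have "z * e ^ k = e ^ k * z" for k by (rule power_commuting_commutes[symmetric]) (simp add: that)
    then have "S n \<in> {w. z * w = w * z}" for n by (simp add: S_def sum_distrib_left sum_distrib_right)
    then show ?thesis using closed_sequentially[OF closed_commutant _ i] by simp
  qed
  have "s * e = e * s" using cs[of e] by simp
  then have si: "s * i = i * s" by (rule ci)
  show thesis
  proof (rule that[of "i * s"])
    show "star (i * s) = i * s" by (simp add: star_mult s \<open>star i = i\<close> si)
    have iss: "i * (s * s) = 1" by (simp add: s(2) i1)
    have "s * (i * s) = i * (s * s)" using si by (metis mult.assoc)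
    moreover have "i * s * (1 - e) * (i * s) = (i * (s * s)) * (s * (i * s))"
      by (simp add: mult.assoc flip: s(2))
    ultimately show "i * s * (1 - e) * (i * s) = 1" by (simp add: iss)
    fix z assume z: "z * e = e * z"
    show "z * (i * s) = i * s * z" using ci[OF z] cs[OF z] by (metis mult.assoc)
  qed
qed

lemma projection_le_absorb:
  fixes p q :: "'a::cstar_algebra"
  assumes "cprojection p" "cprojection q" "cstar_le q p"
  shows "p * q = q" "q * p = q"
proof -
  define s where "s = q - q * p"
  have "sa_square (p - q)" using assms(3) by (simp add: cstar_le_def pos_cone_UNIV_iff)
  then have "sa_square (embed_unit (p - q))" by simp
  from sa_square_conj[OF this, of "1 - embed_unit p"]
  have "sa_square (embed_unit (- (star s * s)))"
    using assms(1,2)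
    by (simp add: s_def star_simps embed_unit_simps algebra_simps cprojection_absorb flip: embed_unit_simps(5,6))
  then have "star s * s = 0" using sa_square_antisym[OF sa_square_star_mult[of s]] by simp
  then show "q * p = q" by (simp add: s_def)
  then show "p * q = q" using assms(1,2) by (metis cprojection_star star_mult)
qed

text \<open>\<open>v\<close> is a non-unitary isometry of the corner of \<open>p\<close>, with
  defect \<open>r = p - q\<close>. As for a shift, applying powers of \<open>v\<close> to
  \<open>r\<close> gives copies of \<open>r\<close> with mutually orthogonal ranges.\<close>

lemma infinite_projection_family:
  fixes p :: "'a::cstar_algebra"
  assumes "infinite_projection p"
  obtains r and e :: "nat \<Rightarrow> 'a" where "cprojection r" "r \<noteq> 0"
    "\<And>i j. star (e i) * e j = (if i = j then r else 0)" "\<And>i. p * e i = e i"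
proof -
  obtain q v where p: "cprojection p" and q: "cprojection q" "cstar_le q p" "q \<noteq> p"
    and v: "star v * v = p" "v * star v = q"
    using assms by (auto simp: infinite_projection_def)
  note pq = projection_le_absorb[OF p q(1,2)]
  have qv: "q * v = v"
  proof -
    have "star (q * v - v) * (q * v - v) = star v * q * v - star v * q * v - star v * q * v + star v * v"
      using q(1) by (simp add: star_simps algebra_simps cprojection_absorb)
    also have "star v * q * v = star v * v * (star v * v)" by (simp add: mult.assoc flip: v(2))
    finally have "star (q * v - v) * (q * v - v) = 0" using p by (simp add: v)
    then show ?thesis by simp
  qed
  define r where "r = p - q"
  have r: "cprojection r" unfolding cprojection_def r_def using p q pq by (simp add: star_simps algebra_simps)
  have rv: "r * v = 0"
  proof -
    have "p * v = v" using qv pq(1) by (metis mult.assoc)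
    then show ?thesis by (simp add: r_def left_diff_distrib qv)
  qed
  define e where "e i = ((*) v ^^ i) r" for i
  have e0: "e 0 = r" and eS: "e (Suc i) = v * e i" for i by (simp_all add: e_def)
  have pe: "p * e i = e i" for i
  proof (cases i)
    case 0
    then show ?thesis using p pq by (simp add: e0 r_def algebra_simps)
  next
    case (Suc k)
    have "p * v = v" using qv pq(1) by (metis mult.assoc)
    then show ?thesis unfolding Suc eS by (simp flip: mult.assoc)
  qed
  have ee: "star (e i) * e j = (if i = j then r else 0)" for i j
  proof (induction i arbitrary: j)
    case 0
    show ?case using r rv by (cases j) (simp_all add: e0 eS flip: mult.assoc)
  next
    case (Suc i)
    show ?case
    proof (cases j)
      case 0
      have "star v * r = star (r * v)" using r by (simp add: star_mult)
      then have "star v * r = 0" by (simp add: rv)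
      then show ?thesis using 0 by (simp add: e0 eS star_mult mult.assoc)
    next
      case (Suc k)
      have "star (e (Suc i)) * e (Suc k) = star (e i) * (star v * v * e k)"
        by (simp add: eS star_mult mult.assoc)
      then show ?thesis using Suc.IH[of k] unfolding \<open>j = Suc k\<close> by (simp add: v pe)
    qed
  qed
  show thesis by (rule that[OF r _ ee pe]) (use q(3) in \<open>simp add: r_def\<close>)
qed

text \<open>Polar decomposition in the corner: the lower bound makes \<open>star w * w\<close>
  invertible in \<open>P A P\<close>, and \<open>z\<close> is its inverse square root.\<close>

lemma corner_isometry:
  fixes w :: "'a::cstar_algebra"
  assumes P: "cprojection P" and w: "w * P = w" and K: "0 \<le> K"
    and low: "sa_square (K *\<^sub>R (star w * w) - (1/4) *\<^sub>R P)"
  obtains u z where "u = w * z" "star u * u = P"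
proof -
  define h where "h = star w * w"
  have hP: "P * h = h" "h * P = h"
    using P w by (simp_all add: h_def mult.assoc) (metis cprojection_star mult.assoc star_mult)
  \<comment> \<open>Writing \<open>h = M *\<^sub>R (P - e)\<close>, the lower bound gives norm e
    \<le> 1 - c. The added 1 in \<open>M\<close> and \<open>L\<close> keeps both at least 1, so that
    0 < c < 1.\<close>
  define M where "M = norm h + 1"
  define L where "L = K + 1"
  define c where "c = 1 / (4 * L * M)"
  have LM: "L \<ge> 1" "M \<ge> 1" using K by (simp_all add: L_def M_def)
  then have "L * M \<ge> 1 * 1" by (intro mult_mono) auto
  then have c: "0 < c" "c < 1" using LM by (simp_all add: c_def)
  have h: "sa_square h" by (simp add: h_def sa_square_star_mult)
  define e where "e = P - (1/M) *\<^sub>R h"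
  have "norm h + 1 > 0" by (simp add: add_nonneg_pos)
  then have "norm ((1/M) *\<^sub>R h) \<le> 1" by (simp add: M_def)
  moreover have "sa_square ((1/M) *\<^sub>R h)" using h LM by (intro sa_square_scaleR) auto
  ultimately have "sa_square (1 *\<^sub>R P - (1/M) *\<^sub>R h)"
    by (intro corner_norm_diff) (use P hP in auto)
  then have e: "sa_square e" by (simp add: e_def)
  have "sa_square (L *\<^sub>R h - (1/4) *\<^sub>R P)"
    using sa_square_plus[OF low h] by (simp add: L_def h_def algebra_simps)
  then have "sa_square ((1 / (L * M)) *\<^sub>R (L *\<^sub>R h - (1/4) *\<^sub>R P))"
    using LM by (intro sa_square_scaleR) auto
  also have "(1 / (L * M)) *\<^sub>R (L *\<^sub>R h - (1/4) *\<^sub>R P) = (1 - c) *\<^sub>R P - e"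
    using LM by (simp add: e_def c_def algebra_simps)
  finally have "norm e \<le> norm ((1 - c) *\<^sub>R P)" using norm_mono_diff[OF e] by blast
  also have "\<dots> \<le> (1 - c) * 1" using norm_cprojection_le[OF P] c by (simp add: mult_left_le)
  finally have "norm (embed_unit e) < 1" using c by simp
  moreover have "star (embed_unit e) = embed_unit e"
    using sa_square_star[OF e] by (simp flip: embed_unit_simps)
  ultimately obtain y where y: "star y = y" "y * (1 - embed_unit e) * y = 1"
    and comm: "\<And>z. z * embed_unit e = embed_unit e * z \<Longrightarrow> z * y = y * z"
    using inverse_sqrt by blast
  have Pe: "P * e = e" "e * P = e" using P hP by (simp_all add: e_def algebra_simps)
  have Py: "embed_unit P * y = y * embed_unit P"
    by (rule comm) (simp add: Pe flip: embed_unit_simps)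
  define z where "z = upart (sqrt (1/M) *\<^sub>R (y * embed_unit P))"
  have z: "embed_unit z = sqrt (1/M) *\<^sub>R (y * embed_unit P)"
    unfolding z_def by (rule embed_unit_upart) simp
  define u where "u = w * z"
  have "sqrt (1/M) * sqrt (1/M) = 1/M" using LM by (simp del: real_sqrt_divide)
  then have sqM: "sqrt (1/M) * (M * sqrt (1/M)) = 1" using LM by (simp add: field_simps)
  have hM: "h = M *\<^sub>R (P - e)" using LM by (simp add: e_def)
  have "embed_unit (star u * u) = embed_unit (star z) * embed_unit h * embed_unit z"
    by (simp add: u_def h_def star_mult embed_unit_simps mult.assoc)
  also have "\<dots> = (embed_unit P * y) * embed_unit (P - e) * (y * embed_unit P)"
    using LM P y(1) sqM unfolding embed_unit_simps(6) z hM
    by (simp add: star_simps embed_unit_simps flip: embed_unit_simps(6))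
  also have "embed_unit (P - e) = embed_unit P * (1 - embed_unit e)"
    by (simp add: Pe algebra_simps flip: embed_unit_simps)
  also have "(embed_unit P * y) * (embed_unit P * (1 - embed_unit e)) * (y * embed_unit P)
      = embed_unit P * (embed_unit P * (y * (1 - embed_unit e) * y)) * embed_unit P"
    by (simp add: Py mult.assoc) (simp add: Py flip: mult.assoc)
  also have "\<dots> = embed_unit P" using P by (simp add: y flip: embed_unit_simps)
  finally have "star u * u = P" by simp
  then show thesis using that u_def by blast
qed

lemma infinite_subprojection:
  fixes p :: "'a::cstar_algebra"
  assumes pi: "purely_infinite TYPE('a)" and p: "cprojection p" "p \<noteq> 0"
  obtains p' where "p * p' = p'" "infinite_projection p'"
proof -
  have "p \<in> {x. p * x = x \<and> x * p = x}" using p by simp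
  then obtain p' where "p' \<in> {x. p * x = x \<and> x * p = x}" "infinite_projection p'"
    using purely_infiniteD[OF pi hereditary_corner[OF cprojection_star[OF p(1)]]] p(2) by blast
  then show thesis by (intro that[of p']) simp_all
qed

text \<open>Cuntz comparison: simplicity approximates \<open>P\<close> by a sum of
  \<open>x i * r * y i\<close>, and orthogonal copies \<open>e i\<close> of \<open>r\<close> below
  \<open>p\<close> factor this sum as \<open>X * w0\<close> with \<open>p * w0 = w0\<close>. Hence
  \<open>w0 * P\<close> is bounded below on \<open>P\<close>, and its polar part is the
  isometry.\<close>

lemma projection_comparison:
  fixes P p :: "'a::cstar_algebra"
  assumes si: "simple_cstar TYPE('a)" and pi: "purely_infinite TYPE('a)"
    and P: "cprojection P" and p: "cprojection p" "p \<noteq> 0"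
  obtains u where "star u * u = P" "p * u = u"
proof -
  obtain p' where p': "p * p' = p'" "infinite_projection p'"
    using infinite_subprojection[OF pi p] by blast
  obtain r and e :: "nat \<Rightarrow> 'a" where r: "cprojection r" "r \<noteq> 0"
    and ee: "\<And>i j. star (e i) * e j = (if i = j then r else 0)" and pe': "\<And>i. p' * e i = e i"
    using infinite_projection_family[OF p'(2)] by blast
  have pe: "p * e i = e i" for i using pe' p'(1) by (metis mult.assoc)
  obtain ps where ps: "norm (P - (\<Sum>(x, y)\<leftarrow>ps. x * r * y)) < 1/2"
    using simple_approx[OF si r, of "1/2"] by auto
  define x y where "x i = fst (ps ! i)" and "y i = snd (ps ! i)" for i
  define n where "n = length ps"
  define w0 where "w0 = (\<Sum>i<n. e i * y i)"
  define X where "X = (\<Sum>i<n. x i * star (e i))"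
  have "X * w0 = (\<Sum>i<n. \<Sum>j<n. x i * (star (e i) * e j) * y j)"
    by (simp add: X_def w0_def sum_product mult.assoc)
  also have "\<dots> = (\<Sum>i<n. x i * r * y i)"
  proof (rule sum.cong)
    fix i assume "i \<in> {..<n}"
    have "(\<Sum>j<n. x i * (star (e i) * e j) * y j) = (\<Sum>j<n. if i = j then x i * r * y j else 0)"
      by (rule sum.cong) (auto simp: ee)
    then show "(\<Sum>j<n. x i * (star (e i) * e j) * y j) = x i * r * y i"
      using \<open>i \<in> {..<n}\<close> by simp
  qed simp
  also have "\<dots> = (\<Sum>(x, y)\<leftarrow>ps. x * r * y)"
    by (simp add: sum_list_sum_nth n_def x_def y_def case_prod_unfold atLeast0LessThan)
  finally have Xw: "norm (P - X * w0) < 1/2" using ps by simp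
  define w where "w = w0 * P"
  define Y where "Y = X * w"
  define D where "D = P - Y"
  have "D = (P - X * w0) * P" using P by (simp add: D_def Y_def w_def algebra_simps)
  then have "norm D \<le> norm (P - X * w0) * norm P" by (simp add: norm_mult_ineq)
  also have "\<dots> \<le> (1/2) * 1" using Xw norm_cprojection_le[OF P] by (intro mult_mono) auto
  finally have "(norm D)\<^sup>2 \<le> (1/2)\<^sup>2" by (intro power_mono) auto
  then have D: "norm (star D * D) \<le> 1/4" by (simp add: cstar_identity power2_eq_square)
  have DP: "P * star D = star D"
  proof -
    have "D * P = D" using P by (simp add: D_def Y_def w_def algebra_simps)
    then show ?thesis using P by (metis cprojection_star star_mult)
  qed
  have a1: "sa_square ((1/4) *\<^sub>R P - star D * D)"
    by (rule corner_norm_diff[OF sa_square_star_mult P _ D]) (simp add: DP flip: mult.assoc)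
  \<comment> \<open>Since Y + D = P, positivity of this square gives, as in the parallelogram law,
    \<open>star Y * Y\<close> \<ge> P/2 - \<open>star D * D\<close> \<ge> P/4.\<close>
  have a2: "sa_square (star (Y - D) * (Y - D))" by (rule sa_square_star_mult)
  have "star P * P = star (Y + D) * (Y + D)" by (simp add: D_def)
  then have YD: "star Y * D + star D * Y = P - star Y * Y - star D * D"
    using P by (simp add: algebra_simps star_add)
  have "star (Y - D) * (Y - D) = 2 *\<^sub>R (star Y * Y) + 2 *\<^sub>R (star D * D) - P"
    using YD by (simp add: algebra_simps star_diff scaleR_2)
  with a2 have a5: "sa_square (2 *\<^sub>R (star Y * Y) + 2 *\<^sub>R (star D * D) - P)" by (simp only:)
  have "(2 *\<^sub>R (star Y * Y) + 2 *\<^sub>R (star D * D) - P) + 2 *\<^sub>R ((1/4) *\<^sub>R P - star D * D)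
      = 2 *\<^sub>R (star Y * Y) + ((1/2) *\<^sub>R P - 1 *\<^sub>R P)"
    by (simp add: algebra_simps)
  then have eq: "(2 *\<^sub>R (star Y * Y) + 2 *\<^sub>R (star D * D) - P) + 2 *\<^sub>R ((1/4) *\<^sub>R P - star D * D)
      = 2 *\<^sub>R (star Y * Y) - (1/2) *\<^sub>R P"
    unfolding scaleR_diff_left[symmetric] by simp
  have "sa_square (2 *\<^sub>R (star Y * Y) - (1/2) *\<^sub>R P)"
    using sa_square_plus[OF a5 sa_square_scaleR[OF a1, of 2]] unfolding eq by simp
  from sa_square_scaleR[OF this, of "1/2"]
  have a3: "sa_square (star Y * Y - (1/4) *\<^sub>R P)" by (simp add: algebra_simps)
  have "norm (star (embed_unit X) * embed_unit X) = (norm X)\<^sup>2" by (simp add: cstar_identity)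
  then have "sa_square ((norm X)\<^sup>2 *\<^sub>R 1 - star (embed_unit X) * embed_unit X)"
    by (intro sa_square_norm_diff) (simp_all add: star_simps)
  from sa_square_conj[OF this, of "embed_unit w"]
  have "sa_square (embed_unit ((norm X)\<^sup>2 *\<^sub>R (star w * w) - star Y * Y))"
    by (simp add: Y_def star_simps embed_unit_simps algebra_simps)
  then have "sa_square ((norm X)\<^sup>2 *\<^sub>R (star w * w) - star Y * Y)" by simp
  from sa_square_plus[OF this a3]
  have "sa_square ((norm X)\<^sup>2 *\<^sub>R (star w * w) - (1/4) *\<^sub>R P)" by simp
  then obtain u z where u: "u = w * z" "star u * u = P"
    using corner_isometry[OF P _ zero_le_power2] P by (metis w_def mult.assoc cprojection_mult)
  have "p * w0 = w0" by (simp add: w0_def sum_distrib_left pe flip: mult.assoc)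
  then have "p * u = u" by (simp add: u w_def flip: mult.assoc)
  with u that show thesis by blast
qed

text \<open>Orthogonal copies of \<open>P\<close> below \<open>p\<close> make room for off-diagonal
  elements: \<open>r\<close> is copied infinitely often, and \<open>P\<close> is embedded in
  \<open>r\<close>.\<close>

lemma projection_comparison_family:
  fixes P p :: "'a::cstar_algebra"
  assumes si: "simple_cstar TYPE('a)" and pi: "purely_infinite TYPE('a)"
    and P: "cprojection P" and p: "cprojection p" "p \<noteq> 0"
  obtains u :: "nat \<Rightarrow> 'a" where "\<And>i j. star (u i) * u j = (if i = j then P else 0)" "\<And>i. p * u i = u i"
proof -
  obtain p' where p': "p * p' = p'" "infinite_projection p'"
    using infinite_subprojection[OF pi p] by blast
  obtain r and e :: "nat \<Rightarrow> 'a" where r: "cprojection r" "r \<noteq> 0"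
    and ee: "\<And>i j. star (e i) * e j = (if i = j then r else 0)" and pe': "\<And>i. p' * e i = e i"
    using infinite_projection_family[OF p'(2)] by blast
  obtain v where v: "star v * v = P" "r * v = v"
    using projection_comparison[OF si pi P r] by blast
  show thesis
  proof (rule that[of "\<lambda>i. e i * v"])
    fix i j
    have "star (e i * v) * (e j * v) = star v * (star (e i) * e j * v)" by (simp add: star_mult mult.assoc)
    then show "star (e i * v) * (e j * v) = (if i = j then P else 0)" by (simp add: ee v)
  next
    fix i
    have "p * e i = e i" using pe' p'(1) by (metis mult.assoc)
    then show "p * (e i * v) = e i * v" by (simp flip: mult.assoc)
  qed
qed

section \<open>Intertwiners\<close>

lemma star_endomorphismD:
  assumes "star_endomorphism \<rho>"
  shows "\<rho> (x + y) = \<rho> x + \<rho> y" "\<rho> (x - y) = \<rho> x - \<rho> y" "\<rho> 0 = 0"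
    "\<rho> (c *\<^sub>C x) = c *\<^sub>C \<rho> x" "\<rho> (r *\<^sub>R x) = r *\<^sub>R \<rho> x"
    "\<rho> (x * y) = \<rho> x * \<rho> y" "\<rho> (star x) = star (\<rho> x)"
proof -
  interpret Vector_Spaces.linear scaleC scaleC \<rho>
    using assms by (simp add: star_endomorphism_def clinear_def)
  show "\<rho> (x + y) = \<rho> x + \<rho> y" "\<rho> (x - y) = \<rho> x - \<rho> y" "\<rho> 0 = 0" "\<rho> (c *\<^sub>C x) = c *\<^sub>C \<rho> x"
    by (simp_all add: add diff zero scale)
  then show "\<rho> (r *\<^sub>R x) = r *\<^sub>R \<rho> x" by (simp add: scaleR_scaleC scale)
  show "\<rho> (x * y) = \<rho> x * \<rho> y" "\<rho> (star x) = star (\<rho> x)"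
    using assms by (simp_all add: star_endomorphism_def)
qed

text \<open>For a contraction \<open>x\<close> the root relation of \<open>sqrt_iteration_sa\<close>
  does not mention the unit, so it passes through \<rho>. In the unitization it then reads
  \<open>star X * X + (1 - C) * (1 - C) = 1\<close>, a sum of positive elements.\<close>

lemma star_endomorphism_norm_le:
  assumes \<rho>: "star_endomorphism \<rho>"
  shows "norm (\<rho> x) \<le> norm x"
proof -
  note [simp] = star_endomorphismD[OF \<rho>]
  have contr: "norm (\<rho> x) \<le> 1" if x: "norm x \<le> 1" for x
  proof -
    have "norm (star x * x) \<le> 1" using x by (simp add: cstar_identity power_le_one)
    moreover have "star (star x * x) = star x * x" by (simp add: star_simps)
    ultimately obtain c where c: "c + c = star x * x + c * c" "star c = c"
      using sqrt_iteration_sa by blast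
    define X where "X = embed_unit (\<rho> x)"
    define C where "C = embed_unit (\<rho> c)"
    have Cs: "star C = C" by (simp add: C_def c(2) flip: embed_unit_simps star_endomorphismD(7)[OF \<rho>])
    have "embed_unit (\<rho> (c + c)) = embed_unit (\<rho> (star x * x + c * c))" by (simp only: c(1))
    then have "C + C = star X * X + C * C" by (simp add: C_def X_def embed_unit_simps)
    then have "star X * X + (1 - C) * (1 - C) = 1" by (simp add: algebra_simps)
    moreover have "sa_square (star X * X)" "sa_square ((1 - C) * (1 - C))"
      by (auto intro!: sa_square_star_mult sa_squareI simp: star_diff Cs)
    ultimately have "norm (star X * X) \<le> norm (1 :: 'a unitization)" by (metis norm_mono)
    then have "(norm (\<rho> x))\<^sup>2 \<le> 1\<^sup>2" by (simp add: cstar_identity X_def)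
    then show ?thesis by (rule power2_le_imp_le) simp
  qed
  show ?thesis
  proof (cases "x = 0")
    case False
    then have "norm (\<rho> ((1 / norm x) *\<^sub>R x)) \<le> 1" by (intro contr) simp
    then show ?thesis using False by (simp add: divide_le_eq)
  qed simp
qed

lemma cprojection_star_endomorphism: "star_endomorphism \<rho> \<Longrightarrow> cprojection p \<Longrightarrow> cprojection (\<rho> p)"
  unfolding cprojection_def by (metis star_endomorphismD(6,7))

lemma norm_mult_contraction:
  fixes x y :: "'a::real_normed_algebra"
  shows "norm x \<le> 1 \<Longrightarrow> norm (x * y) \<le> norm y" "norm x \<le> 1 \<Longrightarrow> norm (y * x) \<le> norm y"
  by (rule order_trans[OF norm_mult_ineq]; simp add: mult_left_le mult_left_le_one_le)+

text \<open>
  If cutting \<open>c\<close> down by smaller projections hardly decreases its norm, then its off-diagonal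
  parts are small: a large part would add up with a diagonal part.
\<close>

lemma off_diagonal_small:
  fixes c :: "'a::cstar_algebra"
  assumes pi: "purely_infinite TYPE('a)" and \<rho>: "star_endomorphism \<rho>"
    and low: "\<And>q. cprojection q \<Longrightarrow> q \<noteq> 0 \<Longrightarrow> p * q = q \<Longrightarrow> m \<le> (norm (q * c * \<rho> q))\<^sup>2"
    and up: "(norm c)\<^sup>2 \<le> m + \<eta>" and \<eta>: "0 < \<eta>"
    and q0: "cprojection q0" "p * q0 = q0" and q': "cprojection q'" "q0 * q' = 0"
  shows "(norm (q0 * c * \<rho> q'))\<^sup>2 \<le> 2 * \<eta>"
proof (rule ccontr)
  note [simp] = star_endomorphismD[OF \<rho>]
  assume neg: "\<not> (norm (q0 * c * \<rho> q'))\<^sup>2 \<le> 2 * \<eta>"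
  define z where "z = q0 * c * \<rho> q'"
  define h where "h = z * star z"
  \<comment> \<open>The negated bound is norm h > 2 \<eta>, so \<eta> < t < norm h: the gain
    \<open>t\<close> beats the slack \<eta> and is admissible for
    \<open>top_projection\<close>.\<close>
  define t where "t = norm h - \<eta>"
  have nh: "norm h = (norm z)\<^sup>2" by (simp add: h_def cstar_identity')
  have t: "0 < t" "t < norm h" "\<eta> < t" using neg \<eta> by (simp_all add: t_def nh z_def)
  have "sa_square h" by (simp add: h_def sa_square_mult_star)
  moreover have "q0 * h = h" using q0 by (simp add: h_def z_def mult.assoc cprojection_absorb)
  ultimately obtain q where q: "cprojection q" "q \<noteq> 0" "q0 * q = q" "sa_square (q * h * q - t *\<^sub>R q)"
    using top_projection[OF pi _ q0(1) _ t(1,2)] by blast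
  have qq0: "q * q0 = q" using q q0 by (metis cprojection_star star_mult)
  have qq': "q * q' = 0" using qq0 q'(2) by (metis mult.assoc mult_zero_right)
  then have q'q: "q' * q = 0" using q q' by (metis cprojection_star star_mult star_zero)
  have Q: "cprojection (q + q')" unfolding cprojection_def
    using q q' qq' q'q by (simp add: star_add algebra_simps)
  have sr: "star (\<rho> r) = \<rho> r" "\<rho> r * \<rho> r = \<rho> r" if "cprojection r" for r
    using cprojection_star_endomorphism[OF \<rho> that] by simp_all
  \<comment> \<open>The diagonal part. The row \<open>q * c * \<rho> (q + q')\<close> times its
    adjoint is \<open>B + q * h * q\<close>, of norm at least m + t, while the row is no longer than
    \<open>c\<close>.\<close>
  define B where "B = (q * c * \<rho> q) * star (q * c * \<rho> q)"
  have h: "h = q0 * c * \<rho> q' * star c * q0"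
    using sr[OF q'(1)] q0 by (simp add: h_def z_def star_mult mult.assoc) (metis mult.assoc)
  have Beq: "B = q * c * \<rho> q * star c * q"
    using sr[OF q(1)] q by (simp add: B_def star_mult mult.assoc) (metis mult.assoc)
  have "(q * c * \<rho> (q + q')) * star (q * c * \<rho> (q + q'))
      = q * c * (\<rho> (q + q') * \<rho> (q + q')) * star c * q"
    using sr(1)[OF Q] q by (simp add: star_mult mult.assoc)
  also have "\<dots> = q * c * \<rho> (q + q') * star c * q"
    by (simp only: sr(2)[OF Q])
  also have "\<dots> = B + q * h * q"
    using qq0 q(3) by (simp add: Beq h algebra_simps) (metis mult.assoc)
  finally have "norm (B + q * h * q) = (norm (q * c * \<rho> (q + q')))\<^sup>2"
    by (metis cstar_identity')
  also have "norm (q * c * \<rho> (q + q')) \<le> norm c"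
    using norm_cprojection_le[OF q(1)] norm_cprojection_le[OF cprojection_star_endomorphism[OF \<rho> Q]]
    by (intro order_trans[OF norm_mult_contraction(2)] norm_mult_contraction(1)) 
  then have "(norm (q * c * \<rho> (q + q')))\<^sup>2 \<le> (norm c)\<^sup>2" by (intro power_mono) auto
  finally have "norm (B + q * h * q) \<le> m + \<eta>" using up by simp
  moreover have "norm B + t \<le> norm (B + q * h * q)"
  proof (rule norm_corner_shift[OF _ q(1,2) _ _ q(4)])
    show "sa_square B" by (simp add: B_def sa_square_mult_star)
    show "q * B = B" using q by (simp add: Beq mult.assoc cprojection_absorb)
  qed (use t in simp)
  moreover have "p * q = q" using q(3) q0(2) by (metis mult.assoc)
  then have "m \<le> norm B" using low[OF q(1,2)] by (simp add: B_def cstar_identity')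
  ultimately show False using t by simp
qed

text \<open>If source \<open>f\<close> and range \<open>g\<close> of \<open>w\<close> are
  orthogonal, half of f + g + w + \<open>star w\<close> is a projection below \<open>p\<close>, so w
  + \<open>star w\<close> is a combination of three projections with coefficients 2, -1, -1, whence
  the 4. The same holds for i w, and the two together recover 2 w.\<close>

lemma commutator_partial_isometry:
  fixes w :: "'a::cstar_algebra"
  assumes \<rho>: "star_endomorphism \<rho>"
    and small: "\<And>q. cprojection q \<Longrightarrow> p * q = q \<Longrightarrow> norm (q * c - c * \<rho> q) \<le> \<kappa>"
    and f: "cprojection f" "p * f = f" "star w * w = f" and w: "p * w = w" "f * w = 0"
  shows "norm (w * c - c * \<rho> w) \<le> 4 * \<kappa>"
proof -
  note [simp] = star_endomorphismD[OF \<rho>]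
  define D where "D y = y * c - c * \<rho> y" for y
  have main: "norm (D (w + star w)) \<le> 4 * \<kappa>"
    if fw: "star w * w = f" "p * w = w" "f * w = 0" for w
  proof -
    define g where "g = w * star w"
    have wf: "w * f = w" by (rule isometry_right_unit[OF fw(1) f(1)])
    then have fws: "f * star w = star w" using f(1) by (metis cprojection_star star_mult)
    have wsf: "star w * f = 0" using fw(3) f(1) by (metis cprojection_star star_mult star_zero)
    have ww: "w * w = 0" using wf fw(3) by (metis mult.assoc mult_zero_right)
    then have wsws: "star w * star w = 0" by (metis star_mult star_zero)
    have g: "cprojection g" unfolding cprojection_def g_def
      by (simp add: star_simps) (metis fws fw(1) mult.assoc)
    have pg: "p * g = g" using fw(2) by (simp add: g_def flip: mult.assoc)
    have rel: "f * g = 0" "g * f = 0" "g * w = w" "w * g = 0" "g * star w = 0" "star w * g = star w"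
      unfolding g_def by (metis fw wf fws wsf ww wsws mult.assoc mult_zero_left mult_zero_right)+
    define e where "e = (1/2) *\<^sub>R (f + g + w + star w)"
    have "(f + g + w + star w) * (f + g + w + star w) = 2 *\<^sub>R (f + g + w + star w)"
      using f(1) g by (simp add: algebra_simps rel wf fws wsf ww wsws fw scaleR_2 flip: g_def)
    then have "cprojection e"
      using f(1) g unfolding cprojection_def e_def by (simp add: star_simps add_ac)
    moreover have "p * e = e"
    proof -
      have "p * star w = star w" using fws f(2) by (metis mult.assoc)
      then show ?thesis by (simp add: e_def distrib_left f(2) pg fw(2))
    qed
    ultimately have "norm (D e) \<le> \<kappa>" unfolding D_def by (rule small)
    moreover have "norm (D f) \<le> \<kappa>" "norm (D g) \<le> \<kappa>" unfolding D_def using small f g pg by blast+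
    moreover have "D (w + star w) = 2 *\<^sub>R D e - D f - D g"
      by (simp add: D_def e_def algebra_simps scaleR_diff_right)
    then have "norm (D (w + star w)) \<le> 2 * norm (D e) + norm (D f) + norm (D g)"
      using norm_triangle_ineq4[of "2 *\<^sub>R D e - D f" "D g"] norm_triangle_ineq4[of "2 *\<^sub>R D e" "D f"] by simp
    ultimately show ?thesis by linarith
  qed
  let ?w' = "\<i> *\<^sub>C w"
  have "norm (D (?w' + star ?w')) \<le> 4 * \<kappa>"
    by (rule main) (simp_all add: star_scaleC mult_scaleC_left mult_scaleC_right scaleC_scaleC f w)
  moreover have "norm (D (w + star w)) \<le> 4 * \<kappa>" by (rule main) (use f w in auto)
  moreover have "D (w + star w) - \<i> *\<^sub>C D (?w' + star ?w') = D (2 *\<^sub>R w)"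
    by (simp add: D_def star_scaleC scaleC_add_right cvec.scale_right_diff_distrib algebra_simps
        mult_scaleC_left mult_scaleC_right scaleC_scaleC scaleR_2)
  moreover have "D (2 *\<^sub>R w) = 2 *\<^sub>R D w" by (simp add: D_def scaleR_diff_right)
  ultimately have "2 * norm (D w) \<le> 4 * \<kappa> + 4 * \<kappa>"
    using norm_triangle_ineq4[of "D (w + star w)" "\<i> *\<^sub>C D (?w' + star ?w')"]
    by (simp add: norm_scaleC)
  then show ?thesis by (simp add: D_def)
qed

text \<open>
  A contraction between orthogonal equivalent projections is the average of two partial
  isometries \<open>y \<plusminus> v s\<close>, where \<open>s\<^sup>2 = 1 - y\<^sup>* y\<close> and \<open>v\<close> maps into a third projection.
\<close>

lemma commutator_off_diagonal:
  fixes y :: "'a::cstar_algebra" and u :: "nat \<Rightarrow> 'a"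
  assumes \<rho>: "star_endomorphism \<rho>"
    and small: "\<And>q. cprojection q \<Longrightarrow> p * q = q \<Longrightarrow> norm (q * c - c * \<rho> q) \<le> \<kappa>"
    and P: "cprojection P" and u: "\<And>i j. star (u i) * u j = (if i = j then P else 0)" "\<And>i. p * u i = u i"
    and ij: "i \<noteq> j" and y: "u i * star (u i) * y = y" "y * (u j * star (u j)) = y" "norm y \<le> 1"
  shows "norm (y * c - c * \<rho> y) \<le> 4 * \<kappa>"
proof -
  note [simp] = star_endomorphismD[OF \<rho>]
  \<comment> \<open>A third copy is needed: the range of \<open>v\<close> has to be orthogonal to
    \<open>Q\<close>, and to the range of \<open>y\<close> so that the cross terms cancel.\<close>
  obtain k where k: "k \<noteq> i" "k \<noteq> j" using ex_new_if_finite[of "{i, j}"] by auto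
  define Q where "Q = u j * star (u j)"
  have uP: "u i * P = u i" for i by (rule isometry_right_unit) (simp_all add: u P)
  have Pu: "P * star (u i) = star (u i)" for i using uP P by (metis cprojection_star star_mult)
  have Q: "cprojection Q" unfolding cprojection_def Q_def
    by (simp add: star_simps) (metis u(1) uP mult.assoc)
  have pQ: "p * Q = Q" unfolding Q_def using u(2) by (simp flip: mult.assoc)
  let ?x = "star y * y"
  have "norm ?x \<le> 1" using y(3) by (simp add: cstar_identity power_le_one)
  moreover have "star ?x = ?x" by (simp add: star_simps)
  moreover have ysQ: "Q * star y = star y" using y(2) Q by (metis Q_def cprojection_star star_mult)
  ultimately obtain d where d: "d + d = ?x + d * d" "star d = d" and "\<And>z. z * ?x = ?x \<Longrightarrow> z * d = d"
    using sqrt_iteration_sa by blast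
  then have Qd: "Q * d = d" using ysQ by (simp flip: mult.assoc)
  then have dQ: "d * Q = d" using d(2) Q by (metis cprojection_star star_mult)
  define s where "s = Q - d"
  have s: "star s = s" "Q * s = s" "s * s = Q - ?x"
    using Q d by (simp_all add: s_def star_simps algebra_simps Qd dQ)
  define v where "v = u k * star (u j)"
  have vv: "star v * v = Q" by (simp add: v_def Q_def star_simps mult.assoc) (simp add: u(1) Pu flip: mult.assoc[of "star (u k)"])
  have yv: "star y * v = 0"
  proof -
    have "star y = star y * (u i * star (u i))" using y(1) by (metis star_mult star_star)
    then have "star y * v = star y * (u i * (star (u i) * u k * star (u j)))"
      by (metis v_def mult.assoc)
    then show ?thesis using k by (simp add: u(1))
  qed
  then have vy: "star v * y = 0" by (metis star_mult star_star star_zero)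
  have Qv: "Q * v = 0"
  proof -
    have "Q * v = u j * (star (u j) * u k) * star (u j)" by (simp add: Q_def v_def mult.assoc)
    then show ?thesis using k by (simp add: u(1))
  qed
  have Qy: "Q * y = 0"
  proof -
    have "Q * y = Q * (u i * star (u i) * y)" by (simp only: y(1))
    also have "\<dots> = u j * (star (u j) * u i) * star (u i) * y" by (simp add: Q_def mult.assoc)
    finally show ?thesis using ij by (simp add: u(1))
  qed
  have py: "p * y = y" using y(1) u(2)[of i] by (metis mult.assoc)
  have bound: "norm ((y + r *\<^sub>R (v * s)) * c - c * \<rho> (y + r *\<^sub>R (v * s))) \<le> 4 * \<kappa>" if r: "r * r = 1" for r
  proof (rule commutator_partial_isometry[OF \<rho> small Q pQ])
    have "star (y + r *\<^sub>R (v * s)) * (y + r *\<^sub>R (v * s))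
        = ?x + r *\<^sub>R (star y * v * s) + r *\<^sub>R (s * (star v * y)) + (r * r) *\<^sub>R (s * (star v * v * s))"
      by (simp add: star_simps s algebra_simps)
    also have "\<dots> = Q" by (simp add: r yv vy vv s)
    finally show "star (y + r *\<^sub>R (v * s)) * (y + r *\<^sub>R (v * s)) = Q" .
    have "p * v = v" using u(2) by (simp add: v_def flip: mult.assoc)
    then show "p * (y + r *\<^sub>R (v * s)) = y + r *\<^sub>R (v * s)" by (simp add: distrib_left py flip: mult.assoc)
    show "Q * (y + r *\<^sub>R (v * s)) = 0" by (simp add: distrib_left Qy Qv flip: mult.assoc)
  qed
  have "2 *\<^sub>R (y * c - c * \<rho> y) = ((y + 1 *\<^sub>R (v * s)) * c - c * \<rho> (y + 1 *\<^sub>R (v * s)))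
      + ((y + (-1) *\<^sub>R (v * s)) * c - c * \<rho> (y + (-1) *\<^sub>R (v * s)))"
    by (simp add: algebra_simps scaleR_2)
  then have "norm (2 *\<^sub>R (y * c - c * \<rho> y)) \<le> 4 * \<kappa> + 4 * \<kappa>"
    using bound[of 1] bound[of "-1"] norm_triangle_mono by (metis mult_1_left mult_minus1 minus_minus)
  then show ?thesis by simp
qed

text \<open>The statement is about a compression of \<open>b\<close> because the near-minimal
  \<open>p\<close> depends on \<open>b\<close> and \<epsilon>. An isometry with source
  \<open>P\<close> and range below \<open>p\<close> moves the estimate back to the fixed corner
  \<open>P A P\<close>, where different tolerances can be compared.\<close>

lemma approximate_intertwiner:
  fixes b :: "'a::cstar_algebra"
  assumes si: "simple_cstar TYPE('a)" and pi: "purely_infinite TYPE('a)" and \<rho>: "star_endomorphism \<rho>"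
    and P: "cprojection P" "P \<noteq> 0" and \<epsilon>: "\<epsilon> > 0"
  obtains u where "star u * u = P" "P * u = u"
    "\<And>x. P * x = x \<Longrightarrow> x * P = x \<Longrightarrow>
      norm (x * (star u * b * \<rho> u) - (star u * b * \<rho> u) * \<rho> x) \<le> \<epsilon> * norm x"
proof -
  note [simp] = star_endomorphismD[OF \<rho>]
  \<comment> \<open>Error budget: 2 \<eta> is the square of \<epsilon>/16, which bounds off-diagonal
    parts; commutators with projections cost \<epsilon>/8, with off-diagonal contractions
    \<epsilon>/2, with products of two of these \<epsilon>.\<close>
  define \<eta> where "\<eta> = \<epsilon>\<^sup>2 / 512"
  have \<eta>: "\<eta> > 0" using \<epsilon> by (simp add: \<eta>_def)
  define S where "S = {(norm (q * b * \<rho> q))\<^sup>2 | q. cprojection q \<and> q \<noteq> 0 \<and> P * q = q}"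
  have "S \<noteq> {}" unfolding S_def using P cprojection_mult[OF P(1)] by blast
  moreover have bdd: "bdd_below S" unfolding S_def by (rule bdd_belowI[of _ 0]) auto
  ultimately obtain s where "s \<in> S" "s < Inf S + \<eta>" using \<eta> by (metis cInf_lessD less_add_same_cancel1)
  then obtain p where p: "cprojection p" "p \<noteq> 0" "P * p = p" "(norm (p * b * \<rho> p))\<^sup>2 < Inf S + \<eta>"
    unfolding S_def by auto
  define c where "c = p * b * \<rho> p"
  have \<rho>p: "cprojection (\<rho> p)" by (rule cprojection_star_endomorphism[OF \<rho> p(1)])
  have pc: "p * c = c" "c * \<rho> p = c"
    using p \<rho>p by (simp_all add: c_def mult.assoc cprojection_absorb)
  have low: "Inf S \<le> (norm (q * c * \<rho> q))\<^sup>2" if q: "cprojection q" "q \<noteq> 0" "p * q = q" for q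
  proof -
    have "q * p = q" using q p by (metis cprojection_star star_mult)
    then have "q * c * \<rho> q = q * b * (\<rho> (p * q))" unfolding c_def
      by (simp add: mult.assoc) (metis mult.assoc)
    then have "q * c * \<rho> q = q * b * \<rho> q" by (simp only: q(3))
    moreover have "P * q = q" using q(3) p(3) by (metis mult.assoc)
    ultimately show ?thesis using q bdd by (intro cInf_lower) (auto simp: S_def)
  qed
  have up: "(norm c)\<^sup>2 \<le> Inf S + \<eta>" using p(4) by (simp add: c_def)
  have off: "norm (q * c * \<rho> q') \<le> \<epsilon> / 16"
    if "cprojection q" "p * q = q" "cprojection q'" "q * q' = 0" for q q'
  proof -
    have "(norm (q * c * \<rho> q'))\<^sup>2 \<le> 2 * \<eta>"
      by (rule off_diagonal_small[OF pi \<rho> low up \<eta> that])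
    also have "\<dots> = (\<epsilon> / 16)\<^sup>2" by (simp add: \<eta>_def power_divide)
    finally show ?thesis by (rule power2_le_imp_le) (use \<epsilon> in simp)
  qed
  have small: "norm (q * c - c * \<rho> q) \<le> \<epsilon> / 8" if q: "cprojection q" "p * q = q" for q
  proof -
    have qp: "q * p = q" using q p by (metis cprojection_star star_mult)
    have pq: "cprojection (p - q)" unfolding cprojection_def
      using q p qp by (simp add: star_simps algebra_simps)
    have "q * c - c * \<rho> q = q * (c * \<rho> p) - (p * c) * \<rho> q" by (simp only: pc)
    also have "\<dots> = q * c * \<rho> (p - q) - (p - q) * c * \<rho> q" by (simp add: algebra_simps)
    finally have "norm (q * c - c * \<rho> q) \<le> norm (q * c * \<rho> (p - q)) + norm ((p - q) * c * \<rho> q)"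
      using norm_triangle_ineq4 by metis
    also have "\<dots> \<le> \<epsilon> / 16 + \<epsilon> / 16"
      using p q qp pq by (intro add_mono off) (auto simp: algebra_simps)
    finally show ?thesis by simp
  qed
  obtain u :: "nat \<Rightarrow> 'a" where u: "\<And>i j. star (u i) * u j = (if i = j then P else 0)" "\<And>i. p * u i = u i"
    using projection_comparison_family[OF si pi P(1) p(1,2)] by blast
  have uP: "u i * P = u i" for i by (rule isometry_right_unit) (simp_all add: u P)
  have Pu: "P * star (u i) = star (u i)" for i using uP P by (metis cprojection_star star_mult)
  have uu: "star (u i) * (u j * z) = (if i = j then P * z else 0)" for i j z
    using u(1)[of i j] by (simp flip: mult.assoc)
  have nu: "norm (u i) = 1" for i
  proof -
    have "(norm (u i))\<^sup>2 = 1" using cstar_identity[of "u i"] P by (simp add: u(1) norm_cprojection)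
    then show ?thesis by (simp add: power2_eq_1_iff) (metis norm_ge_zero not_one_le_zero neg_0_le_iff_le)
  qed
  define b' where "b' = star (u 0) * b * \<rho> (u 0)"
  have up0: "star (u 0) * p = star (u 0)" using u(2)[of 0] p(1) by (metis cprojection_star star_mult)
  have "\<rho> p * \<rho> (u 0) = \<rho> (u 0)" by (simp add: u(2) flip: star_endomorphismD(6)[OF \<rho>])
  then have b': "b' = star (u 0) * c * \<rho> (u 0)"
    unfolding b'_def c_def using up0 by (metis mult.assoc)
  have main: "norm (x * b' - b' * \<rho> x) \<le> \<epsilon>" if x: "P * x = x" "x * P = x" "norm x \<le> 1" for x
  proof -
    define D where "D y = y * c - c * \<rho> y" for y
    \<comment> \<open>The copy of \<open>x\<close> below \<open>p\<close> is diagonal; a detour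
      through the second copy of \<open>P\<close> makes it the product \<open>y1 * y2\<close> of
      off-diagonal contractions.\<close>
    define y1 where "y1 = u 0 * x * star (u 1)"
    define y2 where "y2 = u 1 * star (u 0)"
    note offd = commutator_off_diagonal[OF \<rho> small P(1) u]
    have ny1: "norm y1 \<le> 1"
    proof -
      have "norm y1 \<le> norm (u 0) * norm x * norm (star (u 1))"
        unfolding y1_def by (intro order_trans[OF norm_mult_ineq] mult_mono) auto
      then show ?thesis using x nu by simp
    qed
    have ny2: "norm y2 \<le> 1"
      unfolding y2_def using norm_mult_ineq[of "u 1" "star (u 0)"] nu by simp
    have "norm (D y1) \<le> 4 * (\<epsilon> / 8)" unfolding D_def
    proof (rule offd[of 0 1])
      show "(0::nat) \<noteq> 1" "norm y1 \<le> 1" using ny1 by simp_all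
      show "u 0 * star (u 0) * y1 = y1" "y1 * (u 1 * star (u 1)) = y1"
        using x by (simp_all add: y1_def mult.assoc uu Pu) (simp add: x uP flip: mult.assoc)
    qed
    moreover have "norm (D y2) \<le> 4 * (\<epsilon> / 8)" unfolding D_def
    proof (rule offd[of 1 0])
      show "(1::nat) \<noteq> 0" "norm y2 \<le> 1" using ny2 by simp_all
      show "u 1 * star (u 1) * y2 = y2" "y2 * (u 0 * star (u 0)) = y2"
        by (simp_all add: y2_def mult.assoc uu Pu)
    qed
    moreover have "D (y1 * y2) = y1 * D y2 + D y1 * \<rho> y2" by (simp add: D_def algebra_simps)
    moreover have "norm (y1 * D y2) \<le> norm (D y2)" by (rule norm_mult_contraction(1)[OF ny1])
    moreover have "norm (D y1 * \<rho> y2) \<le> norm (D y1)"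
      by (rule norm_mult_contraction(2)) (use star_endomorphism_norm_le[OF \<rho>, of y2] ny2 in simp)
    ultimately have D12: "norm (D (y1 * y2)) \<le> \<epsilon>"
      using norm_triangle_ineq[of "y1 * D y2" "D y1 * \<rho> y2"] by simp
    have y12: "y1 * y2 = u 0 * x * star (u 0)"
      by (simp add: y1_def y2_def mult.assoc uu Pu)
    have "star (u 0) * D (y1 * y2) * \<rho> (u 0)
        = star (u 0) * u 0 * x * star (u 0) * c * \<rho> (u 0)
          - star (u 0) * c * \<rho> (u 0) * \<rho> (x * (star (u 0) * u 0))"
      unfolding y12 D_def by (simp add: algebra_simps)
    also have "\<dots> = x * b' - b' * \<rho> x" by (simp add: u(1) x b' mult.assoc del: star_endomorphismD)
    finally have "norm (x * b' - b' * \<rho> x) = norm (star (u 0) * D (y1 * y2) * \<rho> (u 0))" by simp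
    also have "\<dots> \<le> norm (star (u 0) * D (y1 * y2))"
      by (rule norm_mult_contraction(2)) (use star_endomorphism_norm_le[OF \<rho>, of "u 0"] nu in simp)
    also have "\<dots> \<le> norm (D (y1 * y2))" by (rule norm_mult_contraction(1)) (simp add: nu)
    finally show ?thesis using D12 by simp
  qed
  show thesis
  proof (rule that[of "u 0"])
    show "star (u 0) * u 0 = P" by (simp add: u)
    show "P * u 0 = u 0" using u(2)[of 0] p(3) by (metis mult.assoc)
    fix x assume x: "P * x = x" "x * P = x"
    have "norm (x * b' - b' * \<rho> x) \<le> \<epsilon> * norm x"
    proof (cases "x = 0")
      case False
      let ?r = "1 / norm x"
      have "norm ((?r *\<^sub>R x) * b' - b' * \<rho> (?r *\<^sub>R x)) \<le> \<epsilon>"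
        by (rule main) (use x False in auto)
      moreover have "(?r *\<^sub>R x) * b' - b' * \<rho> (?r *\<^sub>R x) = ?r *\<^sub>R (x * b' - b' * \<rho> x)"
        by (simp add: scaleR_diff_right)
      ultimately show ?thesis using False by (simp add: divide_le_eq)
    qed simp
    then show "norm (x * (star (u 0) * b * \<rho> (u 0)) - star (u 0) * b * \<rho> (u 0) * \<rho> x) \<le> \<epsilon> * norm x"
      by (simp only: b'_def)
  qed
qed

text \<open>\<open>u\<close> carries a test projection \<open>q\<close> to the test projection
  \<open>u * q * star u\<close>, and the outer factors are contractions. This keeps iterated
  compressions away from 0.\<close>

lemma compression_lower_bound:
  fixes b :: "'a::cstar_algebra"
  assumes \<rho>: "star_endomorphism \<rho>" and P: "cprojection P" and u: "star u * u = P" "P * u = u"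
    and low: "\<And>q. cprojection q \<Longrightarrow> q \<noteq> 0 \<Longrightarrow> P * q = q \<Longrightarrow> \<delta> \<le> norm (q * b * \<rho> q)"
    and q: "cprojection q" "q \<noteq> 0" "P * q = q"
  shows "\<delta> \<le> norm (q * (star u * b * \<rho> u) * \<rho> q)"
proof -
  note [simp] = star_endomorphismD[OF \<rho>]
  define q' where "q' = u * q * star u"
  have uuz: "star u * (u * z) = P * z" for z using u by (simp flip: mult.assoc)
  have Pq: "P * (q * z) = q * z" for z using q by (simp flip: mult.assoc)
  have qP: "q * P = q" using q P by (metis cprojection_star star_mult)
  have q': "cprojection q'" unfolding cprojection_def
    using q by (simp add: q'_def star_simps mult.assoc uuz Pq cprojection_absorb)
  moreover have "star u * q' * u = q" by (simp add: q'_def mult.assoc uuz Pq u qP)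
  then have "q' \<noteq> 0" using q by auto
  moreover have "P * q' = q'" by (simp add: q'_def u flip: mult.assoc)
  ultimately have "\<delta> \<le> norm (q' * b * \<rho> q')" by (rule low)
  also have "q' * b * \<rho> q' = u * (q * (star u * b * \<rho> u) * \<rho> q) * \<rho> (star u)"
    by (simp add: q'_def mult.assoc)
  also have "norm \<dots> \<le> norm (u * (q * (star u * b * \<rho> u) * \<rho> q))"
    by (rule norm_mult_contraction(2))
      (use star_endomorphism_norm_le[OF \<rho>, of "star u"] norm_isometry_le[OF u(1) P] in simp)
  also have "\<dots> \<le> norm (q * (star u * b * \<rho> u) * \<rho> q)"
    by (rule norm_mult_contraction(1)) (rule norm_isometry_le[OF u(1) P])
  finally show ?thesis .
qed

text \<open>
  Compressing the approximate intertwiner \<open>b\<close> again, by an isometry \<open>u\<close> of the corner, moves it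
  only a little, since \<open>b \<rho>(u)\<close> is close to \<open>u b\<close>. Hence iterated compressions converge in norm.
\<close>

lemma exact_intertwiner:
  fixes a :: "'a::cstar_algebra"
  assumes si: "simple_cstar TYPE('a)" and pi: "purely_infinite TYPE('a)" and \<rho>: "star_endomorphism \<rho>"
    and P: "cprojection P" "P \<noteq> 0"
    and low: "\<And>q. cprojection q \<Longrightarrow> q \<noteq> 0 \<Longrightarrow> P * q = q \<Longrightarrow> \<delta> \<le> norm (q * a * \<rho> q)"
  obtains b where "P * b = b" "b * \<rho> P = b" "\<delta> \<le> norm b"
    "\<And>x. P * x = x \<Longrightarrow> x * P = x \<Longrightarrow> x * b = b * \<rho> x"
proof -
  note [simp] = star_endomorphismD[OF \<rho>]
  define lower where "lower b \<longleftrightarrow>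
    (\<forall>q. cprojection q \<longrightarrow> q \<noteq> 0 \<longrightarrow> P * q = q \<longrightarrow> \<delta> \<le> norm (q * b * \<rho> q))" for b
  define good where "good n b \<longleftrightarrow> P * b = b \<and> b * \<rho> P = b \<and> lower b \<and>
    (\<forall>x. P * x = x \<longrightarrow> x * P = x \<longrightarrow> norm (x * b - b * \<rho> x) \<le> (1/2) ^ n * norm x)" for n b
  have compress: "\<exists>u. star u * u = P \<and> P * u = u \<and> good n (star u * b * \<rho> u)" if b: "lower b" for n b
  proof -
    obtain u where u: "star u * u = P" "P * u = u"
      "\<And>x. P * x = x \<Longrightarrow> x * P = x \<Longrightarrow>
        norm (x * (star u * b * \<rho> u) - (star u * b * \<rho> u) * \<rho> x) \<le> (1/2) ^ n * norm x"
      using approximate_intertwiner[OF si pi \<rho> P, of "(1/2) ^ n" b] by (metis zero_less_power half_gt_zero zero_less_one)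
    have uP: "u * P = u" by (rule isometry_right_unit[OF u(1) P(1)])
    then have "P * star u = star u" using P by (metis cprojection_star star_mult)
    then have "P * (star u * b * \<rho> u) = star u * b * \<rho> u" by (simp flip: mult.assoc)
    moreover have "\<rho> u * \<rho> P = \<rho> u" using uP by (metis star_endomorphismD(6)[OF \<rho>])
    then have "star u * b * \<rho> u * \<rho> P = star u * b * \<rho> u" by (simp add: mult.assoc)
    moreover have "lower (star u * b * \<rho> u)"
      using compression_lower_bound[OF \<rho> P(1) u(1,2)] b unfolding lower_def by blast
    ultimately have "good n (star u * b * \<rho> u)" using u(3) by (simp add: good_def)
    with u show ?thesis by blast
  qed
  have "lower a" using low by (simp add: lower_def)
  then obtain b0 where "good 0 b0" using compress by blast
  moreover have "\<exists>b'. good (Suc n) b' \<and> norm (b' - b) \<le> (1/2) ^ n" if b: "good n b" for n b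
  proof -
    obtain u where u: "star u * u = P" "P * u = u" "good (Suc n) (star u * b * \<rho> u)"
      using compress b unfolding good_def by blast
    have nu: "norm u \<le> 1" by (rule norm_isometry_le[OF u(1) P(1)])
    have "star u * b * \<rho> u - b = - (star u * (u * b - b * \<rho> u))"
      using b u(1) by (simp add: good_def algebra_simps) (simp flip: mult.assoc)
    then have "norm (star u * b * \<rho> u - b) = norm (star u * (u * b - b * \<rho> u))" by (simp only: norm_minus_cancel)
    also have "\<dots> \<le> norm (u * b - b * \<rho> u)" by (rule norm_mult_contraction(1)) (simp add: nu)
    \<comment> \<open>\<open>u\<close> itself belongs to the corner, so the commutator estimate for
      \<open>b\<close> applies to it.\<close>
    also have "\<dots> \<le> (1/2) ^ n * norm u"
      using b u(2) isometry_right_unit[OF u(1) P(1)] unfolding good_def by blast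
    also have "\<dots> \<le> (1/2) ^ n" using nu by (simp add: mult_left_le)
    finally show ?thesis using u(3) by blast
  qed
  ultimately obtain B where B: "\<And>n. good n (B n)" "\<And>n. norm (B (Suc n) - B n) \<le> (1/2) ^ n"
    using dependent_nat_choice[of good "\<lambda>n b b'. norm (b' - b) \<le> (1/2) ^ n"] by metis
  have "summable (\<lambda>n. B (Suc n) - B n)"
    by (rule summable_norm_cancel, rule summable_comparison_test'[of "\<lambda>n. (1/2) ^ n" 0])
      (use B(2) in \<open>auto simp: summable_geometric\<close>)
  then obtain L where "(\<lambda>n. \<Sum>k<n. B (Suc k) - B k) \<longlonglongrightarrow> L"
    unfolding summable_def sums_def by blast
  then have "(\<lambda>n. B n - B 0) \<longlonglongrightarrow> L" by (simp add: sum_lessThan_telescope)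
  from tendsto_add[OF this tendsto_const[of "B 0"]] have lim: "B \<longlonglongrightarrow> L + B 0" by simp
  define b where "b = L + B 0"
  have b: "B \<longlonglongrightarrow> b" using lim by (simp add: b_def)
  show thesis
  proof (rule that[of b])
    have "P * B n = B n" "B n * \<rho> P = B n" for n using B(1)[of n] by (simp_all add: good_def)
    then have "B \<longlonglongrightarrow> P * b" "B \<longlonglongrightarrow> b * \<rho> P"
      using tendsto_mult[OF tendsto_const[of P] b] tendsto_mult[OF b tendsto_const[of "\<rho> P"]] by simp_all
    then show "P * b = b" "b * \<rho> P = b" using LIMSEQ_unique[OF _ b] by blast+
    have "\<delta> \<le> norm (B n)" for n
    proof -
      have "\<delta> \<le> norm (P * B n * \<rho> P)"
        using B(1)[of n] P cprojection_mult[OF P(1)] unfolding good_def lower_def by blast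
      then show ?thesis using B(1)[of n] by (simp add: good_def)
    qed
    then show "\<delta> \<le> norm b" using tendsto_norm[OF b] by (intro LIMSEQ_le_const) auto
    fix x assume x: "P * x = x" "x * P = x"
    have "(\<lambda>n. x * B n - B n * \<rho> x) \<longlonglongrightarrow> x * b - b * \<rho> x"
      by (intro tendsto_diff tendsto_mult tendsto_const b)
    moreover have "(\<lambda>n. (1/2) ^ n * norm x) \<longlonglongrightarrow> 0 * norm x"
      by (intro tendsto_mult tendsto_const LIMSEQ_power_zero) simp
    then have zero: "(\<lambda>n. (1/2) ^ n * norm x) \<longlonglongrightarrow> 0" by simp
    have "norm (x * B n - B n * \<rho> x) \<le> (1/2) ^ n * norm x" for n
      using B(1)[of n] x unfolding good_def by blast
    then have "(\<lambda>n. x * B n - B n * \<rho> x) \<longlonglongrightarrow> 0"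
      by (intro Lim_null_comparison[OF always_eventually zero]) blast
    ultimately have "x * b - b * \<rho> x = 0" by (rule LIMSEQ_unique)
    then show "x * b = b * \<rho> x" by simp
  qed
qed

text \<open>Near the top of its spectrum \<open>h\<close> is almost the scalar \<open>M\<close> on
  some projection \<open>q\<close>. An isometry from \<open>P\<close> into \<open>q\<close> lies in
  the corner and so commutes with \<open>h\<close>; compressing by it spreads the bound h \<ge> M -
  e from \<open>q\<close> to all of \<open>P\<close>.\<close>

lemma central_positive_scalar:
  fixes h :: "'a::cstar_algebra"
  assumes si: "simple_cstar TYPE('a)" and pi: "purely_infinite TYPE('a)" and P: "cprojection P"
    and h: "sa_square h" "P * h = h" and central: "\<And>x. P * x = x \<Longrightarrow> x * P = x \<Longrightarrow> x * h = h * x"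
  shows "h = norm h *\<^sub>R P"
proof (cases "h = 0")
  case False
  define M where "M = norm h"
  have M: "M > 0" using False by (simp add: M_def)
  have "norm (M *\<^sub>R P - h) \<le> e" if e: "0 < e" "e < M" for e
  proof -
    obtain q where q: "cprojection q" "q \<noteq> 0" "P * q = q" "sa_square (q * h * q - (M - e) *\<^sub>R q)"
      using top_projection[OF pi h(1) P h(2), of "M - e"] e by (auto simp: M_def)
    obtain u where u: "star u * u = P" "q * u = u"
      using projection_comparison[OF si pi P q(1,2)] by blast
    have uP: "u * P = u" by (rule isometry_right_unit[OF u(1) P])
    have Pu: "P * u = u" using u(2) q(3) by (metis mult.assoc)
    have usq: "star u * q = star u" using u(2) q(1) by (metis cprojection_star star_mult)
    have "star u * (q * h * q - (M - e) *\<^sub>R q) * u = star u * q * h * (q * u) - (M - e) *\<^sub>R (star u * (q * u))"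
      by (simp add: algebra_simps)
    also have "\<dots> = star u * (h * u) - (M - e) *\<^sub>R P" by (simp add: usq u mult.assoc)
    also have "star u * (h * u) = h" using central[OF Pu uP] u(1) h(2) by (metis mult.assoc)
    finally have hM: "sa_square (h - (M - e) *\<^sub>R P)" using sa_square_conj[OF q(4), of u] by simp
    have "sa_square (M *\<^sub>R P - h)" by (rule corner_norm_diff[OF h(1) P h(2)]) (simp add: M_def)
    moreover have "h - (M - e) *\<^sub>R P = e *\<^sub>R P - (M *\<^sub>R P - h)" by (simp add: algebra_simps)
    then have "sa_square (e *\<^sub>R P - (M *\<^sub>R P - h))" using hM by (simp only:)
    ultimately have "norm (M *\<^sub>R P - h) \<le> norm (e *\<^sub>R P)" by (rule norm_mono_diff)
    also have "\<dots> \<le> e" using e norm_cprojection_le[OF P] by (simp add: mult_left_le)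
    finally show ?thesis .
  qed
  note bound = this
  have "\<not> norm (M *\<^sub>R P - h) > 0"
  proof
    define N where "N = norm (M *\<^sub>R P - h)"
    assume "norm (M *\<^sub>R P - h) > 0"
    then have "0 < min (N / 2) (M / 2)" "min (N / 2) (M / 2) < M" "min (N / 2) (M / 2) < N"
      using M by (auto simp: min_less_iff_disj N_def)
    with bound[of "min (N / 2) (M / 2)"] show False by (simp add: N_def)
  qed
  then show ?thesis by (simp add: M_def)
qed simp

section \<open>Finite index and density\<close>

text \<open>With t = h h and r = 1 - t this is the scalar estimate (m + 1) t r^m \<le> 1 - r^(m+1),
  proved by induction: the gap grows by (m + 1) t t r^m in each step.\<close>

lemma norm_square_power_bound:
  fixes h :: "'a::unital_cstar_algebra"
  assumes h: "star h = h" "norm h \<le> 1"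
  shows "real (Suc m) * norm (h * h * (1 - h * h) ^ m) \<le> 1"
proof -
  define r where "r = 1 - h * h"
  have "norm (1 *\<^sub>R 1 - r) \<le> 1" using h by (simp add: r_def norm_sa_square power_le_one)
  moreover have "star r = r" by (simp add: r_def star_simps h)
  ultimately obtain s where s: "star s = s" "s * s = r"
    and comm: "\<And>y. y * r = r * y \<Longrightarrow> y * s = s * y" using sa_sqrt by metis
  have hs: "h * s = s * h" by (rule comm) (simp add: r_def algebra_simps)
  have hsn: "h * s ^ n = s ^ n * h" for n
    by (rule power_commuting_commutes[symmetric]) (simp add: hs)
  have sn: "star (s ^ n) = s ^ n" for n
    by (induction n) (simp_all add: star_mult s power_commutes)
  have rn: "r ^ n = s ^ n * s ^ n" for n
    by (simp add: power_mult_distrib power2_eq_square flip: s(2) power_mult power_add)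
      (metis mult_2 power2_eq_square power_add power_mult)
  have sq: "sa_square (h * h * r ^ n)" "sa_square (h * h * (h * h) * r ^ n)" "sa_square (r ^ n)" for n
  proof -
    have "h * h * r ^ n = (h * s ^ n) * (h * s ^ n)" "h * h * (h * h) * r ^ n = (h * h * s ^ n) * (h * h * s ^ n)"
      unfolding rn by (metis hsn mult.assoc)+
    moreover have "star (h * s ^ n) = h * s ^ n" "star (h * h * s ^ n) = h * h * s ^ n"
      by (simp_all add: star_mult h sn hsn mult.assoc) (metis hsn mult.assoc)
    ultimately show "sa_square (h * h * r ^ n)" "sa_square (h * h * (h * h) * r ^ n)" "sa_square (r ^ n)"
      unfolding rn using sa_squareI sn by metis+
  qed
  have pos: "sa_square (1 - r ^ Suc m - real (Suc m) *\<^sub>R (h * h * r ^ m))"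
  proof (induction m)
    case 0
    then show ?case by (simp add: r_def)
  next
    case (Suc m)
    have "1 - r ^ Suc (Suc m) - real (Suc (Suc m)) *\<^sub>R (h * h * r ^ Suc m)
        = (1 - r ^ Suc m - real (Suc m) *\<^sub>R (h * h * r ^ m))
          + real (Suc m) *\<^sub>R (h * h * (h * h) * r ^ m)"
    proof -
      have r1: "r * z = z - h * h * z" for z by (simp add: r_def algebra_simps)
      have "r ^ Suc (Suc m) = r ^ Suc m - h * h * r ^ Suc m" by (simp add: r1)
      moreover have "h * h * r ^ Suc m = h * h * r ^ m - h * h * (h * h) * r ^ m"
        by (simp add: r1 algebra_simps)
      moreover have "real (Suc (Suc m)) *\<^sub>R z = real (Suc m) *\<^sub>R z + z" for z :: 'a
        by (subst of_nat_Suc) (simp only: scaleR_add_left scaleR_one add.commute)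
      ultimately show ?thesis by (simp add: scaleR_diff_right del: of_nat_Suc power_Suc)
    qed
    then show ?case using sa_square_plus[OF Suc sa_square_scaleR[OF sq(2)]] by (metis of_nat_0_le_iff)
  qed
  have "sa_square (1 - real (Suc m) *\<^sub>R (h * h * r ^ m))"
    using sa_square_plus[OF pos sq(3)[of "Suc m"]] by (simp add: algebra_simps)
  then have "norm (real (Suc m) *\<^sub>R (h * h * r ^ m)) \<le> norm (1 :: 'a)"
    by (intro norm_mono_diff sa_square_scaleR sq) auto
  then show ?thesis by (simp add: r_def del: of_nat_Suc)
qed

text \<open>For contractive \<open>y\<close> and h = E(y \<open>star y\<close>), finite index gives
  y \<open>star y\<close> \<le> l h. So the square of the norm of r^n y is at most l times the norm
  of r^n h r^n, which tends to 0 for r = 1 - h h, while y - r^n y is of the form h v.\<close>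

lemma finite_index_nondegenerate:
  fixes y :: "'a::cstar_algebra"
  assumes E: "conditional_expectation E B" and l: "l \<ge> 1"
    and index: "positive_map (\<lambda>x. E x - inverse l *\<^sub>R x)" and e: "e > 0"
  obtains h v where "h \<in> B" "norm (y - h * v) < e"
proof -
  have contr: "\<exists>h\<in>B. \<exists>v. norm (y - h * v) < e" if y: "norm y \<le> 1" and e: "e > 0" for y e
  proof -
    define h where "h = E (y * star y)"
    have pos: "y * star y \<in> pos_cone UNIV" by (simp add: pos_cone_UNIV_iff sa_square_mult_star)
    have h: "sa_square h"
      using E pos unfolding conditional_expectation_def positive_map_def h_def
      by (metis image_subset_iff pos_cone_UNIV_iff)
    have hB: "h \<in> B" using E by (auto simp: conditional_expectation_def h_def)
    have hs: "star h = h" by (rule sa_square_star[OF h])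
    have "norm h \<le> norm (y * star y)" using E by (simp add: conditional_expectation_def h_def)
    then have hn: "norm h \<le> 1" using y by (simp add: cstar_identity' power_le_one order_trans)
    define H where "H = embed_unit h"
    define Y where "Y = embed_unit y"
    define r where "r = 1 - H * H"
    have Hs: "star H = H" "norm H \<le> 1" using hs hn by (simp_all add: H_def flip: embed_unit_simps)
    have rs: "star r = r" by (simp add: r_def star_simps Hs)
    have rns: "star (r ^ n) = r ^ n" for n
      by (induction n) (simp_all add: star_mult rs power_commutes)
    have rH: "H * r ^ n = r ^ n * H" for n
      by (rule power_commuting_commutes[symmetric]) (simp add: r_def algebra_simps)
    \<comment> \<open>r^n y, computed without the unit; the recursion shows that
      \<open>y - z n\<close> is a left multiple of \<open>h\<close>.\<close>
    define z where "z n = ((\<lambda>w. w - h * (h * w)) ^^ n) y" for n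
    have z0: "z 0 = y" and zS: "z (Suc n) = z n - h * (h * z n)" for n by (simp_all add: z_def)
    have ez: "embed_unit (z n) = r ^ n * Y" for n
      by (induction n) (simp_all add: z0 zS Y_def embed_unit_simps r_def H_def algebra_simps)
    have zv: "\<exists>v. z n = y - h * v" for n
    proof (induction n)
      case 0
      show ?case by (rule exI[of _ 0]) (simp add: z0)
    next
      case (Suc n)
      then obtain v where "z n = y - h * v" by blast
      then have "z (Suc n) = y - h * (v + h * z n)" by (simp add: zS algebra_simps)
      then show ?case by blast
    qed
    have "sa_square (h - inverse l *\<^sub>R (y * star y))"
      using index pos unfolding positive_map_def h_def by (metis image_subset_iff pos_cone_UNIV_iff)
    then have "sa_square (l *\<^sub>R (h - inverse l *\<^sub>R (y * star y)))" using l by (intro sa_square_scaleR) auto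
    then have "sa_square (l *\<^sub>R h - y * star y)" using l by (simp add: scaleR_diff_right)
    then have "sa_square (embed_unit (l *\<^sub>R h - y * star y))" by simp
    from sa_square_conj[OF this]
    have conj: "sa_square (l *\<^sub>R (r ^ n * H * r ^ n) - r ^ n * Y * star (r ^ n * Y))" for n
      by (metis (no_types, lifting) H_def Y_def embed_unit_simps(3,5,6,7) left_diff_distrib mult.assoc
          mult_scaleR_left mult_scaleR_right right_diff_distrib rns star_mult)
    have bound: "(norm (z n))\<^sup>2 \<le> l * sqrt (1 / real (Suc (4 * n)))" for n
    proof -
      have T: "star (r ^ n * H * r ^ n) = r ^ n * H * r ^ n" by (simp add: star_mult rns Hs mult.assoc)
      \<comment> \<open>The power bound concerns the square of \<open>H\<close>; squaring produces
        it, at the price of a square root in the rate.\<close>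
      have "(r ^ n * H * r ^ n) * (r ^ n * H * r ^ n) = H * H * r ^ (4 * n)"
      proof -
        have "H * (r ^ n * w) = r ^ n * (H * w)" for w using rH[of n] by (metis mult.assoc)
        moreover have "4 * n = n + (n + (n + n))" by simp
        then have "r ^ (4 * n) = r ^ n * (r ^ n * (r ^ n * r ^ n))" by (simp only: power_add)
        ultimately show ?thesis by (simp add: mult.assoc rH)
      qed
      then have "(norm (r ^ n * H * r ^ n))\<^sup>2 = norm (H * H * r ^ (4 * n))"
        using norm_sa_square[OF T] by simp
      also have "\<dots> \<le> 1 / real (Suc (4 * n))"
        using norm_square_power_bound[OF Hs, of "4 * n"] by (simp add: r_def field_simps del: of_nat_Suc)
      finally have "norm (r ^ n * H * r ^ n) \<le> sqrt (1 / real (Suc (4 * n)))" by (rule real_le_rsqrt)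
      moreover have "norm (r ^ n * Y * star (r ^ n * Y)) \<le> norm (l *\<^sub>R (r ^ n * H * r ^ n))"
        by (rule norm_mono_diff[OF sa_square_mult_star conj])
      moreover have "(norm (z n))\<^sup>2 = norm (r ^ n * Y * star (r ^ n * Y))"
        by (simp add: cstar_identity' flip: ez)
      ultimately show ?thesis using l by (simp del: of_nat_Suc) (meson mult_left_mono order_trans zero_le_one)
    qed
    have "(\<lambda>n. l * sqrt (1 / real (Suc (4 * n)))) \<longlonglongrightarrow> l * sqrt 0"
    proof (intro tendsto_mult tendsto_const tendsto_real_sqrt)
      have "strict_mono (\<lambda>n::nat. 4 * n)" by (simp add: strict_mono_def)
      from LIMSEQ_subseq_LIMSEQ[OF LIMSEQ_inverse_real_of_nat this]
      show "(\<lambda>n. 1 / real (Suc (4 * n))) \<longlonglongrightarrow> 0" by (simp add: o_def inverse_eq_divide)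
    qed
    then have "\<forall>\<^sub>F n in sequentially. l * sqrt (1 / real (Suc (4 * n))) < e\<^sup>2"
      using e by (intro order_tendstoD(2)) auto
    then obtain n where "l * sqrt (1 / real (Suc (4 * n))) < e\<^sup>2"
      using eventually_happens' sequentially_bot by blast
    with bound[of n] have "(norm (z n))\<^sup>2 < e\<^sup>2" by linarith
    then have "norm (z n) < e" by (rule power2_less_imp_less) (use e in simp)
    moreover obtain v where "z n = y - h * v" using zv by blast
    ultimately show ?thesis using hB by auto
  qed
  define N where "N = norm y + 1"
  have N: "N > 0" by (simp add: N_def add_nonneg_pos)
  have "norm ((1/N) *\<^sub>R y) \<le> 1" using N by (simp add: N_def)
  then obtain h v where hv: "h \<in> B" "norm ((1/N) *\<^sub>R y - h * v) < e / N"
    using contr[of "(1/N) *\<^sub>R y" "e / N"] e N by auto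
  have "N *\<^sub>R ((1/N) *\<^sub>R y - h * v) = y - h * (N *\<^sub>R v)" using N by (simp add: scaleR_diff_right)
  then have "norm (y - h * (N *\<^sub>R v)) = N * norm ((1/N) *\<^sub>R y - h * v)"
    using N by (metis abs_of_pos norm_scaleR)
  also have "\<dots> < e" using hv(2) N by (simp add: pos_less_divide_eq mult.commute)
  finally show thesis using that hv(1) by blast
qed

section \<open>Double centralizers and the index\<close>

text \<open>\<open>G\<close> is the graph of a densely defined contraction. Working with the graph
  avoids choosing a representation of each element: the norm bound on differences gives
  single-valuedness, and the closure of \<open>G\<close> is the graph of the extension.\<close>

lemma contraction_extension:
  fixes G :: "('a::cstar_algebra \<times> 'a) set"
  assumes add: "\<And>p q. p \<in> G \<Longrightarrow> q \<in> G \<Longrightarrow> p + q \<in> G"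
    and scale: "\<And>c x z. (x, z) \<in> G \<Longrightarrow> (c *\<^sub>C x, c *\<^sub>C z) \<in> G"
    and bound: "\<And>x z. (x, z) \<in> G \<Longrightarrow> norm z \<le> norm x"
    and dense: "closure (fst ` G) = UNIV"
  obtains L where "\<And>x. (x, L x) \<in> closure G" "\<And>x z. (x, z) \<in> closure G \<Longrightarrow> z = L x"
    "\<And>x. norm (L x) \<le> norm x"
proof -
  have diff: "(x - x', z - z') \<in> G" if G: "(x, z) \<in> G" "(x', z') \<in> G" for x x' z z'
    using add[OF G(1) scale[OF G(2), of "-1"]] by simp
  have "closed {p :: 'a \<times> 'a. norm (snd p) \<le> norm (fst p)}"
    by (intro closed_Collect_le continuous_intros)
  then have "closure G \<subseteq> {p. norm (snd p) \<le> norm (fst p)}"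
    by (intro closure_minimal) (auto dest: bound)
  then have cl_bound: "norm z \<le> norm x" if "(x, z) \<in> closure G" for x z using that by auto
  have cl_unique: "z = z'" if z: "(x, z) \<in> closure G" "(x, z') \<in> closure G" for x z z'
  proof -
    obtain f f' where f: "\<forall>n. f n \<in> G" "f \<longlonglongrightarrow> (x, z)" "\<forall>n. f' n \<in> G" "f' \<longlonglongrightarrow> (x, z')"
      using z by (meson closure_sequential)
    have "f n - f' n \<in> G" for n
      using diff[of "fst (f n)" "snd (f n)" "fst (f' n)" "snd (f' n)"] f(1,3) by (simp add: minus_prod_def)
    moreover have "(\<lambda>n. f n - f' n) \<longlonglongrightarrow> (x, z) - (x, z')" by (intro tendsto_diff f)
    ultimately have "(x, z) - (x, z') \<in> closure G"
      unfolding closure_sequential by (intro exI[of _ "\<lambda>n. f n - f' n"]) simp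
    then show ?thesis using cl_bound[of 0 "z - z'"] by simp
  qed
  have ex: "\<exists>z. (x, z) \<in> closure G" for x
  proof -
    have "x \<in> closure (fst ` G)" using dense by simp
    then obtain f where f: "\<forall>n. f n \<in> fst ` G" "f \<longlonglongrightarrow> x" by (meson closure_sequential)
    have "\<forall>n. \<exists>w. (f n, w) \<in> G" using f(1) by (force simp: image_iff)
    then obtain g where g: "\<And>n. (f n, g n) \<in> G" by metis
    have "Cauchy g"
      unfolding Cauchy_def dist_norm
    proof (intro allI impI)
      fix e :: real assume "e > 0"
      then obtain M where M: "\<forall>m\<ge>M. \<forall>n\<ge>M. norm (f m - f n) < e"
        using LIMSEQ_imp_Cauchy[OF f(2)] unfolding Cauchy_def dist_norm by blast
      have "norm (g m - g n) < e" if "m \<ge> M" "n \<ge> M" for m n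
        using M that bound[OF diff[OF g[of m] g[of n]]] by fastforce
      then show "\<exists>M. \<forall>m\<ge>M. \<forall>n\<ge>M. norm (g m - g n) < e" by blast
    qed
    then obtain z where "g \<longlonglongrightarrow> z" by (auto simp: Cauchy_convergent_iff convergent_def)
    then have "(\<lambda>n. (f n, g n)) \<longlonglongrightarrow> (x, z)" by (intro tendsto_Pair f)
    then show ?thesis
      unfolding closure_sequential using g by (intro exI[of _ z] exI[of _ "\<lambda>n. (f n, g n)"]) simp
  qed
  define L where "L x = (SOME z. (x, z) \<in> closure G)" for x
  have L: "(x, L x) \<in> closure G" for x unfolding L_def by (rule someI_ex) (rule ex)
  show thesis
    by (rule that[of L]) (use L cl_unique cl_bound in blast)+
qed

text \<open>
  A projection \<open>g\<close> commuting with \<open>\<rho>(P A P)\<close> extends to the double centralizer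
  \<open>\<rho>(x) \<rho>(P) y \<mapsto> \<rho>(x) g y\<close>, which commutes with \<open>\<rho>(A)\<close>.
\<close>

lemma irreducible_corner:
  fixes \<rho> :: "'a::cstar_algebra \<Rightarrow> 'a"
  assumes \<rho>: "star_endomorphism \<rho>" and irr: "irreducible_endo \<rho>" and P: "cprojection P"
    and dense: "closure (range (\<lambda>ps. \<Sum>(x, y)\<leftarrow>ps. \<rho> x * \<rho> P * y)) = UNIV"
    and g: "cprojection g" "g \<noteq> 0" "g * \<rho> P = g"
    and comm: "\<And>x. P * x = x \<Longrightarrow> x * P = x \<Longrightarrow> g * \<rho> x = \<rho> x * g"
  shows "g = \<rho> P"
proof -
  note rho [simp] = star_endomorphismD[OF \<rho>]
  note [simp del] = rho(6)
  have \<rho>P: "cprojection (\<rho> P)" by (rule cprojection_star_endomorphism[OF \<rho> P])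
  have Pg: "\<rho> P * g = g" using g \<rho>P by (metis cprojection_star star_mult)
  \<comment> \<open>\<open>g\<close> commutes with the compression \<rho>(P w P), so one of the two
    factors \<open>g\<close> can be replaced by \<open>\<rho> P\<close>. This makes the assignment
    of \<open>F2\<close> to \<open>F1\<close> symmetric.\<close>
  have key: "g * \<rho> w * g = \<rho> P * \<rho> w * g" for w
  proof -
    have "g * \<rho> w * g = g * (\<rho> P * \<rho> w * \<rho> P) * g" using g(3) Pg by (metis mult.assoc)
    also have "\<rho> P * \<rho> w * \<rho> P = \<rho> (P * w * P)" by (simp add: rho(6))
    also have "g * \<rho> (P * w * P) = \<rho> (P * w * P) * g"
      using P by (intro comm) (simp_all add: mult.assoc cprojection_absorb)
    also have "\<dots> * g = \<rho> P * \<rho> w * g" using g(1) Pg by (simp add: rho(6) mult.assoc)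
    finally show ?thesis .
  qed
  define f1 where "f1 p = \<rho> (fst p) * \<rho> P * snd p" for p :: "'a \<times> 'a"
  define f2 where "f2 p = \<rho> (fst p) * g * snd p" for p :: "'a \<times> 'a"
  define F1 where "F1 ps = (\<Sum>p\<leftarrow>ps. f1 p)" for ps
  define F2 where "F2 ps = (\<Sum>p\<leftarrow>ps. f2 p)" for ps
  have F_simps: "F1 [] = 0" "F1 (p # ps) = f1 p + F1 ps" "F2 [] = 0" "F2 (p # ps) = f2 p + F2 ps" for p ps
    by (simp_all add: F1_def F2_def)
  have gen: "star (f2 p) * f2 q = star (f1 p) * f2 q" for p q
  proof -
    have "star (f2 p) * f2 q = star (snd p) * (g * \<rho> (star (fst p) * fst q) * g) * snd q"
      using g(1) by (simp add: f2_def star_mult rho(6) mult.assoc)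
    also have "\<dots> = star (f1 p) * f2 q"
      unfolding key using \<rho>P by (simp add: f1_def f2_def star_mult rho(6) mult.assoc)
    finally show ?thesis .
  qed
  have gen2: "star (f2 p) * F2 qs = star (f1 p) * F2 qs" for p qs
    by (induction qs) (simp_all add: F_simps distrib_left gen)
  have sym: "star (F2 ps) * F2 qs = star (F1 ps) * F2 qs" for ps qs
    by (induction ps) (simp_all add: F_simps star_add distrib_right gen2)
  have sym': "star (F2 ps) * F1 qs = star (F1 ps) * F2 qs" for ps qs
  proof -
    have "star (F2 ps) * F2 qs = star (F2 ps) * F1 qs"
      using arg_cong[OF sym[of qs ps], of star] by (simp add: star_mult star_star)
    from trans[OF this[symmetric] sym] show ?thesis .
  qed
  define G where "G = range (\<lambda>ps. (F1 ps, F2 ps))"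
  have G_add: "p + q \<in> G" if pq: "p \<in> G" "q \<in> G" for p q
  proof -
    obtain ps qs where "p = (F1 ps, F2 ps)" "q = (F1 qs, F2 qs)" using pq by (auto simp: G_def)
    then have "p + q = (F1 (ps @ qs), F2 (ps @ qs))" by (simp add: F1_def F2_def)
    then show ?thesis by (simp add: G_def)
  qed
  have G_map: "(T x, T z) \<in> G"
    if T: "\<And>a b. T (a + b) = T a + T b" "T 0 = 0" "\<And>p. T (f1 p) = f1 (m p)" "\<And>p. T (f2 p) = f2 (m p)"
      and xz: "(x, z) \<in> G" for T m x z
  proof -
    obtain ps where ps: "x = F1 ps" "z = F2 ps" using xz by (auto simp: G_def)
    have "T (F1 ps) = F1 (map m ps)" "T (F2 ps) = F2 (map m ps)" for ps
      by (induction ps) (simp_all add: F1_def F2_def T)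
    then show ?thesis by (auto simp: G_def ps)
  qed
  have G_scale: "(c *\<^sub>C x, c *\<^sub>C z) \<in> G" if "(x, z) \<in> G" for c x z
    by (rule G_map[where m = "\<lambda>p. (c *\<^sub>C fst p, snd p)", OF _ _ _ _ that])
      (simp_all add: scaleC_add_right f1_def f2_def mult_scaleC_left)
  have G_right: "(x * w, z * w) \<in> G" if "(x, z) \<in> G" for w x z
    by (rule G_map[where m = "\<lambda>p. (fst p, snd p * w)", OF _ _ _ _ that])
      (simp_all add: distrib_right f1_def f2_def mult.assoc)
  have G_left: "(\<rho> w * x, \<rho> w * z) \<in> G" if "(x, z) \<in> G" for w x z
    by (rule G_map[where m = "\<lambda>p. (w * fst p, snd p)", OF _ _ _ _ that])
      (simp_all add: distrib_left f1_def f2_def mult.assoc rho(6))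
  \<comment> \<open>Symmetry gives \<open>star z * z = star x * z\<close>, as for an orthogonal
    projection z of x.\<close>
  have G_bound: "norm z \<le> norm x" if xz: "(x, z) \<in> G" for x z
  proof -
    obtain ps where ps: "x = F1 ps" "z = F2 ps" using xz by (auto simp: G_def)
    have "norm z * norm z = norm (star x * z)"
      using cstar_identity[of z] sym[of ps ps] by (simp add: ps power2_eq_square)
    also have "\<dots> \<le> norm x * norm z" using norm_mult_ineq[of "star x" z] by simp
    finally show ?thesis by (cases "z = 0") auto
  qed
  have "fst ` G = range (\<lambda>ps. \<Sum>(x, y)\<leftarrow>ps. \<rho> x * \<rho> P * y)"
    by (simp add: G_def F1_def f1_def image_image case_prod_unfold)
  then have G_dense: "closure (fst ` G) = UNIV" using dense by simp
  obtain L where L: "\<And>x. (x, L x) \<in> closure G" "\<And>x z. (x, z) \<in> closure G \<Longrightarrow> z = L x"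
    "\<And>x. norm (L x) \<le> norm x"
    using contraction_extension[OF G_add G_scale G_bound G_dense] by blast
  have L_map: "T (L x) = L (T x)"
    if T: "bounded_linear T" "\<And>x z. (x, z) \<in> G \<Longrightarrow> (T x, T z) \<in> G" for T x
  proof -
    have "bounded_linear (\<lambda>p :: 'a \<times> 'a. (T (fst p), T (snd p)))"
      by (intro bounded_linear_Pair bounded_linear_compose[OF T(1)] bounded_linear_fst bounded_linear_snd)
    from closure_image_bounded_linear[OF this _ L(1)[of x], of G]
    have "(T (L x)) = L (T x)" using T(2) L(2) by auto
    then show ?thesis .
  qed
  have L_add: "L (x + y) = L x + L y" for x y
    using L(2)[of "x + y" "L x + L y"] closure_additive[OF G_add L(1)[of x] L(1)[of y]] by simp
  have L_scale: "L (c *\<^sub>C x) = c *\<^sub>C L x" for c x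
    by (rule L_map[symmetric, OF bounded_linear_scaleC G_scale])
  have L_right: "L (x * w) = L x * w" for x w
    by (rule L_map[symmetric, OF bounded_linear_mult_left G_right])
  have L_left: "L (\<rho> w * x) = \<rho> w * L x" for x w
    by (rule L_map[symmetric, OF bounded_linear_mult_right G_left])
  have L_sym: "star (L x) * y = star x * L y" for x y
  proof -
    obtain f where f: "\<forall>n. f n \<in> G" "f \<longlonglongrightarrow> (x, L x)" using L(1)[of x] by (meson closure_sequential)
    obtain h where h: "\<forall>n. h n \<in> G" "h \<longlonglongrightarrow> (y, L y)" using L(1)[of y] by (meson closure_sequential)
    have "star (snd (f n)) * fst (h n) = star (fst (f n)) * snd (h n)" for n
    proof -
      obtain ps qs where "f n = (F1 ps, F2 ps)" "h n = (F1 qs, F2 qs)"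
        using f(1) h(1) unfolding G_def by (metis (no_types, lifting) imageE)
      then show ?thesis by (simp add: sym')
    qed
    moreover have "(\<lambda>n. star (snd (f n)) * fst (h n)) \<longlonglongrightarrow> star (L x) * y"
      using tendsto_mult[OF tendsto_star[OF tendsto_snd[OF f(2)]] tendsto_fst[OF h(2)]] by simp
    moreover have "(\<lambda>n. star (fst (f n)) * snd (h n)) \<longlonglongrightarrow> star x * L y"
      using tendsto_mult[OF tendsto_star[OF tendsto_fst[OF f(2)]] tendsto_snd[OF h(2)]] by simp
    ultimately show ?thesis using LIMSEQ_unique by simp
  qed
  \<comment> \<open>The adjoint of \<open>L\<close>; \<open>L_sym\<close> is exactly the
    compatibility of the two halves of a double centralizer.\<close>
  define R where "R x = star (L (star x))" for x
  have R_add: "R (x + y) = R x + R y" for x y by (simp add: R_def star_add L_add)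
  have R_scale: "R (c *\<^sub>C x) = c *\<^sub>C R x" for c x by (simp add: R_def star_scaleC L_scale)
  have clin: "clinear T"
    if "\<And>x y. T (x + y) = T x + T y" "\<And>c x. T (c *\<^sub>C x) = c *\<^sub>C T x" for T :: "'a \<Rightarrow> 'a"
    unfolding clinear_def by unfold_locales (use that in auto)
  have bl: "bounded_linear T"
    if "\<And>x y. T (x + y) = T x + T y" "\<And>c x. T (c *\<^sub>C x) = c *\<^sub>C T x" "\<And>x. norm (T x) \<le> norm x"
    for T :: "'a \<Rightarrow> 'a"
    by (rule bounded_linear_intro[where K = 1]) (simp_all add: that scaleR_scaleC)
  have "(L, R) \<in> multiplier_algebra"
  proof -
    have "R x * y = x * L y" for x y by (simp add: R_def L_sym star_star)
    moreover have "R (x * y) = x * R y" for x y by (simp add: R_def star_simps L_right)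
    moreover have "norm (R x) \<le> norm x" for x using L(3)[of "star x"] by (simp add: R_def)
    ultimately show ?thesis unfolding multiplier_algebra_def
      using clin[of L] clin[of R] bl[of L] bl[of R] L_add L_scale L(3) R_add R_scale L_right by blast
  qed
  moreover have "mult_M (L, R) (embed_M b) = mult_M (embed_M b) (L, R)" if b: "b \<in> range \<rho>" for b
  proof -
    obtain w where w: "b = \<rho> w" using b by blast
    have "R (x * \<rho> w) = R x * \<rho> w" for x
    proof -
      have "star (x * \<rho> w) = \<rho> (star w) * star x" by (simp add: star_mult)
      then have "R (x * \<rho> w) = star (\<rho> (star w) * L (star x))" by (simp only: R_def L_left)
      then show ?thesis by (simp add: R_def star_simps)
    qed
    then show ?thesis by (simp add: mult_M_def embed_M_def w fun_eq_iff L_left)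
  qed
  ultimately have "(L, R) \<in> range scalar_M" using irr unfolding irreducible_endo_def by blast
  then obtain c where c: "\<And>x. L x = c *\<^sub>C x" by (auto simp: scalar_M_def)
  have "(F1 [(P, w)], F2 [(P, w)]) \<in> closure G" for w
    by (rule subsetD[OF closure_subset]) (auto simp: G_def)
  then have "L (\<rho> P * w) = g * w" for w
    using L(2)[of "\<rho> P * w" "g * w"] \<rho>P by (simp add: F1_def F2_def f1_def f2_def Pg)
  then have gw: "g * w = c *\<^sub>C (\<rho> P * w)" for w by (simp add: c)
  from gw[of g] have "g = c *\<^sub>C g" using g(1) by (simp add: Pg)
  then have "(1 - c) *\<^sub>C g = 0" by (simp add: cvec.scale_left_diff_distrib)
  then have "c = 1" using g(2) by simp
  then show ?thesis using gw[of "\<rho> P"] g(3) \<rho>P by simp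
qed

text \<open>Finite index makes the products of elements of \<rho>(A) and \<open>A\<close> dense.
  Simplicity approximates the argument of \<rho> by sums of \<open>x * P * y\<close>, and
  \<open>\<rho> y\<close> is absorbed into the right factor.\<close>

lemma corner_range_dense:
  fixes \<rho> :: "'a::cstar_algebra \<Rightarrow> 'a"
  assumes si: "simple_cstar TYPE('a)" and \<rho>: "star_endomorphism \<rho>"
    and E: "conditional_expectation E (range \<rho>)" and l: "l \<ge> 1"
    and index: "positive_map (\<lambda>x. E x - inverse l *\<^sub>R x)" and P: "cprojection P" "P \<noteq> 0"
  shows "closure (range (\<lambda>ps. \<Sum>(x, y)\<leftarrow>ps. \<rho> x * \<rho> P * y)) = UNIV"
proof -
  note rho = star_endomorphismD[OF \<rho>]
  let ?F = "\<lambda>ps. \<Sum>(x, y)\<leftarrow>ps. \<rho> x * \<rho> P * y"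
  have "\<exists>ps. norm (?F ps - z) < e" if e: "e > 0" for z e
  proof -
    obtain h v where "h \<in> range \<rho>" and hv: "norm (z - h * v) < e / 2"
      using finite_index_nondegenerate[OF E l index, of "e / 2"] e by auto
    then obtain w where w: "h = \<rho> w" by blast
    define N where "N = norm v + 1"
    have N: "N > 0" "norm v \<le> N" by (simp_all add: N_def add_nonneg_pos)
    obtain ps where ps: "norm (w - (\<Sum>(x, y)\<leftarrow>ps. x * P * y)) < e / (2 * N)"
      using simple_approx[OF si P, of "e / (2 * N)" w] e N by auto
    let ?s = "\<Sum>(x, y)\<leftarrow>ps. x * P * y"
    have F: "?F (map (\<lambda>(x, y). (x, \<rho> y * v)) ps) = \<rho> ?s * v"
      by (induction ps) (auto simp: rho distrib_right mult.assoc)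
    have "norm (\<rho> w * v - \<rho> ?s * v) = norm (\<rho> (w - ?s) * v)" by (simp add: rho left_diff_distrib)
    also have "\<dots> \<le> norm (w - ?s) * N"
      using star_endomorphism_norm_le[OF \<rho>, of "w - ?s"] N
      by (intro order_trans[OF norm_mult_ineq] mult_mono) auto
    also have "\<dots> < e / (2 * N) * N" using ps N by (intro mult_strict_right_mono) auto
    also have "\<dots> = e / 2" using N by simp
    finally have "norm (\<rho> w * v - \<rho> ?s * v) < e / 2" .
    moreover have "norm (\<rho> ?s * v - z) \<le> norm (\<rho> w * v - \<rho> ?s * v) + norm (z - \<rho> w * v)"
      using norm_triangle_ineq[of "\<rho> w * v - \<rho> ?s * v" "z - \<rho> w * v"] by (simp add: norm_minus_commute)
    ultimately have "norm (?F (map (\<lambda>(x, y). (x, \<rho> y * v)) ps) - z) < e"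
      unfolding F using hv by (simp add: w)
    then show ?thesis by blast
  qed
  then have "z \<in> closure (range ?F)" for z unfolding closure_approachable dist_norm by blast
  then show ?thesis by blast
qed

lemma intertwiner_imp_expectation_id:
  fixes \<rho> :: "'a::cstar_algebra \<Rightarrow> 'a"
  assumes si: "simple_cstar TYPE('a)" and pi: "purely_infinite TYPE('a)"
    and \<rho>: "star_endomorphism \<rho>" and irr: "irreducible_endo \<rho>"
    and E: "conditional_expectation E (range \<rho>)" and l: "l \<ge> 1"
    and index: "positive_map (\<lambda>x. E x - inverse l *\<^sub>R x)" and P: "cprojection P" "P \<noteq> 0"
    and b: "P * b = b" "b * \<rho> P = b" "b \<noteq> 0"
      "\<And>x. P * x = x \<Longrightarrow> x * P = x \<Longrightarrow> x * b = b * \<rho> x"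
  shows "E z = z"
proof -
  note rho [simp] = star_endomorphismD[OF \<rho>]
  have \<rho>P: "cprojection (\<rho> P)" by (rule cprojection_star_endomorphism[OF \<rho> P(1)])
  have bs: "\<rho> x * star b = star b * x" if x: "P * x = x" "x * P = x" for x
  proof -
    have "star x * P = star x" "P * star x = star x" using x P(1) by (metis cprojection_star star_mult)+
    then have "star (star x * b) = star (b * \<rho> (star x))" using b(4) by metis
    then show ?thesis by (simp add: star_simps)
  qed
  define M where "M = norm (b * star b)"
  have bb: "b * star b = M *\<^sub>R P" unfolding M_def
  proof (rule central_positive_scalar[OF si pi P(1)])
    show "sa_square (b * star b)" by (rule sa_square_mult_star)
    show "P * (b * star b) = b * star b" using b(1) by (simp flip: mult.assoc)
    fix x assume x: "P * x = x" "x * P = x"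
    have "x * (b * star b) = b * (\<rho> x * star b)" using b(4)[OF x] by (simp flip: mult.assoc)
    then show "x * (b * star b) = b * star b * x" by (simp add: bs[OF x] mult.assoc)
  qed
  have M: "M > 0" using b(3) by (simp add: M_def cstar_identity')
  have bPs: "\<rho> P * star b = star b" using b(2) \<rho>P by (metis cprojection_star star_mult)
  have sbP: "star b * P = star b" using b(1) P(1) by (metis cprojection_star star_mult)
  define g where "g = (1/M) *\<^sub>R (star b * b)"
  have "star b * b * (star b * b) = star b * (b * star b) * b" by (simp add: mult.assoc)
  also have "\<dots> = M *\<^sub>R (star b * b)" by (simp add: bb b(1) sbP)
  finally have g: "cprojection g" unfolding cprojection_def g_def using M by (simp add: star_simps)
  have "g = \<rho> P"
  proof (rule irreducible_corner[OF \<rho> irr P(1) corner_range_dense[OF si \<rho> E l index P] g])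
    show "g \<noteq> 0" using M b(3) by (simp add: g_def)
    show "g * \<rho> P = g" using b(2) by (simp add: g_def mult.assoc)
    fix x assume x: "P * x = x" "x * P = x"
    have "star b * b * \<rho> x = star b * x * b" using b(4)[OF x] by (simp add: mult.assoc)
    also have "\<dots> = \<rho> x * (star b * b)" using bs[OF x] by (simp flip: mult.assoc)
    finally show "g * \<rho> x = \<rho> x * g" by (simp add: g_def)
  qed
  then have star_bb: "star b * b = M *\<^sub>R \<rho> P" using M by (simp add: g_def) (metis scaleR_scaleR divide_self_if less_irrefl mult.commute scaleR_one times_divide_eq_right mult_1_right)
  have corner: "y \<in> range \<rho>" if y: "\<rho> P * y = y" "y * \<rho> P = y" for y
  proof -
    \<comment> \<open>Conjugation by \<open>b\<close> inverts \<rho> on the corner, up to the scale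
      \<open>M\<close>.\<close>
    define x where "x = (1/M) *\<^sub>R (b * y * star b)"
    have x: "P * x = x" "x * P = x"
      by (simp_all add: x_def mult.assoc sbP) (simp add: b(1) flip: mult.assoc)
    have "M *\<^sub>R \<rho> x = star b * b * \<rho> x"
      unfolding star_bb using x(1) by (simp flip: star_endomorphismD(6)[OF \<rho>])
    also have "\<dots> = star b * x * b" using b(4)[OF x] by (simp add: mult.assoc)
    also have "\<dots> = (1/M) *\<^sub>R ((star b * b) * y * (star b * b))" by (simp add: x_def mult.assoc)
    also have "\<dots> = M *\<^sub>R y" using y M by (simp add: star_bb mult.assoc)
    finally have "y = \<rho> x" using M by simp
    then show ?thesis by blast
  qed
  have El: "clinear E" "\<And>y. y \<in> range \<rho> \<Longrightarrow> E y = y"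
    "\<And>x y. x \<in> range \<rho> \<Longrightarrow> E (x * y) = x * E y" "\<And>x y. x \<in> range \<rho> \<Longrightarrow> E (y * x) = E y * x"
    "\<And>x. norm (E x) \<le> norm x"
    using E unfolding conditional_expectation_def by blast+
  interpret El: Vector_Spaces.linear scaleC scaleC E using El(1) by (simp add: clinear_def)
  have Ebl: "bounded_linear E"
    by (rule bounded_linear_intro[where K = 1]) (simp_all add: El.add El.scale El(5) scaleR_scaleC)
  note E_cont = bounded_linear.continuous_on[OF Ebl]
  let ?F = "\<lambda>ps. \<Sum>(x, y)\<leftarrow>ps. \<rho> x * \<rho> P * y"
  \<comment> \<open>One generator times the adjoint of another has its middle factor in the corner
    of \<open>\<rho> P\<close>, hence lies in \<rho>(A). Density in each factor separately then
    shows that \<open>E\<close> fixes all products.\<close>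
  have gen: "E ((\<rho> x * \<rho> P * y) * star (\<rho> x' * \<rho> P * y')) = (\<rho> x * \<rho> P * y) * star (\<rho> x' * \<rho> P * y')"
    for x y x' y'
  proof -
    define w where "w = \<rho> P * y * star y' * \<rho> P"
    have "(\<rho> x * \<rho> P * y) * star (\<rho> x' * \<rho> P * y') = \<rho> x * (w * \<rho> (star x'))"
      using \<rho>P by (simp add: w_def star_mult mult.assoc)
    moreover have "w \<in> range \<rho>"
      by (rule corner) (use \<rho>P in \<open>simp_all add: w_def mult.assoc cprojection_absorb\<close>)
    then obtain v where "w = \<rho> v" by blast
    ultimately have "(\<rho> x * \<rho> P * y) * star (\<rho> x' * \<rho> P * y') = \<rho> (x * (v * star x'))" by simp
    then show ?thesis using El(2)[OF rangeI[of \<rho> "x * (v * star x')"]] by (simp only:)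
  qed
  have gen2: "E ((\<rho> x * \<rho> P * y) * star (?F qs)) = (\<rho> x * \<rho> P * y) * star (?F qs)" for x y qs
    by (induction qs) (auto simp: star_add distrib_left El.add gen simp del: star_mult rho)
  have FF: "E (?F ps * star (?F qs)) = ?F ps * star (?F qs)" for ps qs
    by (induction ps) (auto simp: distrib_right El.add gen2 simp del: rho)
  have dense: "closure (range ?F) = UNIV" by (rule corner_range_dense[OF si \<rho> E l index P])
  have F1: "E (y * star (?F qs)) = y * star (?F qs)" for y qs
  proof -
    have "closed {y. E (y * star (?F qs)) = y * star (?F qs)}"
      by (intro closed_Collect_eq E_cont continuous_on_mult continuous_on_id continuous_on_const)
    then have "closure (range ?F) \<subseteq> {y. E (y * star (?F qs)) = y * star (?F qs)}"
      by (intro closure_minimal) (use FF in blast)+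
    then show ?thesis using dense by blast
  qed
  have prod: "E (y * star y') = y * star y'" for y y'
  proof -
    have "closed {y'. E (y * star y') = y * star y'}"
      by (intro closed_Collect_eq E_cont continuous_on_mult continuous_on_star continuous_on_id continuous_on_const)
    then have "closure (range ?F) \<subseteq> {y'. E (y * star y') = y * star y'}"
      by (intro closure_minimal) (use F1 in blast)+
    then show ?thesis using dense by blast
  qed
  have sums: "E (\<Sum>(x, y)\<leftarrow>ps. x * P * y) = (\<Sum>(x, y)\<leftarrow>ps. x * P * y)" for ps
  proof (induction ps)
    case (Cons p ps)
    then show ?case using prod[of "fst p * P" "star (snd p)"] by (simp add: case_prod_unfold El.add star_star)
  qed simp
  have "closed {z. E z = z}" by (intro closed_Collect_eq E_cont continuous_on_id)
  then have "closure (range (\<lambda>ps. \<Sum>(x, y)\<leftarrow>ps. x * P * y)) \<subseteq> {z. E z = z}"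
    by (intro closure_minimal) (use sums in blast)+
  moreover have "z \<in> closure (range (\<lambda>ps. \<Sum>(x, y)\<leftarrow>ps. x * P * y))"
    unfolding closure_approachable dist_norm
  proof (intro allI impI)
    fix e :: real assume "e > 0"
    then obtain ps where "norm (z - (\<Sum>(x, y)\<leftarrow>ps. x * P * y)) < e" using simple_approx[OF si P] by blast
    then show "\<exists>y\<in>range (\<lambda>ps. \<Sum>(x, y)\<leftarrow>ps. x * P * y). norm (y - z) < e"
      by (auto simp: norm_minus_commute)
  qed
  ultimately show ?thesis by blast
qed

theorem corollary3p4:
  fixes \<rho> :: "'a::cstar_algebra \<Rightarrow> 'a"
  assumes "separable_space (euclidean :: 'a topology)"
    and "simple_cstar TYPE('a)"
    and "purely_infinite TYPE('a)"
    and "\<rho> \<in> End0"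
    and "irreducible_endo \<rho>"
    and "stat_dim \<rho> > 1"
  shows "properly_outer \<rho>"
proof (rule ccontr)
  assume "\<not> properly_outer \<rho>"
  then obtain a C where C: "hereditary_subalgebra C" "C \<noteq> {0}"
    and inf: "Inf {norm (c * a * \<rho> c) | c. c \<in> pos_cone C \<and> norm c = 1} \<noteq> 0"
    unfolding properly_outer_def by blast
  define S where "S = {norm (c * a * \<rho> c) | c. c \<in> pos_cone C \<and> norm c = 1}"
  define \<delta> where "\<delta> = Inf S"
  obtain P where P: "P \<in> C" "infinite_projection P"
    using assms(3) C unfolding purely_infinite_def by blast
  have P': "cprojection P" "P \<noteq> 0"
    using P infinite_projection_nonzero by (auto simp: infinite_projection_def)
  \<comment> \<open>Heredity puts every projection below \<open>P\<close> into \<open>C\<close>, so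
    it competes in the infimum and \<delta> bounds it from below.\<close>
  have mem: "norm (q * a * \<rho> q) \<in> S" if q: "cprojection q" "q \<noteq> 0" "P * q = q" for q
  proof -
    have qP: "q * P = q" using q P' by (metis cprojection_star star_mult)
    have "P - q = star (P - q) * (P - q)" using q P' qP by (simp add: star_diff algebra_simps)
    then have "cstar_le q P" by (auto simp: cstar_le_def pos_cone_def)
    moreover have "P \<in> pos_cone C" unfolding pos_cone_def using P P' by (auto intro!: exI[of _ P])
    moreover have "q \<in> pos_cone UNIV" unfolding pos_cone_def using q by (auto intro!: exI[of _ q])
    ultimately have "q \<in> C" using C(1) unfolding hereditary_subalgebra_def by blast
    then have "q \<in> pos_cone C" unfolding pos_cone_def using q by (auto intro!: exI[of _ q])
    then show ?thesis unfolding S_def using norm_cprojection[OF q(1,2)] by blast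
  qed
  have "0 \<le> \<delta>" unfolding \<delta>_def by (rule cInf_greatest) (use mem[OF P'] P'(1) in \<open>auto simp: S_def\<close>)
  then have \<delta>: "\<delta> > 0" using inf by (simp add: \<delta>_def S_def)
  have "bdd_below S" by (rule bdd_belowI[of _ 0]) (auto simp: S_def)
  then have low: "\<delta> \<le> norm (q * a * \<rho> q)" if "cprojection q" "q \<noteq> 0" "P * q = q" for q
    unfolding \<delta>_def using mem[OF that] by (rule cInf_lower[rotated])
  obtain E where \<rho>: "star_endomorphism \<rho>" and E: "conditional_expectation E (range \<rho>)" "Ind E < \<infinity>"
    using assms(4) by (auto simp: End0_def)
  obtain l where l: "l \<ge> 1" "positive_map (\<lambda>x. E x - inverse l *\<^sub>R x)"
    using E(2) unfolding Ind_def Inf_less_iff by blast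
  obtain b where b: "P * b = b" "b * \<rho> P = b" "\<delta> \<le> norm b"
    "\<And>x. P * x = x \<Longrightarrow> x * P = x \<Longrightarrow> x * b = b * \<rho> x"
    using exact_intertwiner[OF assms(2,3) \<rho> P' low] by blast
  have "b \<noteq> 0" using b(3) \<delta> by auto
  then have "E z = z" for z
    by (rule intertwiner_imp_expectation_id[OF assms(2,3) \<rho> assms(5) E(1) l P' b(1,2) _ b(4)])
  then have "positive_map (\<lambda>x. E x - inverse 1 *\<^sub>R x)"
    by (auto simp: positive_map_def pos_cone_UNIV_iff)
  then have "Ind E \<le> ereal 1" unfolding Ind_def by (intro Inf_lower) auto
  moreover have "min_index (range \<rho>) \<le> Ind E" unfolding min_index_def by (intro Inf_lower) (use E in blast)
  \<comment> \<open>Only constants l \<ge> 1 compete in \<open>Ind\<close>; so the minimal index is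
    exactly 1, which contradicts dimension above 1.\<close>
  moreover have "ereal 1 \<le> Ind E'" for E' :: "'a \<Rightarrow> 'a" unfolding Ind_def by (intro Inf_greatest) auto
  then have "ereal 1 \<le> min_index (range \<rho>)" unfolding min_index_def by (intro Inf_greatest) auto
  ultimately have "min_index (range \<rho>) = ereal 1" by (meson antisym order_trans)
  then show False using assms(6) by (simp add: stat_dim_def)
qed

end
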